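(* Let $q\in[0,2)$ and let $k^*_q=k^*_q(s,p,r,n,\lambda)$ be the effective dimension. Observe a $2n\times p$ matrix $\mathbf{X}$ from the spiked model with $\sigma=1$ and let $\widehat{\mathbf{V}}_*$ be the aggregated estimator. There exist constants $C_0$ (sufficiently large) and $C$, depending only on $\kappa$ and $q$, such that if \[ \lambda\ge C_0\sqrt{\frac{\log n}{n}},\qquad nh(\lambda)\ge C_0k^*_q\Bigl(r+\log\frac{\mathrm{e}p}{k^*_q}\Bigr),\qquad n\ge C_0\Bigl(k^*_q\log\frac{\mathrm{e}p}{k^*_q}\vee\log\lambda\Bigr), \] then \[ \sup_{\boldsymbol{\Sigma}\in\Theta_q(s,p,r,\lambda)}\mathsf{E}\bigl\|\widehat{\mathbf{V}}_*\widehat{\mathbf{V}}_*'-\mathbf{V}\mathbf{V}'\bigr\|_{\mathrm F}^2\le 2\bigl(r\wedge(p-r)\bigr)\wedge C\,\Psi(k^*_q,p,r,n,\lambda). \] Moreover, if $q=0$ (so $k^*_0=s$), the same bound holds with $\Psi$ replaced by $\Psi_0(s,p,r,n,\lambda)$, and the condition $nh(\lambda)\ge C_0k^*_q(r+\log\frac{\mathrm{e}p}{k^*_q})$ can be dropped.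
   Context: Spiked model (sample size $N$): $\mathbf{X}=\mathbf{U}\mathbf{D}\mathbf{V}'+\mathbf{Z}$ is $N\times p$, $\mathbf{U}$ is $N\times r$ with i.i.d. $N(0,1)$ entries, $\mathbf{D}=\operatorname{diag}(\lambda_1^{1/2},\dots,\lambda_r^{1/2})$, $\mathbf{V}\in O(p,r)=\{\mathbf{V}\in\mathbb{R}^{p\times r}:\mathbf{V}'\mathbf{V}=\mathbf{I}_r\}$, $\mathbf{Z}$ has i.i.d. $N(0,\sigma^2)$ entries independent of $\mathbf{U}$; rows of $\mathbf{X}$ are i.i.d. $N(0,\mathbf{V}\boldsymbol{\Lambda}\mathbf{V}'+\sigma^2\mathbf{I}_p)$, $\boldsymbol{\Lambda}=\operatorname{diag}(\lambda_1,\dots,\lambda_r)$. Weak-$\ell_q$ radius: with row norms sorted decreasingly $\|\mathbf{V}_{(1)*}\|\ge\dots\ge\|\mathbf{V}_{(p)*}\|$, $\|\mathbf{V}\|_{q,w}=\max_j j\|\mathbf{V}_{(j)*}\|^q$ (for $q=0$: number of nonzero rows). Fix $\kappa>1$; $\Theta_q(s,p,r,\lambda)=\{\mathbf{V}\boldsymbol{\Lambda}\mathbf{V}'+\mathbf{I}_p: 0<\lambda\le\lambda_r\le\dots\le\lambda_1\le\kappa\lambda,\ \mathbf{V}\in O(p,r),\ \|\mathbf{V}\|_{q,w}\le s\}$. $h(\lambda)=\lambda^2/(\lambda+1)$; $\Psi(k,p,r,n,\lambda)=\frac{1}{nh(\lambda)}(rk+k\log\frac{\mathrm{e}p}{k})$;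 $\Psi_0(k,p,r,n,\lambda)=\frac{1}{nh(\lambda)}(r(k-r)+k\log\frac{\mathrm{e}p}{k})$. Effective dimension: $x_q=\max\{0\le x\le p: x\le s(nh(\lambda)/(r+\log(\mathrm{e}p/x)))^{q/2}\}$, $k^*_q=\lceil x_q\rceil$ (for $q=0$, $k^*_0=s$). Aggregated estimator: with sample size $2n$, split $\mathbf{X}$ into its first $n$ rows $\mathbf{X}_{(1)}$ and last $n$ rows $\mathbf{X}_{(2)}$, and set $\mathbf{S}_{(i)}=\frac1n\mathbf{X}_{(i)}'\mathbf{X}_{(i)}$. For $B\subset[p]$ let $\mathbf{J}_B$ be the $p\times p$ diagonal matrix with $(\mathbf{J}_B)_{ii}=\mathbf{1}\{i\in B\}$, and let $\widehat{\mathbf{V}}_B\in O(p,r)$ consist of $r$ leading eigenvectors of $\mathbf{J}_B\mathbf{S}_{(1)}\mathbf{J}_B$. Let $B^*$ be any maximizer of $\operatorname{Tr}(\widehat{\mathbf{V}}_B'\mathbf{S}_{(2)}\widehat{\mathbf{V}}_B)$ over $B\subset[p]$ with $|B|=k^*_q$, and $\widehat{\mathbf{V}}_*=\widehat{\mathbf{V}}_{B^*}$. *)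

theory Defs
  imports "HOL-Probability.Probability"
begin

text \<open>Matrices are represented as functions nat => nat => real, with the
  dimensions carried explicitly; only entries with indices below the
  stated dimensions are relevant.\<close>

type_synonym rmat = "nat \<Rightarrow> nat \<Rightarrow> real"

definition orthonormal_cols :: "nat \<Rightarrow> nat \<Rightarrow> rmat \<Rightarrow> bool" where
  "orthonormal_cols p r V \<longleftrightarrow>
     (\<forall>a<r. \<forall>b<r. (\<Sum>i<p. V i a * V i b) = (if a = b then 1 else 0))"

definition row_norm :: "nat \<Rightarrow> rmat \<Rightarrow> nat \<Rightarrow> real" where
  "row_norm r V i = sqrt (\<Sum>a<r. (V i a)\<^sup>2)"

definition weak_lq :: "real \<Rightarrow> nat \<Rightarrow> nat \<Rightarrow> rmat \<Rightarrow> real" where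
  "weak_lq q p r V =
     (if q = 0 then real (card {i\<in>{..<p}. row_norm r V i \<noteq> 0})
      else (let L = rev (sort (map (row_norm r V) [0..<p]))
            in Max (insert 0 ((\<lambda>j. real j * (L ! (j - 1)) powr q) ` {1..p}))))"

text \<open>(V, Lambda) parametrises a member V Lambda V' + I_p of Theta_q(s,p,r,lambda)
  (with the fixed constant kappa); Lambda = diag(Ls 0, ..., Ls (r-1)),
  i.e. lambda_1 = Ls 0 >= ... >= lambda_r = Ls (r-1).\<close>
definition in_Theta ::
  "real \<Rightarrow> real \<Rightarrow> real \<Rightarrow> nat \<Rightarrow> nat \<Rightarrow> real \<Rightarrow> rmat \<Rightarrow> (nat \<Rightarrow> real) \<Rightarrow> bool" where
  "in_Theta \<kappa> q s p r lam V Ls \<longleftrightarrow>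
     0 < lam \<and>
     (\<forall>a<r. lam \<le> Ls a \<and> Ls a \<le> \<kappa> * lam) \<and>
     (\<forall>a b. a \<le> b \<longrightarrow> b < r \<longrightarrow> Ls b \<le> Ls a) \<and>
     orthonormal_cols p r V \<and>
     weak_lq q p r V \<le> s"

definition hfun :: "real \<Rightarrow> real" where
  "hfun lam = lam\<^sup>2 / (lam + 1)"

definition Psi :: "nat \<Rightarrow> nat \<Rightarrow> nat \<Rightarrow> nat \<Rightarrow> real \<Rightarrow> real" where
  "Psi k p r n lam =
     (real r * real k + real k * ln (exp 1 * real p / real k)) / (real n * hfun lam)"

definition Psi0 :: "nat \<Rightarrow> nat \<Rightarrow> nat \<Rightarrow> nat \<Rightarrow> real \<Rightarrow> real" where
  "Psi0 k p r n lam =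
     (real r * (real k - real r) + real k * ln (exp 1 * real p / real k)) / (real n * hfun lam)"

definition x_eff :: "real \<Rightarrow> real \<Rightarrow> nat \<Rightarrow> nat \<Rightarrow> nat \<Rightarrow> real \<Rightarrow> real" where
  "x_eff q s p r n lam =
     Sup {x. 0 \<le> x \<and> x \<le> real p \<and>
             x \<le> s * (real n * hfun lam / (real r + ln (exp 1 * real p / x))) powr (q / 2)}"

definition k_eff :: "real \<Rightarrow> real \<Rightarrow> nat \<Rightarrow> nat \<Rightarrow> nat \<Rightarrow> real \<Rightarrow> nat" where
  "k_eff q s p r n lam =
     (if q = 0 then nat \<lceil>s\<rceil> else nat \<lceil>x_eff q s p r n lam\<rceil>)"

text \<open>Data of the spiked model with sigma = 1 and sample size 2n:
  X = U D V' + Z, where omega = (U, Z), U is 2n x r and Z is 2n x p,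
  both with i.i.d. N(0,1) entries (indexed by pairs).\<close>
definition data_space :: "nat \<Rightarrow> nat \<Rightarrow> nat \<Rightarrow> ((nat \<times> nat \<Rightarrow> real) \<times> (nat \<times> nat \<Rightarrow> real)) measure" where
  "data_space n p r =
     (PiM ({..<2*n} \<times> {..<r}) (\<lambda>_. std_normal_distribution)) \<Otimes>\<^sub>M
     (PiM ({..<2*n} \<times> {..<p}) (\<lambda>_. std_normal_distribution))"

definition data_X ::
  "nat \<Rightarrow> rmat \<Rightarrow> (nat \<Rightarrow> real) \<Rightarrow> (nat \<times> nat \<Rightarrow> real) \<times> (nat \<times> nat \<Rightarrow> real) \<Rightarrow> rmat" where
  "data_X r V Ls \<omega> = (\<lambda>t j. (\<Sum>a<r. fst \<omega> (t, a) * sqrt (Ls a) * V j a) + snd \<omega> (t, j))"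

definition S1 :: "nat \<Rightarrow> rmat \<Rightarrow> rmat" where
  "S1 n X = (\<lambda>i j. (\<Sum>t<n. X t i * X t j) / real n)"

definition S2 :: "nat \<Rightarrow> rmat \<Rightarrow> rmat" where
  "S2 n X = (\<lambda>i j. (\<Sum>t\<in>{n..<2*n}. X t i * X t j) / real n)"

definition restrict_mat :: "nat set \<Rightarrow> rmat \<Rightarrow> rmat" where
  "restrict_mat B M = (\<lambda>i j. if i \<in> B \<and> j \<in> B then M i j else 0)"

definition leading_eigvecs :: "nat \<Rightarrow> nat \<Rightarrow> rmat \<Rightarrow> rmat \<Rightarrow> bool" where
  "leading_eigvecs p r M W \<longleftrightarrow>
     (\<exists>E \<nu>. orthonormal_cols p p E \<and>
        (\<forall>a<p. \<forall>i<p. (\<Sum>j<p. M i j * E j a) = \<nu> a * E i a) \<and>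
        (\<forall>a b. a \<le> b \<longrightarrow> b < p \<longrightarrow> \<nu> b \<le> \<nu> a) \<and>
        (\<forall>i<p. \<forall>a<r. W i a = E i a))"

definition trace_quad :: "nat \<Rightarrow> nat \<Rightarrow> rmat \<Rightarrow> rmat \<Rightarrow> real" where
  "trace_quad p r S W = (\<Sum>a<r. \<Sum>i<p. \<Sum>j<p. W i a * S i j * W j a)"

definition proj_loss :: "nat \<Rightarrow> nat \<Rightarrow> rmat \<Rightarrow> rmat \<Rightarrow> real" where
  "proj_loss p r W V =
     (\<Sum>i<p. \<Sum>j<p. ((\<Sum>a<r. W i a * W j a) - (\<Sum>a<r. V i a * V j a))\<^sup>2)"

definition aggregated_estimator ::
  "nat \<Rightarrow> nat \<Rightarrow> nat \<Rightarrow> nat \<Rightarrow> (rmat \<Rightarrow> nat set \<Rightarrow> rmat) \<Rightarrow> (rmat \<Rightarrow> nat set) \<Rightarrow> bool" where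
  "aggregated_estimator n p r k Vsel Bst \<longleftrightarrow>
     (\<forall>X B. B \<subseteq> {..<p} \<and> card B = k \<longrightarrow>
        leading_eigvecs p r (restrict_mat B (S1 n X)) (Vsel X B)) \<and>
     (\<forall>X. Bst X \<subseteq> {..<p} \<and> card (Bst X) = k \<and>
        (\<forall>B. B \<subseteq> {..<p} \<and> card B = k \<longrightarrow>
           trace_quad p r (S2 n X) (Vsel X B) \<le> trace_quad p r (S2 n X) (Vsel X (Bst X))))"

definition expected_loss ::
  "nat \<Rightarrow> nat \<Rightarrow> nat \<Rightarrow> (rmat \<Rightarrow> nat set \<Rightarrow> rmat) \<Rightarrow> (rmat \<Rightarrow> nat set) \<Rightarrow> rmat \<Rightarrow> (nat \<Rightarrow> real) \<Rightarrow> real" where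
  "expected_loss n p r Vsel Bst V Ls =
     integral\<^sup>L (data_space n p r)
       (\<lambda>\<omega>. let X = data_X r V Ls \<omega> in proj_loss p r (Vsel X (Bst X)) V)"

definition estimator_measurable ::
  "nat \<Rightarrow> nat \<Rightarrow> nat \<Rightarrow> (rmat \<Rightarrow> nat set \<Rightarrow> rmat) \<Rightarrow> (rmat \<Rightarrow> nat set) \<Rightarrow> rmat \<Rightarrow> (nat \<Rightarrow> real) \<Rightarrow> bool" where
  "estimator_measurable n p r Vsel Bst V Ls \<longleftrightarrow>
     (\<forall>i a. (\<lambda>\<omega>. let X = data_X r V Ls \<omega> in Vsel X (Bst X) i a)
              \<in> borel_measurable (data_space n p r))"

end

theory Submission
  imports Defs
begin

text \<open>
  With \<open>W0\<close> the estimate on a set of the \<open>k\<close> largest rows and \<open>W\<close> the selected one, optimality on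
  the second sample gives \<open>\<langle>\<Sigma>, P - W\<rangle> \<le> \<langle>\<Sigma>, P - W0\<rangle> + \<langle>S\<^sub>2 - \<Sigma>, W - W0\<rangle>\<close>, where \<open>\<langle>\<Sigma>, P - W\<rangle>\<close> is
  the squared norm of \<open>(I - W) V D\<close> and controls the loss. Conditionally on the first sample the last
  term is a Gaussian chaos in one of \<open>p choose k\<close> fixed directions, hence of order
  \<open>sqrt (k log (ep / k) / n)\<close> times the Frobenius norm of that direction, which is absorbed.
  The oracle term is bounded by the same variational inequality on the first sample and an
  operator-norm bound for a Gaussian matrix with \<open>r + k\<close> columns; writing the difference of two
  projections through either their ranges or their complements replaces the factor \<open>r\<close> by
  \<open>min r (k - r)\<close>, which gives the sharper rate for exact sparsity. Exceptional events have
  probability exponentially small in \<open>n\<close> and are absorbed because \<open>log \<lambda>\<close> is small against \<open>n\<close>.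
\<close>

text \<open>Aggregation needs the candidates to be fixed once the first sample is given, but a
  selector may look at the whole data matrix when it breaks ties between eigenvalues. The maximal
  restricted energy is convex in each noise coordinate and has the fitted values as subgradients, so
  almost surely all choices of leading eigenvectors give the same fitted values; where the
  restricted covariance is definite, this determines the projection. The noise is always kept as a
  relative error, conjugated by a factor of the population covariance. Hence no bound grows with the
  spikes, and the rate function arises from \<open>1 + 1 / lam = lam / hfun lam\<close>. Maxima and
  tail events are handled by one functional \<open>psi\<close>, a truncated exponential of a square.
  Its mean is bounded by a constant; the logarithm of the number of directions is paid through
  \<open>x \<le> exp x\<close>, and the indicator of an exceptional event is dominated by a multiple
  of \<open>psi\<close>.\<close>

section \<open>Finitely supported matrices\<close>

text \<open>Finitely supported matrices form a non-unital ring with the Frobenius inner product: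
  dimensions become coordinate projections and the algebra carries no index bounds.\<close>
typedef fmat = "{A :: nat \<Rightarrow> nat \<Rightarrow> real. \<exists>N. \<forall>i j. N \<le> i \<or> N \<le> j \<longrightarrow> A i j = 0}"
  morphisms ent Fmat
  by (rule exI[of _ "\<lambda>_ _. 0"]) auto

setup_lifting type_definition_fmat

definition bnd :: "fmat \<Rightarrow> nat \<Rightarrow> bool" where
  "bnd A N \<longleftrightarrow> (\<forall>i j. N \<le> i \<or> N \<le> j \<longrightarrow> ent A i j = 0)"

lemma bnd_ex: "\<exists>N. bnd A N"
  using ent[of A] unfolding bnd_def by auto

lemma bnd_mono: "bnd A N \<Longrightarrow> N \<le> M \<Longrightarrow> bnd A M"
  unfolding bnd_def by (meson le_trans)

lemma bnd_ex2: obtains N where "bnd A N" "bnd B N"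
  using bnd_ex bnd_mono by (metis nat_le_linear)

lemma bnd_ex3: obtains N where "bnd A N" "bnd B N" "bnd C N"
proof -
  obtain N M where "bnd A N" "bnd B N" "bnd C M" using bnd_ex bnd_ex2 by metis
  then show ?thesis using that[of "max N M"] bnd_mono by (metis max.cobounded1 max.cobounded2)
qed

lemma fmat_eqI: "(\<And>i j. ent A i j = ent B i j) \<Longrightarrow> A = B"
  by (metis ent_inject ext)

instantiation fmat :: real_vector
begin
lift_definition zero_fmat :: fmat is "\<lambda>_ _. 0" by auto
lift_definition plus_fmat :: "fmat \<Rightarrow> fmat \<Rightarrow> fmat" is "\<lambda>A B i j. A i j + B i j"
proof -
  fix A B :: "nat \<Rightarrow> nat \<Rightarrow> real"
  assume "\<exists>N. \<forall>i j. N \<le> i \<or> N \<le> j \<longrightarrow> A i j = 0" "\<exists>N. \<forall>i j. N \<le> i \<or> N \<le> j \<longrightarrow> B i j = 0"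
  then obtain N M where "\<forall>i j. N \<le> i \<or> N \<le> j \<longrightarrow> A i j = 0" "\<forall>i j. M \<le> i \<or> M \<le> j \<longrightarrow> B i j = 0" by blast
  then show "\<exists>N. \<forall>i j. N \<le> i \<or> N \<le> j \<longrightarrow> A i j + B i j = 0"
    by (intro exI[of _ "max N M"]) auto
qed
lift_definition uminus_fmat :: "fmat \<Rightarrow> fmat" is "\<lambda>A i j. - A i j" by auto
definition minus_fmat :: "fmat \<Rightarrow> fmat \<Rightarrow> fmat" where "minus_fmat A B = A + - B"
lift_definition scaleR_fmat :: "real \<Rightarrow> fmat \<Rightarrow> fmat" is "\<lambda>c A i j. c * A i j" by fastforce
instance
  by standard (unfold minus_fmat_def, (transfer, simp add: fun_eq_iff algebra_simps)+)
end

lemma ent_simps[simp]: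
  "ent 0 i j = 0" "ent (A + B) i j = ent A i j + ent B i j" "ent (- A) i j = - ent A i j"
  "ent (A - B) i j = ent A i j - ent B i j" "ent (c *\<^sub>R A) i j = c * ent A i j"
  unfolding zero_fmat.rep_eq plus_fmat.rep_eq uminus_fmat.rep_eq minus_fmat_def scaleR_fmat.rep_eq by simp_all

lemma ent_sum[simp]: "ent (sum f I) i j = (\<Sum>x\<in>I. ent (f x) i j)"
  by (induction I rule: infinite_finite_induct) auto

lemma bnd_sum_row: "bnd A N \<Longrightarrow> (\<Sum>l | ent A i l \<noteq> 0. ent A i l * f l) = (\<Sum>l<N. ent A i l * f l)"
  by (rule sum.mono_neutral_left) (auto simp: bnd_def, meson not_less)

text \<open>The sum runs over the support of a row of the left factor, which is finite, so the
  product needs no dimension. A bound on either factor turns it into a sum over an initial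
  segment.\<close>

instantiation fmat :: times
begin
lift_definition times_fmat :: "fmat \<Rightarrow> fmat \<Rightarrow> fmat" is
  "\<lambda>A B i j. \<Sum>l | A i l \<noteq> 0. A i l * B l j"
proof -
  fix A B :: "nat \<Rightarrow> nat \<Rightarrow> real"
  assume "\<exists>N. \<forall>i j. N \<le> i \<or> N \<le> j \<longrightarrow> A i j = 0" "\<exists>N. \<forall>i j. N \<le> i \<or> N \<le> j \<longrightarrow> B i j = 0"
  then obtain N M where "\<forall>i j. N \<le> i \<or> N \<le> j \<longrightarrow> A i j = 0" "\<forall>i j. M \<le> i \<or> M \<le> j \<longrightarrow> B i j = 0" by blast
  then show "\<exists>N. \<forall>i j. N \<le> i \<or> N \<le> j \<longrightarrow> (\<Sum>l | A i l \<noteq> 0. A i l * B l j) = 0"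
    by (intro exI[of _ "max N M"]) (auto intro!: sum.neutral)
qed
instance ..
end

lemma ent_times: "bnd A N \<Longrightarrow> ent (A * B) i j = (\<Sum>l<N. ent A i l * ent B l j)"
  by (simp add: times_fmat.rep_eq bnd_sum_row)

lemma ent_times': assumes "bnd B N" shows "ent (A * B) i j = (\<Sum>l<N. ent A i l * ent B l j)"
proof -
  obtain M where M: "bnd A M" "bnd B M" using bnd_ex2 by blast
  have "ent (A * B) i j = (\<Sum>l<max N M. ent A i l * ent B l j)"
    using ent_times bnd_mono[OF M(1)] by simp
  also have "\<dots> = (\<Sum>l<N. ent A i l * ent B l j)"
    using assms by (intro sum.mono_neutral_right) (auto simp: bnd_def)
  finally show ?thesis .
qed

lemma bnd_times: "bnd A N \<Longrightarrow> bnd B N \<Longrightarrow> bnd (A * B) N"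
  unfolding bnd_def[of "A * B"] by (auto simp: ent_times) (auto simp: bnd_def)

lift_definition tp :: "fmat \<Rightarrow> fmat" is "\<lambda>A i j. A j i" by auto

lemma ent_tp[simp]: "ent (tp A) i j = ent A j i" by (simp add: tp.rep_eq)
lemma bnd_tp[simp]: "bnd (tp A) N = bnd A N" by (auto simp: bnd_def)

instance fmat :: real_algebra
proof
  fix A B C :: fmat and c :: real
  obtain N where N: "bnd A N" "bnd B N" "bnd C N" by (rule bnd_ex3)
  show "A * B * C = A * (B * C)"
  proof (rule fmat_eqI)
    fix i j
    have "ent (A * B * C) i j = (\<Sum>l<N. \<Sum>m<N. ent A i m * ent B m l * ent C l j)"
      by (simp add: ent_times[OF bnd_times[OF N(1,2)]] ent_times[OF N(1)] sum_distrib_right)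
    also have "\<dots> = (\<Sum>m<N. \<Sum>l<N. ent A i m * ent B m l * ent C l j)" by (rule sum.swap)
    also have "\<dots> = ent (A * (B * C)) i j"
      by (simp add: ent_times[OF N(1)] ent_times[OF N(2)] sum_distrib_left mult.assoc)
    finally show "ent (A * B * C) i j = ent (A * (B * C)) i j" .
  qed
  show "(A + B) * C = A * C + B * C"
    by (rule fmat_eqI) (simp add: ent_times'[OF N(3)] sum.distrib algebra_simps)
  show "A * (B + C) = A * B + A * C"
    by (rule fmat_eqI) (simp add: ent_times[OF N(1)] sum.distrib algebra_simps)
  show "c *\<^sub>R A * B = c *\<^sub>R (A * B)"
    by (rule fmat_eqI) (simp add: ent_times'[OF N(2)] sum_distrib_left algebra_simps)
  show "A * c *\<^sub>R B = c *\<^sub>R (A * B)"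
    by (rule fmat_eqI) (simp add: ent_times[OF N(1)] sum_distrib_left algebra_simps)
qed

lemma tp_simps[simp]:
  "tp (A + B) = tp A + tp B" "tp (A - B) = tp A - tp B" "tp (- A) = - tp A" "tp (tp A) = A"
  "tp 0 = 0" "tp (c *\<^sub>R A) = c *\<^sub>R tp A"
  by (auto intro!: fmat_eqI)

lemma tp_sum: "tp (sum f I) = (\<Sum>x\<in>I. tp (f x))"
  by (auto intro!: fmat_eqI)

lemma tp_times[simp]: "tp (A * B) = tp B * tp A"
proof -
  obtain N where N: "bnd A N" "bnd B N" by (rule bnd_ex2)
  show ?thesis by (rule fmat_eqI) (simp add: ent_times[OF N(1)] ent_times[of "tp B" N] N mult.commute)
qed

section \<open>Frobenius inner product and norm\<close>

instantiation fmat :: real_inner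
begin
definition inner_fmat :: "fmat \<Rightarrow> fmat \<Rightarrow> real" where
  "inner_fmat A B = (let N = (SOME N. bnd A N) in \<Sum>i<N. \<Sum>j<N. ent A i j * ent B i j)"
definition norm_fmat :: "fmat \<Rightarrow> real" where "norm_fmat A = sqrt (inner A A)"
definition dist_fmat :: "fmat \<Rightarrow> fmat \<Rightarrow> real" where "dist_fmat A B = norm (A - B)"
definition sgn_fmat :: "fmat \<Rightarrow> fmat" where "sgn_fmat A = A /\<^sub>R norm A"
definition uniformity_fmat :: "(fmat \<times> fmat) filter"
  where "uniformity_fmat = (INF e\<in>{0 <..}. principal {(x, y). dist x y < e})"
definition open_fmat :: "fmat set \<Rightarrow> bool"
  where "open_fmat U \<longleftrightarrow> (\<forall>x\<in>U. \<forall>\<^sub>F (x', y) in uniformity. x' = x \<longrightarrow> y \<in> U)"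

text \<open>Enlarging the square of summation only adds zeros, so the arbitrary choice in the
  definition is harmless and a bound for the left argument suffices.\<close>

lemma inner_fmat_bnd: assumes "bnd A N" shows "inner A B = (\<Sum>i<N. \<Sum>j<N. ent A i j * ent B i j)"
proof -
  define M where "M = (SOME N. bnd A N)"
  have M: "bnd A M" unfolding M_def using bnd_ex by (rule someI_ex)
  have *: "(\<Sum>i<K. \<Sum>j<K. ent A i j * ent B i j) = (\<Sum>i<max M N. \<Sum>j<max M N. ent A i j * ent B i j)"
    if "bnd A K" "K \<le> max M N" for K
  proof -
    have "(\<Sum>i<K. \<Sum>j<K. ent A i j * ent B i j) = (\<Sum>i<K. \<Sum>j<max M N. ent A i j * ent B i j)"
      using that by (intro sum.cong refl sum.mono_neutral_left) (auto simp: bnd_def)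
    also have "\<dots> = (\<Sum>i<max M N. \<Sum>j<max M N. ent A i j * ent B i j)"
      using that by (intro sum.mono_neutral_left) (auto simp: bnd_def)
    finally show ?thesis .
  qed
  show ?thesis unfolding inner_fmat_def Let_def M_def[symmetric] using *[OF M] *[OF assms] by simp
qed

instance
proof
  fix A B C :: fmat and c :: real
  obtain N where N: "bnd A N" "bnd B N" "bnd C N" by (rule bnd_ex3)
  have NAB: "bnd (A + B) N" "bnd (c *\<^sub>R A) N" using N by (auto simp: bnd_def)
  show "dist A B = norm (A - B)" by (rule dist_fmat_def)
  show "sgn A = A /\<^sub>R norm A" by (rule sgn_fmat_def)
  show "uniformity = (INF e\<in>{0 <..}. principal {(x :: fmat, y). dist x y < e})" by (rule uniformity_fmat_def)
  show "open U \<longleftrightarrow> (\<forall>x\<in>U. \<forall>\<^sub>F (x', y) in uniformity. x' = x \<longrightarrow> y \<in> U)" for U :: "fmat set" by (rule open_fmat_def)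
  show "inner A B = inner B A" by (simp add: inner_fmat_bnd[OF N(1)] inner_fmat_bnd[OF N(2)] mult.commute)
  show "inner (A + B) C = inner A C + inner B C"
    by (simp add: inner_fmat_bnd[OF N(1)] inner_fmat_bnd[OF N(2)] inner_fmat_bnd[OF NAB(1)] sum.distrib algebra_simps)
  show "inner (c *\<^sub>R A) B = c * inner A B"
    by (simp add: inner_fmat_bnd[OF N(1)] inner_fmat_bnd[OF NAB(2)] sum_distrib_left algebra_simps)
  show "0 \<le> inner A A" by (simp add: inner_fmat_bnd[OF N(1)] sum_nonneg)
  show "inner A A = 0 \<longleftrightarrow> A = 0"
  proof
    assume "inner A A = 0"
    then have "\<forall>i<N. \<forall>j<N. ent A i j = 0"
      by (simp add: inner_fmat_bnd[OF N(1)] sum_nonneg sum_nonneg_eq_0_iff)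
    then show "A = 0" using N(1) by (intro fmat_eqI) (auto simp: bnd_def, meson not_le)
  qed (simp add: inner_fmat_bnd[of 0 0] bnd_def)
  show "norm A = sqrt (inner A A)" by (rule norm_fmat_def)
qed
end

lemma inner_tp: "inner (tp A) (tp B) = inner A B"
proof -
  obtain N where N: "bnd A N" by (meson bnd_ex)
  show ?thesis by (simp add: inner_fmat_bnd[OF N] inner_fmat_bnd[of "tp A" N] N) (rule sum.swap)
qed

lemma norm_tp[simp]: "norm (tp A) = norm A"
  unfolding norm_eq_sqrt_inner by (simp only: inner_tp)

lemma inner_mult_l: "inner (A * B) C = inner B (tp A * C)"
proof -
  obtain N where N: "bnd A N" "bnd B N" "bnd C N" by (rule bnd_ex3)
  have "inner (A * B) C = (\<Sum>i<N. \<Sum>j<N. \<Sum>l<N. ent A i l * ent B l j * ent C i j)"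
    by (simp add: inner_fmat_bnd[OF bnd_times[OF N(1,2)]] ent_times[OF N(1)] sum_distrib_right)
  also have "\<dots> = (\<Sum>i<N. \<Sum>l<N. \<Sum>j<N. ent A i l * ent B l j * ent C i j)"
    by (intro sum.cong refl sum.swap)
  also have "\<dots> = (\<Sum>l<N. \<Sum>i<N. \<Sum>j<N. ent A i l * ent B l j * ent C i j)"
    by (rule sum.swap)
  also have "\<dots> = (\<Sum>l<N. \<Sum>j<N. \<Sum>i<N. ent A i l * ent B l j * ent C i j)"
    by (intro sum.cong refl sum.swap)
  also have "\<dots> = inner B (tp A * C)"
    by (simp add: inner_fmat_bnd[OF N(2)] ent_times[of "tp A" N] N sum_distrib_left algebra_simps)
  finally show ?thesis .
qed

lemma inner_mult_r: "inner (A * B) C = inner A (C * tp B)"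
proof -
  have "inner (A * B) C = inner (tp B * tp A) (tp C)" by (metis inner_tp tp_times)
  also have "\<dots> = inner (tp A) (B * tp C)" by (simp add: inner_mult_l)
  also have "\<dots> = inner A (C * tp B)" by (metis inner_tp tp_times tp_simps(4))
  finally show ?thesis .
qed

lemma norm_fmat_sq: "bnd A N \<Longrightarrow> (norm A)\<^sup>2 = (\<Sum>i<N. \<Sum>j<N. (ent A i j)\<^sup>2)"
  unfolding power2_norm_eq_inner by (simp add: inner_fmat_bnd power2_eq_square)

lemma norm_mult_fmat: "norm (A * B :: fmat) \<le> norm A * norm B"
proof -
  obtain N where N: "bnd A N" "bnd B N" by (rule bnd_ex2)
  have "(norm (A * B))\<^sup>2 = (\<Sum>i<N. \<Sum>j<N. (\<Sum>l<N. ent A i l * ent B l j)\<^sup>2)"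
    by (simp add: norm_fmat_sq[OF bnd_times[OF N]] ent_times[OF N(1)])
  also have "\<dots> \<le> (\<Sum>i<N. \<Sum>j<N. (\<Sum>l<N. (ent A i l)\<^sup>2) * (\<Sum>l<N. (ent B l j)\<^sup>2))"
    by (intro sum_mono Cauchy_Schwarz_ineq_sum)
  also have "\<dots> = (\<Sum>i<N. \<Sum>l<N. (ent A i l)\<^sup>2) * (\<Sum>j<N. \<Sum>l<N. (ent B l j)\<^sup>2)"
    by (simp add: sum_product)
  also have "(\<Sum>j<N. \<Sum>l<N. (ent B l j)\<^sup>2) = (norm B)\<^sup>2"
    by (simp add: norm_fmat_sq[OF N(2)]) (rule sum.swap)
  finally have "(norm (A * B))\<^sup>2 \<le> (norm A * norm B)\<^sup>2"
    by (simp add: norm_fmat_sq[OF N(1)] power_mult_distrib)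
  then show ?thesis by (rule power2_le_imp_le) simp
qed

text \<open>Infinite sets are sent to zero, which keeps the result finitely supported.
  \<open>coord {..<d}\<close> serves as the identity of dimension \<open>d\<close>, and
  \<open>x * coord {0} = x\<close> is how \<open>x\<close> is declared to be a column
  vector.\<close>

lift_definition coord :: "nat set \<Rightarrow> fmat" is
  "\<lambda>S i j. if finite S \<and> i = j \<and> i \<in> S then 1 else 0"
proof -
  fix S :: "nat set"
  show "\<exists>N. \<forall>i j. N \<le> i \<or> N \<le> j \<longrightarrow> (if finite S \<and> i = j \<and> i \<in> S then 1 else 0) = (0::real)"
  proof (cases "finite S")
    case True
    then obtain N where "\<forall>i\<in>S. i < N" using finite_nat_set_iff_bounded by blast
    then show ?thesis by (intro exI[of _ N]) auto
  qed auto
qed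

lemma ent_coord[simp]: "ent (coord S) i j = (if finite S \<and> i = j \<and> i \<in> S then 1 else 0)"
  by (simp add: coord.rep_eq)

lemma bnd_coord: "S \<subseteq> {..<N} \<Longrightarrow> bnd (coord S) N"
  by (auto simp: bnd_def)

lemma tp_coord[simp]: "tp (coord S) = coord S"
  by (rule fmat_eqI) auto

lemma ent_coord_l: "finite S \<Longrightarrow> ent (coord S * A) i j = (if i \<in> S then ent A i j else 0)"
proof -
  assume S: "finite S"
  obtain N where N: "bnd (coord S) N" by (meson bnd_ex)
  have "S \<subseteq> {..<N}"
  proof
    fix i assume "i \<in> S" then have "ent (coord S) i i \<noteq> 0" using S by simp
    then show "i \<in> {..<N}" using N unfolding bnd_def by (meson lessThan_iff not_le)
  qed
  then show ?thesis using S
    by (cases "i \<in> S") (auto simp: ent_times[OF N] if_distrib if_distribR cong: if_cong)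
qed

lemma ent_coord_r: "finite S \<Longrightarrow> ent (A * coord S) i j = (if j \<in> S then ent A i j else 0)"
  using ent_coord_l[of S "tp A" j i] by (metis ent_tp tp_coord tp_times tp_simps(4))

lemma coord_mult: "finite S \<Longrightarrow> finite S' \<Longrightarrow> coord S * coord S' = coord (S \<inter> S')"
  by (rule fmat_eqI) (auto simp: ent_coord_l)

lemma norm_coord: assumes "finite S" shows "(norm (coord S))\<^sup>2 = real (card S)"
proof -
  obtain N where N: "S \<subseteq> {..<N}" using assms finite_nat_set_iff_bounded by (metis lessThan_iff subsetI)
  have "(norm (coord S))\<^sup>2 = (\<Sum>i<N. \<Sum>j<N. if i = j \<and> i \<in> S then 1 else 0)"
    unfolding norm_fmat_sq[OF bnd_coord[OF N]] using assms by (intro sum.cong refl) auto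
  also have "\<dots> = (\<Sum>i<N. if i \<in> S then 1 else 0)" by (intro sum.cong refl) (auto simp: if_distrib)
  also have "\<dots> = real (card S)" using N by (simp add: sum.If_cases Int_absorb1)
  finally show ?thesis .
qed

lift_definition fm :: "nat \<Rightarrow> nat \<Rightarrow> rmat \<Rightarrow> fmat" is "\<lambda>a b M i j. if i < a \<and> j < b then M i j else 0"
  by (metis leD max.bounded_iff)

lemma ent_fm[simp]: "ent (fm a b M) i j = (if i < a \<and> j < b then M i j else 0)"
  by (simp add: fm.rep_eq)

lemma bnd_fm: "a \<le> N \<Longrightarrow> b \<le> N \<Longrightarrow> bnd (fm a b M) N"
  by (auto simp: bnd_def)

text \<open>For a self-adjoint idempotent the squared Frobenius norm is the trace, hence the rank.
  Ranks are therefore stated as squared norms, and \<open>J * P = P\<close> says that the range of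
  \<open>P\<close> lies in that of \<open>J\<close>.\<close>

definition proj :: "fmat \<Rightarrow> bool" where
  "proj P \<longleftrightarrow> tp P = P \<and> P * P = P"

lemma proj_coord[simp]: "finite S \<Longrightarrow> proj (coord S)"
  by (simp add: proj_def coord_mult)

lemma projD: "proj P \<Longrightarrow> tp P = P" "proj P \<Longrightarrow> P * P = P" "proj P \<Longrightarrow> P * (P * A) = P * A"
  by (simp_all add: proj_def mult.assoc[symmetric])

lemma proj_diff: "proj P \<Longrightarrow> proj J \<Longrightarrow> J * P = P \<Longrightarrow> proj (J - P)"
proof -
  assume a: "proj P" "proj J" "J * P = P"
  then have "P * J = P" by (metis projD(1) tp_times)
  then show ?thesis using a by (simp add: proj_def algebra_simps)
qed

lemma proj_pythag: assumes "proj P" shows "(norm A)\<^sup>2 = (norm (P * A))\<^sup>2 + (norm (A - P * A))\<^sup>2"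
proof -
  have "inner (P * A) (A - P * A) = 0"
    by (simp add: inner_mult_l projD[OF assms] right_diff_distrib)
  then have "inner (P * A + (A - P * A)) (P * A + (A - P * A)) = inner (P * A) (P * A) + inner (A - P * A) (A - P * A)"
    by (simp only: inner_add_left inner_add_right inner_commute[of "A - P * A" "P * A"])
  then show ?thesis by (simp add: power2_norm_eq_inner)
qed

lemma proj_norm_le: assumes "proj P" shows "norm (P * A) \<le> norm A"
proof (rule power2_le_imp_le)
  show "(norm (P * A))\<^sup>2 \<le> (norm A)\<^sup>2"
    using proj_pythag[OF assms, of A] zero_le_power2[of "norm (A - P * A)"] by linarith
qed simp

lemma proj_norm_le_r: assumes "proj P" shows "norm (A * P) \<le> norm A"
proof -
  have "norm (A * P) = norm (P * tp A)"
    using norm_tp[of "A * P"] by (simp only: tp_times projD(1)[OF assms])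
  also have "\<dots> \<le> norm (tp A)" by (rule proj_norm_le[OF assms])
  finally show ?thesis by simp
qed

lemma proj_inner: assumes "proj P" "proj Q" shows "inner P Q = (norm (P * Q))\<^sup>2"
proof -
  have "inner (P * Q) (P * Q) = inner Q (P * (P * Q))"
    by (simp only: inner_mult_l projD(1)[OF assms(1)])
  also have "\<dots> = inner (P * Q) Q" by (simp only: projD(3)[OF assms(1)] inner_commute)
  also have "\<dots> = inner P (Q * Q)" by (simp only: inner_mult_r projD(1)[OF assms(2)])
  finally show ?thesis by (simp only: power2_norm_eq_inner projD(2)[OF assms(2)])
qed

lemma proj_norm_sub: assumes "proj P" "proj J" "J * P = P"
  shows "(norm (J - P))\<^sup>2 = (norm J)\<^sup>2 - (norm P)\<^sup>2"
proof -
  have "P * J = P" using assms by (metis projD(1) tp_times)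
  then show ?thesis using proj_pythag[OF assms(1), of J] by simp
qed

section \<open>Deterministic inequalities\<close>

text \<open>The operator norm occurs only through upper bounds. Testing on matrices instead of
  vectors gives the same bound, column by column, and applies directly to Frobenius norms.\<close>

definition opb :: "fmat \<Rightarrow> real \<Rightarrow> bool" where
  "opb E e \<longleftrightarrow> 0 \<le> e \<and> (\<forall>A. norm (E * A) \<le> e * norm A)"

lemma opbD: "opb E e \<Longrightarrow> norm (E * A) \<le> e * norm A" "opb E e \<Longrightarrow> 0 \<le> e"
  by (auto simp: opb_def)

lemma mult_cancel_l: "P * J = (J::fmat) \<Longrightarrow> P * (J * A) = J * A"
  by (simp add: mult.assoc[symmetric])

lemma isometry_norm: assumes "tp T * T = J" "J * A = A" shows "norm (T * A) = norm (A::fmat)"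
proof -
  have "inner (T * A) (T * A) = inner A A"
    by (simp only: inner_mult_l mult.assoc[symmetric] assms)
  then show ?thesis by (simp add: norm_eq_sqrt_inner)
qed

lemma proj_of_isometry: assumes "tp T * T = J" "T * J = T" shows "proj (T * tp T)"
proof -
  have "T * tp T * (T * tp T) = T * (tp T * T) * tp T" by (simp add: mult.assoc)
  then show ?thesis by (simp add: proj_def assms)
qed

text \<open>With equal ranks the part of \<open>P\<close> outside \<open>W\<close> and the part of
  \<open>W\<close> outside \<open>P\<close> have the same size, so the distance is controlled by one
  of them. \<open>I\<close> acts as the ambient identity.\<close>

lemma proj_diff_norm:
  assumes "proj W" "proj P" "norm W = norm P" "proj I" "I * W = W" "I * P = P"
  shows "(norm (W - P))\<^sup>2 = 2 * (norm ((I - W) * P))\<^sup>2"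
proof -
  have "(norm (W - P))\<^sup>2 = (norm W)\<^sup>2 + (norm P)\<^sup>2 - 2 * inner W P"
    by (simp add: power2_norm_eq_inner inner_diff_left inner_diff_right inner_commute)
  also have "\<dots> = 2 * ((norm P)\<^sup>2 - (norm (W * P))\<^sup>2)"
    using assms proj_inner[of W P] by simp
  also have "(norm P)\<^sup>2 - (norm (W * P))\<^sup>2 = (norm (P - W * P))\<^sup>2"
    using proj_pythag[OF assms(1), of P] by simp
  finally show ?thesis by (simp add: left_diff_distrib assms)
qed

text \<open>Since \<open>W - P = W * (W - P) + (W - P) * P\<close>, each half is tested against
  \<open>C * W\<close> or \<open>C * P\<close>, whose norm is at most \<open>e * \<mu>\<close>. The
  rank thus enters through its square root only. The lemma serves for ranges and for complements
  alike.\<close>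

lemma inner_proj_diff_le:
  assumes "proj W" "proj P" "tp C = C" "opb C e" "norm W \<le> \<mu>" "norm P \<le> \<mu>"
  shows "\<bar>inner C (W - P)\<bar> \<le> 2 * e * \<mu> * norm (W - P)"
proof -
  let ?A = "W - P"
  note pr = projD[OF assms(1)] projD[OF assms(2)]
  have tpA: "tp ?A = ?A" by (simp add: pr)
  have A: "?A = W * ?A + ?A * P" by (simp add: left_diff_distrib right_diff_distrib pr)
  have aux: "\<bar>inner (C * X) ?A\<bar> \<le> e * \<mu> * norm ?A" if "norm X \<le> \<mu>" for X
  proof -
    have "\<bar>inner (C * X) ?A\<bar> \<le> norm (C * X) * norm ?A" by (rule Cauchy_Schwarz_ineq2)
    also have "\<dots> \<le> (e * norm X) * norm ?A" by (intro mult_right_mono opbD(1)[OF assms(4)]) auto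
    also have "\<dots> \<le> (e * \<mu>) * norm ?A" using that opbD(2)[OF assms(4)] by (intro mult_right_mono mult_left_mono) auto
    finally show ?thesis .
  qed
  have "inner C ?A = inner C (W * ?A) + inner C (?A * P)"
    by (subst A) (simp only: inner_add_right)
  also have "inner C (W * ?A) = inner (C * W) ?A"
  proof -
    have "inner C (W * ?A) = inner (W * C) ?A" using inner_mult_l[of W C ?A] by (simp only: pr)
    also have "\<dots> = inner (tp (W * C)) (tp ?A)" by (rule inner_tp[symmetric])
    finally show ?thesis by (simp only: tp_times tpA assms(3) pr)
  qed
  also have "inner C (?A * P) = inner (C * P) ?A" using inner_mult_r[of C P ?A] by (simp only: pr)
  finally show ?thesis using aux[OF assms(5)] aux[OF assms(6)] by linarith
qed

text \<open>The identity part of the covariance cancels because the ranks agree; the signal part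
  measures captured energy, and the rest is noise tested in a conjugated direction.\<close>

lemma cov_gap:
  assumes "proj X1" "proj X2" "norm X1 = norm X2" "proj I" "I * X1 = X1" "I * X2 = X2"
    "S = tp T1 * T1 + I + tp T * E * T"
  shows "inner S (X1 - X2) = (norm (X1 * tp T1))\<^sup>2 - (norm (X2 * tp T1))\<^sup>2 + inner E (T * (X1 - X2) * tp T)"
proof -
  have a: "inner (tp T1 * T1) X = (norm (X * tp T1))\<^sup>2" if "proj X" for X
  proof -
    have "inner (X * tp T1) (X * tp T1) = inner (tp T1) (X * tp T1)"
      by (simp only: inner_mult_l projD[OF that])
    also have "\<dots> = inner (X * tp T1) (tp T1)" by (rule inner_commute)
    also have "\<dots> = inner X (tp T1 * T1)" by (simp only: inner_mult_r tp_simps)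
    finally show ?thesis by (simp only: power2_norm_eq_inner inner_commute)
  qed
  have b: "inner I X = (norm X)\<^sup>2" if "proj X" "I * X = X" for X
    using proj_inner[OF assms(4) that(1)] that(2) by simp
  have c: "inner (tp T * E * T) X = inner E (T * X * tp T)" for X
    using inner_mult_r[of "tp T * E" T X] inner_mult_l[of "tp T" E "X * tp T"] by (simp add: mult.assoc)
  show ?thesis unfolding assms(7) inner_add_left c
    by (simp only: inner_diff_right a assms b)
qed

text \<open>\<open>\<mu>\<close> squared bounds either the rank or the corank of the two projections inside \<open>J\<close>.
  \<open>Pt\<close> replaces the true projection because it contains the range of \<open>J * tp T1\<close>; then the
  signal part of the noise is quadratic in \<open>(I - W) * tp T1\<close>.\<close>
lemma oracle_basic:
  assumes W: "proj W" "J * W = W" and Pt: "proj Pt" "J * Pt = Pt" "norm W = norm Pt"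
    and J: "proj J" "proj I" "I * J = J"
    and Ir: "proj Ir" "norm Ir = norm W" "Ir * T1 = T1" "K * Ir = Ir"
    and K: "proj K" "K * T2 * J = T2 * J"
    and T2: "tp T2 * T2 = I"
    and T1: "Pt * J * tp T1 = J * tp T1" "I * tp T1 = tp T1"
    and S: "S = tp T1 * T1 + I + tp (T1 + T2) * E * (T1 + T2)"
    and E: "tp E = E" "opb (K * E * K) e"
    and opt: "inner S (Pt - W) \<le> 0"
    and mu: "norm W \<le> \<mu> \<or> norm (J - W) \<le> \<mu>"
    and Y: "Y = norm ((I - W) * tp T1)"
  shows "Y\<^sup>2 \<le> (norm ((I - J) * tp T1))\<^sup>2 + e * Y\<^sup>2 + 2 * e * \<mu> * Y + 2 * e * \<mu> * norm (W - Pt)"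
proof -
  note pr = projD[OF W(1)] projD[OF Pt(1)] projD[OF J(1)] projD[OF Ir(1)] projD[OF K(1)] projD[OF J(2)]
  have e0: "0 \<le> e" by (rule opbD(2)[OF E(2)])
  have WJ: "W * J = W" using W J by (metis projD(1) tp_times)
  have PtJ: "Pt * J = Pt" using Pt J by (metis projD(1) tp_times)
  have JI: "J * I = J" using J by (metis projD(1) tp_times)
  have IW: "I * W = W" and IPt: "I * Pt = Pt" using W(2) Pt(2) J(3) by (metis mult.assoc)+
  have WI: "W * I = W" using IW W(1) J by (metis projD(1) tp_times)
  define Q where "Q = J - W"
  have Q: "proj Q" unfolding Q_def by (rule proj_diff[OF W(1) J(1) W(2)])
  have Qt: "proj (J - Pt)" by (rule proj_diff[OF Pt(1) J(1) Pt(2)])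
  have QJ: "Q * J = Q" "J * Q = Q" unfolding Q_def by (simp_all add: left_diff_distrib right_diff_distrib pr WJ W)
  define R where "R = Q * tp T1"
  have tpR: "tp R = T1 * Q" by (simp add: R_def projD[OF Q])
  have QR: "Q * R = R" by (simp add: R_def projD[OF Q])
  have RY: "norm R \<le> Y"
  proof -
    have "R = J * ((I - W) * tp T1)"
      by (simp add: R_def Q_def left_diff_distrib right_diff_distrib mult.assoc[symmetric] W JI)
    then show ?thesis unfolding Y by (simp add: proj_norm_le[OF J(1)])
  qed
  define A where "A = W - Pt"
  have AJ: "A = J * A" "A = A * J" by (simp_all add: A_def left_diff_distrib right_diff_distrib W Pt WJ PtJ)
  have T1Pt: "T1 * Pt = T1 * J"
  proof -
    have "tp (Pt * J * tp T1) = tp (J * tp T1)" using T1(1) by simp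
    then show ?thesis by (simp add: pr PtJ Pt mult.assoc)
  qed
  \<comment> \<open>As \<open>Pt\<close> reproduces \<open>J * tp T1\<close>, the difference
    \<open>A\<close> meets the signal only in the part missed by \<open>W\<close>. This makes the
    signal blocks below linear or quadratic in \<open>R\<close>.\<close>
  have T1A: "T1 * A = - tp R"
    by (simp add: A_def tpR Q_def right_diff_distrib T1Pt)
  have ATp: "A * tp T1 = - R"
  proof -
    have "tp (T1 * A) = tp (- tp R)" by (simp only: T1A)
    then show ?thesis by (simp add: A_def pr)
  qed
  have T1AT1: "T1 * A * tp T1 = - (tp R * R)"
  proof -
    have "T1 * A * tp T1 = - (tp R * tp T1)" by (simp add: T1A)
    also have "tp R * tp T1 = tp R * (Q * tp T1)" using QR by (simp add: tpR mult.assoc[symmetric] projD[OF Q])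
      (simp add: mult.assoc projD[OF Q])
    finally show ?thesis by (simp add: R_def)
  qed
  define F where "F = K * E * K"
  have tpF: "tp F = F" by (simp add: F_def E pr mult.assoc)
  have F: "opb F e" using E by (simp add: F_def)
  have KT1: "K * T1 = T1" using Ir by (metis mult.assoc)
  have KtpR: "K * tp R = tp R" by (simp add: tpR mult.assoc[symmetric] KT1)
  have IrtpR: "Ir * tp R = tp R" by (simp add: tpR mult.assoc[symmetric] Ir)
  have KT2J: "K * (T2 * (J * X)) = T2 * (J * X)" for X using K(2) by (simp add: mult.assoc[symmetric])
  \<comment> \<open>All matrices that occur are fixed by \<open>K\<close>, so the noise may be
    replaced by its compression \<open>F\<close>, the only part whose operator norm is
    controlled.\<close>
  have bilin: "inner E (X * tp Z) = inner (F * Z) X" if "K * X = X" "K * Z = Z" for X Z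
  proof -
    have "inner E (X * tp Z) = inner (X * tp Z) E" by (rule inner_commute)
    also have "\<dots> = inner X (E * Z)" by (simp add: inner_mult_r)
    also have "\<dots> = inner (K * X) (E * (K * Z))" by (simp add: that)
    also have "\<dots> = inner X (F * Z)" by (simp add: inner_mult_l pr F_def mult.assoc)
    finally show ?thesis by (simp add: inner_commute)
  qed
  have ss: "\<bar>inner E (tp R * R)\<bar> \<le> e * Y\<^sup>2"
  proof -
    have "inner E (tp R * R) = inner (F * tp R) (tp R)" using bilin[OF KtpR KtpR] by simp
    also have "\<bar>\<dots>\<bar> \<le> norm (F * tp R) * norm (tp R)" by (rule Cauchy_Schwarz_ineq2)
    also have "\<dots> \<le> (e * norm R) * norm R" using opbD(1)[OF F, of "tp R"] e0 by (intro mult_mono) auto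
    also have "\<dots> \<le> (e * Y) * Y" using RY e0 Y by (intro mult_mono) auto
    finally show ?thesis by (simp add: power2_eq_square mult.assoc)
  qed
  have T2R: "T2 * R = T2 * (J * R)" using QJ QR by (metis mult.assoc)
  have T2Q: "K * (T2 * Q) = T2 * Q" using KT2J[of Q] by (simp add: QJ)
  have IR: "I * R = R" and IQ: "I * Q = Q" using QJ QR J(3) by (metis mult.assoc)+
  \<comment> \<open>In the rank case the factor \<open>\<mu>\<close> comes from \<open>Ir\<close>,
    which fixes \<open>tp R\<close> and has the norm of \<open>W\<close>; in the corank case it
    comes from \<open>Q = J - W\<close>, which fixes \<open>R\<close>.\<close>
  have sz: "\<bar>inner E (tp R * tp T2)\<bar> \<le> e * \<mu> * Y"
    using mu
  proof
    assume m: "norm W \<le> \<mu>"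
    have "inner E (tp R * tp T2) = inner E (Ir * tp (T2 * R))"
      by (simp add: mult.assoc[symmetric] IrtpR)
    also have "\<dots> = inner (F * (T2 * R)) Ir"
      by (rule bilin) (simp_all add: Ir T2R KT2J)
    also have "\<dots> = inner (T2 * R) (F * Ir)" by (simp add: inner_mult_l tpF)
    also have "\<bar>\<dots>\<bar> \<le> norm (T2 * R) * norm (F * Ir)" by (rule Cauchy_Schwarz_ineq2)
    also have "\<dots> \<le> norm R * (e * norm W)"
      using opbD(1)[OF F, of Ir] isometry_norm[OF T2 IR] e0 by (intro mult_mono) (auto simp: Ir)
    also have "\<dots> \<le> Y * (e * \<mu>)" using RY m e0 Y by (intro mult_mono mult_nonneg_nonneg) auto
    finally show ?thesis by (simp add: mult.commute)
  next
    assume m: "norm (J - W) \<le> \<mu>"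
    have "inner E (tp R * tp T2) = inner E (tp R * tp (T2 * Q))"
      by (simp add: projD[OF Q] mult.assoc[symmetric]) (simp add: tpR mult.assoc projD[OF Q])
    also have "\<dots> = inner (F * (T2 * Q)) (tp R)" by (rule bilin[OF KtpR T2Q])
    also have "\<bar>\<dots>\<bar> \<le> norm (F * (T2 * Q)) * norm (tp R)" by (rule Cauchy_Schwarz_ineq2)
    also have "\<dots> \<le> (e * norm Q) * norm R"
      using opbD(1)[OF F, of "T2 * Q"] isometry_norm[OF T2 IQ] e0 by (intro mult_mono) auto
    also have "\<dots> \<le> (e * \<mu>) * Y" using RY m e0 Y
      by (intro mult_mono mult_nonneg_nonneg) (auto simp: Q_def intro: order_trans[OF norm_ge_zero])
    finally show ?thesis .
  qed
  have zs: "inner E (T2 * R) = inner E (tp R * tp T2)"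
    using inner_tp[of E "T2 * R"] by (simp add: E)
  define C where "C = J * tp T2 * F * T2 * J"
  have tpC: "tp C = C" by (simp add: C_def pr tpF mult.assoc)
  have C: "opb C e"
  proof -
    have "norm (C * X) \<le> e * norm X" for X
    proof -
      have i: "norm (T2 * (J * X)) = norm (J * X)" using isometry_norm[OF T2, of "J * X"] J(3) by (simp add: mult.assoc[symmetric])
      have "norm (C * X) = norm (tp (T2 * J) * (F * (T2 * (J * X))))" by (simp add: C_def mult.assoc pr)
      also have "\<dots> \<le> norm (F * (T2 * (J * X)))"
      proof -
        define Z where "Z = F * (T2 * (J * X))"
        \<comment> \<open>\<open>P\<close> projects onto the range of the partial isometry
          \<open>T2 * J\<close>, which shows that the adjoint of that isometry is a
          contraction.\<close>
        define P where "P = T2 * J * tp (T2 * J)"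
        have "tp (T2 * J) * (T2 * J) = J * (tp T2 * T2) * J" by (simp add: pr mult.assoc)
        then have h: "tp (T2 * J) * (T2 * J) = J" by (simp add: T2 J(3) pr JI)
        have "proj P" unfolding P_def by (rule proj_of_isometry[OF h]) (simp add: pr mult.assoc)
        have "norm (tp (T2 * J) * Z) = norm (T2 * J * (tp (T2 * J) * Z))"
          by (rule isometry_norm[OF h, symmetric]) (simp add: pr mult.assoc)
        also have "\<dots> = norm (P * Z)" by (simp add: P_def mult.assoc)
        also have "\<dots> \<le> norm Z" by (rule proj_norm_le) fact
        finally show ?thesis by (simp add: Z_def)
      qed
      also have "\<dots> \<le> e * norm (T2 * (J * X))" by (rule opbD(1)[OF F])
      also have "\<dots> \<le> e * norm X" using i e0 proj_norm_le[OF J(1)] by (simp add: mult_left_mono)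
      finally show ?thesis .
    qed
    then show ?thesis using e0 by (simp add: opb_def)
  qed
  have zz: "\<bar>inner E (T2 * A * tp T2)\<bar> \<le> 2 * e * \<mu> * norm A"
  proof -
    have "A * (J * X) = A * X" for X using AJ(2) by (metis mult.assoc)
    moreover have "J * (A * X) = A * X" for X using AJ(1) by (metis mult.assoc)
    ultimately have "T2 * A * tp T2 = (T2 * J * A) * tp (T2 * J)" by (simp add: pr mult.assoc)
    then have "inner E (T2 * A * tp T2) = inner (F * (T2 * J)) (T2 * J * A)"
      using bilin[of "T2 * J * A" "T2 * J"] K(2) by (simp add: mult.assoc KT2J)
    also have "\<dots> = inner A (tp (T2 * J) * (F * (T2 * J)))"
      using inner_mult_l[of "T2 * J" A "F * (T2 * J)"] by (simp only: inner_commute)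
    also have "\<dots> = inner C A" by (simp add: C_def pr mult.assoc inner_commute)
    finally have 1: "inner E (T2 * A * tp T2) = inner C A" .
    show ?thesis unfolding 1 using mu
    proof
      assume "norm W \<le> \<mu>"
      then show "\<bar>inner C A\<bar> \<le> 2 * e * \<mu> * norm A" unfolding A_def
        by (intro inner_proj_diff_le W Pt tpC C) (use Pt in auto)
    next
      assume m: "norm (J - W) \<le> \<mu>"
      \<comment> \<open>The complements inside \<open>J\<close> have equal rank as well, and their
        difference is again \<open>A\<close>; the bound then uses the corank.\<close>
      have "norm (J - Pt) = norm (J - W)"
        using proj_norm_sub[OF Pt(1) J(1) Pt(2)] proj_norm_sub[OF W(1) J(1) W(2)] Pt(3) by (metis norm_ge_zero power2_eq_imp_eq)
      then have "\<bar>inner C ((J - Pt) - (J - W))\<bar> \<le> 2 * e * \<mu> * norm ((J - Pt) - (J - W))"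
        using m Q Qt by (intro inner_proj_diff_le tpC C) (auto simp: Q_def)
      moreover have "(J - Pt) - (J - W) = A" by (simp add: A_def)
      ultimately show "\<bar>inner C A\<bar> \<le> 2 * e * \<mu> * norm A" by simp
    qed
  qed
  have dec: "(T1 + T2) * A * tp (T1 + T2) = - (tp R * R) - tp R * tp T2 - T2 * R + T2 * A * tp T2"
    by (simp only: tp_simps distrib_left distrib_right T1AT1) (simp add: T1A mult.assoc ATp)
  have "inner S (Pt - W) = (norm (Pt * tp T1))\<^sup>2 - (norm (W * tp T1))\<^sup>2 + inner E ((T1 + T2) * (Pt - W) * tp (T1 + T2))"
    by (rule cov_gap) (use assms IW IPt in auto)
  moreover have "inner E ((T1 + T2) * (Pt - W) * tp (T1 + T2)) = - inner E ((T1 + T2) * A * tp (T1 + T2))"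
  proof -
    have "Pt - W = - A" by (simp add: A_def)
    then show ?thesis by (simp only: mult_minus_right mult_minus_left inner_minus_right)
  qed
  moreover have "inner E ((T1 + T2) * A * tp (T1 + T2)) = - inner E (tp R * R) - 2 * inner E (tp R * tp T2) + inner E (T2 * A * tp T2)"
    unfolding dec by (simp add: inner_diff_right inner_add_right zs)
  moreover have "(norm (tp T1))\<^sup>2 = (norm (W * tp T1))\<^sup>2 + Y\<^sup>2"
    using proj_pythag[OF W(1), of "tp T1"] by (simp add: Y left_diff_distrib T1)
  moreover have "(norm (tp T1))\<^sup>2 = (norm (Pt * tp T1))\<^sup>2 + (norm (tp T1 - Pt * tp T1))\<^sup>2"
    by (rule proj_pythag[OF Pt(1)])
  moreover have "(norm (tp T1 - Pt * tp T1))\<^sup>2 \<le> (norm ((I - J) * tp T1))\<^sup>2"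
  proof -
    \<comment> \<open>The rows kept by \<open>J\<close> are reproduced exactly by \<open>Pt\<close>,
      so its bias comes from the omitted rows alone.\<close>
    have "tp T1 - Pt * tp T1 = (I - J) * tp T1 - Pt * ((I - J) * tp T1)"
    proof -
      have "Pt * (J * tp T1) = J * tp T1" using T1(1) by (simp add: mult.assoc)
      then show ?thesis by (simp add: left_diff_distrib right_diff_distrib T1)
    qed
    then show ?thesis using proj_pythag[OF Pt(1), of "(I - J) * tp T1"] by simp
  qed
  ultimately show ?thesis using opt ss sz zz unfolding A_def[symmetric] by linarith
qed

text \<open>This is the size of the direction in which the second sample is tested. The signal
  enters only through the missed parts \<open>Y\<close> and \<open>Y0\<close>, never in full, so
  that small noise times this quantity can be absorbed.\<close>

lemma stage2_noise:
  assumes W: "proj W" "I * W = W" and W0: "proj W0" "I * W0 = W0"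
    and I: "proj I" "I * tp T1 = tp T1" "tp T2 * T2 = I"
    and Y: "Y = norm ((I - W) * tp T1)" and Y0: "Y0 = norm ((I - W0) * tp T1)"
  shows "norm ((T1 + T2) * (W - W0) * tp (T1 + T2)) \<le> Y\<^sup>2 + Y0\<^sup>2 + 2 * (Y + Y0) + norm (W - W0)"
proof -
  define A where "A = W - W0"
  have tpA: "tp A = A" using W W0 by (simp add: A_def projD)
  have IA: "I * A = A" by (simp add: A_def right_diff_distrib W W0)
  have pQ: "proj (I - X)" if "proj X" "I * X = X" for X by (rule proj_diff[OF that(1) I(1) that(2)])
  have At: "A * tp T1 = (I - W0) * tp T1 - (I - W) * tp T1" by (simp add: A_def left_diff_distrib)
  \<comment> \<open>Idempotence of \<open>I - X\<close> puts the missed part on both sides, so the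
    pure signal block is quadratic in it.\<close>
  have q: "norm (T1 * ((I - X) * tp T1)) \<le> (norm ((I - X) * tp T1))\<^sup>2" if "proj X" "I * X = X" for X
  proof -
    have "T1 * ((I - X) * tp T1) = tp ((I - X) * tp T1) * ((I - X) * tp T1)"
      using projD[OF pQ[OF that]] by (simp add: mult.assoc del: tp_simps(2)) 
    also have "norm \<dots> \<le> norm ((I - X) * tp T1) * norm ((I - X) * tp T1)"
      using norm_mult_fmat[of "tp ((I - X) * tp T1)" "(I - X) * tp T1"] by (simp only: norm_tp)
    finally show ?thesis by (simp add: power2_eq_square)
  qed
  have n1: "norm (A * tp T1) \<le> Y + Y0"
    unfolding At Y Y0 using norm_triangle_ineq4[of "(I - W0) * tp T1" "(I - W) * tp T1"] by linarith
  have n1': "norm (T1 * A) \<le> Y + Y0"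
    using n1 norm_tp[of "A * tp T1"] by (simp add: tpA)
  have n11: "norm (T1 * A * tp T1) \<le> Y\<^sup>2 + Y0\<^sup>2"
  proof -
    have "T1 * A * tp T1 = T1 * ((I - W0) * tp T1) - T1 * ((I - W) * tp T1)"
      by (simp add: mult.assoc At right_diff_distrib)
    then have "norm (T1 * A * tp T1) \<le> norm (T1 * ((I - W0) * tp T1)) + norm (T1 * ((I - W) * tp T1))"
      by (simp only: norm_triangle_ineq4)
    then show ?thesis using q[OF W] q[OF W0] unfolding Y Y0 by linarith
  qed
  have iso: "norm (T2 * X) = norm X" if "I * X = X" for X by (rule isometry_norm[OF I(3) that])
  have n21: "norm (T2 * A * tp T1) \<le> Y + Y0"
    using iso[of "A * tp T1"] n1 IA by (simp add: mult.assoc mult_cancel_l)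
  have n12: "norm (T1 * A * tp T2) \<le> Y + Y0"
    using norm_tp[of "T2 * A * tp T1"] n21 by (simp add: tpA mult.assoc)
  have n22: "norm (T2 * A * tp T2) = norm A"
  proof -
    have "norm (T2 * A * tp T2) = norm (A * tp T2)" using iso[of "A * tp T2"] IA by (simp add: mult.assoc mult_cancel_l)
    also have "\<dots> = norm (T2 * A)" using norm_tp[of "A * tp T2"] by (simp add: tpA)
    finally show ?thesis using iso[OF IA] by simp
  qed
  have "(T1 + T2) * A * tp (T1 + T2) = T1 * A * tp T1 + T2 * A * tp T1 + (T1 * A * tp T2 + T2 * A * tp T2)"
    by (simp add: distrib_left distrib_right)
  then have "norm ((T1 + T2) * A * tp (T1 + T2)) \<le> norm (T1 * A * tp T1) + norm (T2 * A * tp T1) + (norm (T1 * A * tp T2) + norm (T2 * A * tp T2))"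
    by (simp only:) (intro order_trans[OF norm_triangle_ineq] add_mono norm_triangle_ineq)
  moreover have "x \<le> Y\<^sup>2 + Y0\<^sup>2 + 2 * (Y + Y0) + e"
    if "x \<le> a + b + (c + d)" "a \<le> Y\<^sup>2 + Y0\<^sup>2" "b \<le> Y + Y0" "c \<le> Y + Y0" "d = e" for x a b c d e :: real
    using that by (simp add: algebra_simps)
  ultimately show ?thesis using n11 n21 n12 n22 unfolding A_def[symmetric] by blast
qed

section \<open>Frames, leading eigenvectors and the Ky Fan principle\<close>

definition Pj :: "nat \<Rightarrow> nat \<Rightarrow> rmat \<Rightarrow> fmat" where
  "Pj p r W = fm p r W * tp (fm p r W)"

lemma ent_Pj: "ent (Pj p r W) i j = (if i < p \<and> j < p then \<Sum>a<r. W i a * W j a else 0)"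
proof -
  have b: "bnd (fm p r W) (max p r)" by (rule bnd_fm) auto
  show ?thesis unfolding Pj_def ent_times[OF b] ent_tp ent_fm
    by (auto intro!: sum.mono_neutral_cong_right split: if_splits)
qed

lemma orthonormal_gram:
  assumes "orthonormal_cols p r W"
  shows "tp (fm p r W) * fm p r W = coord {..<r}"
proof (rule fmat_eqI)
  fix a b
  have bd: "bnd (tp (fm p r W)) (max p r)" by (simp add: bnd_fm)
  have "(\<Sum>i<max p r. ent (fm p r W) i a * ent (fm p r W) i b) =
      (if a < r \<and> b < r then \<Sum>i<p. W i a * W i b else 0)"
    by (auto intro!: sum.mono_neutral_cong_right split: if_splits)
  then show "ent (tp (fm p r W) * fm p r W) a b = ent (coord {..<r}) a b"
    unfolding ent_times[OF bd] ent_tp using assms by (auto simp: orthonormal_cols_def)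
qed

lemma fm_coord: "fm p r W * coord {..<r} = fm p r W"
  by (rule fmat_eqI) (simp add: ent_coord_r)

lemma coord_fm_p: "coord {..<p} * fm p r W = fm p r W"
  by (rule fmat_eqI) (simp add: ent_coord_l)

lemma proj_Pj: "orthonormal_cols p r W \<Longrightarrow> proj (Pj p r W)"
  unfolding Pj_def by (rule proj_of_isometry[OF orthonormal_gram fm_coord])

lemma coord_Pj: "coord {..<p} * Pj p r W = Pj p r W"
  unfolding Pj_def by (simp add: mult.assoc[symmetric] coord_fm_p)

lemma norm_Pj: assumes "orthonormal_cols p r W" shows "(norm (Pj p r W))\<^sup>2 = real r"
proof -
  let ?F = "fm p r W"
  have "inner (?F * tp ?F) (?F * tp ?F) = inner (tp ?F * ?F) (tp ?F * ?F)"
    using inner_mult_l[of ?F "tp ?F" "?F * tp ?F"] inner_mult_r[of "tp ?F * ?F" "tp ?F" "tp ?F"]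
      inner_commute by (metis inner_mult_r mult.assoc tp_simps(4))
  then show ?thesis unfolding Pj_def by (simp only: power2_norm_eq_inner[symmetric] orthonormal_gram[OF assms] norm_coord finite_lessThan card_lessThan)
qed

lemma proj_loss_Pj: "proj_loss p r W V = (norm (Pj p r W - Pj p r V))\<^sup>2"
proof -
  have b: "bnd (Pj p r W - Pj p r V) p" unfolding bnd_def by (simp add: ent_Pj)
  show ?thesis unfolding norm_fmat_sq[OF b] proj_loss_def by (auto intro!: sum.cong simp: ent_Pj)
qed

lemma isometry_norm_r: assumes "tp V * V = C" "A * C = A" shows "norm (A * tp V) = norm (A::fmat)"
proof -
  have "C * tp A = tp A"
  proof -
    have "tp C = C" using assms(1) by auto
    then show ?thesis using assms(2) by (metis tp_times)
  qed
  then have "norm (V * tp A) = norm (tp A)" by (rule isometry_norm[OF assms(1)])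
  then show ?thesis by (metis norm_tp tp_times tp_simps(4))
qed

lemma norm_mult_Pj: assumes "orthonormal_cols p r V" shows "norm (A * Pj p r V) = norm (A * fm p r V)"
  unfolding Pj_def mult.assoc[symmetric]
  by (rule isometry_norm_r[OF orthonormal_gram[OF assms]]) (simp add: mult.assoc fm_coord)

lemma proj_loss_eq:
  assumes "orthonormal_cols p r W" "orthonormal_cols p r V"
  shows "proj_loss p r W V = 2 * (norm ((coord {..<p} - Pj p r W) * fm p r V))\<^sup>2"
proof -
  have "norm (Pj p r W) = norm (Pj p r V)"
    using norm_Pj[OF assms(1)] norm_Pj[OF assms(2)] by (metis norm_ge_zero power2_eq_imp_eq)
  then show ?thesis unfolding proj_loss_Pj
    by (subst proj_diff_norm[of _ _ "coord {..<p}"])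
       (auto simp: proj_Pj assms coord_Pj norm_mult_Pj)
qed

lemma frame_le: assumes "orthonormal_cols p r V" shows "r \<le> p"
proof -
  have "real r = (norm (Pj p r V * coord {..<p}))\<^sup>2"
    using coord_Pj[of p r V] norm_Pj[OF assms] projD(1)[OF proj_Pj[OF assms]] by (metis tp_coord tp_times)
  also have "\<dots> \<le> (norm (coord {..<p}))\<^sup>2" by (intro power_mono proj_norm_le proj_Pj assms) auto
  finally show ?thesis by (simp add: norm_coord)
qed

text \<open>Half the loss is the squared norm of a product of two projections, one of rank
  \<open>p - r\<close> and one of rank \<open>r\<close>; it is bounded by either rank.\<close>

lemma proj_loss_le:
  assumes "orthonormal_cols p r W" "orthonormal_cols p r V"
  shows "proj_loss p r W V \<le> 2 * real (min r (p - r))"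
proof -
  let ?I = "coord {..<p}" and ?W = "Pj p r W" and ?P = "Pj p r V"
  have Q: "proj (?I - ?W)" by (intro proj_diff proj_Pj assms coord_Pj) auto
  have n: "(norm ((?I - ?W) * fm p r V))\<^sup>2 = (norm ((?I - ?W) * ?P))\<^sup>2" by (simp add: norm_mult_Pj assms)
  have 1: "(norm ((?I - ?W) * ?P))\<^sup>2 \<le> (norm ?P)\<^sup>2" by (intro power_mono proj_norm_le Q) auto
  have 2: "(norm ((?I - ?W) * ?P))\<^sup>2 \<le> (norm (?I - ?W))\<^sup>2" by (intro power_mono proj_norm_le_r proj_Pj assms) auto
  have 3: "(norm (?I - ?W))\<^sup>2 = real p - real r"
    by (subst proj_norm_sub) (auto simp: proj_Pj assms coord_Pj norm_Pj norm_coord)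
  show ?thesis unfolding proj_loss_eq[OF assms] n using 1 2 3 norm_Pj[OF assms(2)] frame_le[OF assms(1)]
    by (simp add: of_nat_diff min_def)
qed

text \<open>Gram--Schmidt: the case \<open>y = 0\<close> pads the projection so that its rank is exactly the number of columns.\<close>
lemma proj_extend:
  assumes J: "proj J" "(norm J)\<^sup>2 = real k" and P: "proj P" "J * P = P" "(norm P)\<^sup>2 = real m" "m < k"
    and x: "J * x = x" "x * coord {0} = x"
  shows "\<exists>P'. proj P' \<and> J * P' = P' \<and> (norm P')\<^sup>2 = real (Suc m) \<and> P' * P = P \<and> P' * x = x"
proof -
  have Q: "proj (J - P)" by (rule proj_diff[OF P(1) J(1) P(2)])
  have "\<exists>y. y \<noteq> 0 \<and> (J - P) * y = y \<and> y * coord {0} = y \<and> (y = (J - P) * x \<or> (J - P) * x = 0)"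
  proof (cases "(J - P) * x = 0")
    case True
    have "(norm (J - P))\<^sup>2 \<noteq> 0" using proj_norm_sub[OF P(1) J(1) P(2)] J(2) P(3,4) by simp
    then have "J - P \<noteq> 0" by auto
    then obtain i j where ij: "ent (J - P) i j \<noteq> 0" using fmat_eqI[of "J - P" 0] by auto
    \<comment> \<open>A unit column vector that picks a nonzero column of \<open>J - P\<close>; one
      exists because the rank of \<open>J\<close> exceeds \<open>m\<close>.\<close>
    define e where "e = fm (Suc j) 1 (\<lambda>a b. if a = j then 1 else 0)"
    have "ent ((J - P) * e) i 0 = ent (J - P) i j"
    proof -
      have "bnd e (Suc j)" unfolding e_def by (rule bnd_fm) auto
      then show ?thesis unfolding ent_times'[OF \<open>bnd e (Suc j)\<close>] by (simp add: e_def)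
    qed
    then have "(J - P) * e \<noteq> 0" using ij by (metis ent_simps(1))
    moreover have "e * coord {0} = e" by (rule fmat_eqI) (auto simp: e_def ent_coord_r)
    ultimately show ?thesis using True projD[OF Q] by (intro exI[of _ "(J - P) * e"]) (simp add: mult.assoc)
  next
    case False
    then show ?thesis using projD[OF Q] x by (intro exI[of _ "(J - P) * x"]) (simp add: mult.assoc)
  qed
  then obtain y where y: "y \<noteq> 0" "(J - P) * y = y" "y * coord {0} = y" "y = (J - P) * x \<or> (J - P) * x = 0" by blast
  have Qpr: "P * (J - P) = 0" "J * (J - P) = J - P"
    using P J projD[OF P(1)] projD[OF J(1)] by (metis right_diff_distrib tp_times cancel_comm_monoid_add_class.diff_cancel, simp add: right_diff_distrib P projD[OF J(1)])
  have Py: "P * y = 0" using y(2) Qpr by (metis mult.assoc mult_zero_left)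
  have Jy: "J * y = y" using y(2) Qpr by (metis mult.assoc)
  define u where "u = (1 / norm y) *\<^sub>R y"
  have u0: "u * coord {0} = u" "P * u = 0" "J * u = u" "norm u = 1" using y Py Jy by (simp_all add: u_def)
  have uu: "tp u * u = coord {0}"
  proof (rule fmat_eqI)
    obtain N where N: "bnd u N" using bnd_ex by blast
    have e: "ent u i j = (if j = 0 then ent u i j else 0)" for i j
      using arg_cong[OF u0(1), of "\<lambda>z. ent z i j"] by (simp add: ent_coord_r)
    have N1: "bnd u (Suc N)" using N by (rule bnd_mono) simp
    have "1 = (\<Sum>i<Suc N. \<Sum>j<Suc N. (ent u i j)\<^sup>2)" using norm_fmat_sq[OF N1] u0 by simp
    also have "\<dots> = (\<Sum>i<Suc N. (ent u i 0)\<^sup>2)"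
    proof (intro sum.cong refl)
      fix i
      have "(\<Sum>j<Suc N. (ent u i j)\<^sup>2) = (\<Sum>j<Suc N. if j = 0 then (ent u i 0)\<^sup>2 else 0)"
        using e by (intro sum.cong refl) (metis power_zero_numeral)
      then show "(\<Sum>j<Suc N. (ent u i j)\<^sup>2) = (ent u i 0)\<^sup>2" by simp
    qed
    finally have s: "(\<Sum>i<Suc N. (ent u i 0)\<^sup>2) = 1" by simp
    fix i j
    have b: "bnd (tp u) (Suc N)" using N1 by simp
    show "ent (tp u * u) i j = ent (coord {0}) i j"
    proof (cases "i = 0 \<and> j = 0")
      case True then show ?thesis using s unfolding ent_times[OF b] by (simp add: power2_eq_square)
    next
      case False
      then have "ent u a i * ent u a j = 0" for a using e[of a i] e[of a j] by auto
      then have "ent (tp u * u) i j = 0" unfolding ent_times[OF b] ent_tp by (simp only: sum.neutral_const)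
      then show ?thesis using False by auto
    qed
  qed
  define P' where "P' = P + u * tp u"
  have pu: "proj (u * tp u)" by (rule proj_of_isometry[OF uu u0(1)])
  have uP: "tp u * P = 0" "tp u * (P * A) = 0" for A
  proof -
    have "tp (P * u) = tp 0" using u0 by simp
    then show "tp u * P = 0" by (simp add: projD[OF P(1)])
    then show "tp u * (P * A) = 0" by (simp add: mult.assoc[symmetric])
  qed
  have Pu: "P * (u * A) = 0" for A using u0 by (simp add: mult.assoc[symmetric])
  have "proj P'" using projD[OF P(1)] projD[OF pu]
    by (simp add: proj_def P'_def distrib_left distrib_right mult.assoc uP Pu)
  moreover have "J * P' = P'" by (simp add: P'_def distrib_left P mult.assoc[symmetric] u0)
  moreover have "(norm P')\<^sup>2 = real (Suc m)"
  proof -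
    have "inner P (u * tp u) = 0" using proj_inner[OF P(1) pu] by (simp add: Pu)
    moreover have "norm (u * tp u) = 1" using isometry_norm_r[OF uu u0(1)] u0 by simp
    ultimately have "(norm P')\<^sup>2 = (norm P)\<^sup>2 + 1"
      unfolding P'_def power2_norm_eq_inner inner_add_left inner_add_right
      by (simp add: inner_commute power2_norm_eq_inner[symmetric])
    then show ?thesis using P by simp
  qed
  moreover have "P' * P = P" by (simp add: P'_def distrib_right projD[OF P(1)] mult.assoc uP)
  moreover have "P' * x = x"
  proof -
    have x1: "x = P * x + (J - P) * x" by (simp add: left_diff_distrib x)
    have a: "P' * (P * x) = P * x" by (simp add: P'_def distrib_right projD[OF P(1)] mult.assoc uP)
    have b: "P' * y = y"
    proof -
      have "u * tp u * u = u" by (simp add: mult.assoc uu u0)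
      then have "u * tp u * (norm y *\<^sub>R u) = norm y *\<^sub>R u" by (simp only: mult_scaleR_right)
      moreover have "norm y *\<^sub>R u = y" using y(1) by (simp add: u_def)
      ultimately have "u * tp u * y = y" by (simp only:)
      then show ?thesis by (simp add: P'_def distrib_right Py)
    qed
    have "P' * ((J - P) * x) = (J - P) * x" using y(4) b by auto
    then show ?thesis using a x1 by (metis distrib_left)
  qed
  ultimately show ?thesis by blast
qed

text \<open>Truncating the rows of an orthonormal frame can make its columns dependent. The
  projection produced here still has rank exactly \<open>r\<close>, as a competitor in the
  variational principle must.\<close>

lemma proj_span:
  assumes J: "proj J" "(norm J)\<^sup>2 = real k" and "r \<le> k" and V: "J * V = V"
  shows "\<exists>P. proj P \<and> J * P = P \<and> (norm P)\<^sup>2 = real r \<and> P * (V * coord {..<r}) = V * coord {..<r}"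
  using \<open>r \<le> k\<close>
proof (induction r)
  case 0
  have "coord {..<0::nat} = 0" by (rule fmat_eqI) auto
  then show ?case by (intro exI[of _ 0]) (simp add: proj_def)
next
  case (Suc m)
  then obtain P where P: "proj P" "J * P = P" "(norm P)\<^sup>2 = real m" "P * (V * coord {..<m}) = V * coord {..<m}" by auto
  \<comment> \<open>\<open>V * sh\<close> is column \<open>m\<close> of \<open>V\<close> moved to
    position 0, the form in which column vectors are represented.\<close>
  define sh where "sh = fm (Suc m) 1 (\<lambda>a b. if a = m then 1 else 0)"
  have bs: "bnd sh (Suc m)" unfolding sh_def by (rule bnd_fm) auto
  have "J * (V * sh) = V * sh" by (simp add: mult.assoc[symmetric] V)
  moreover have "sh * coord {0} = sh" by (rule fmat_eqI) (auto simp: sh_def ent_coord_r)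
  then have "V * sh * coord {0} = V * sh" by (simp add: mult.assoc)
  ultimately obtain P' where P': "proj P'" "J * P' = P'" "(norm P')\<^sup>2 = real (Suc m)" "P' * P = P" "P' * (V * sh) = V * sh"
    using proj_extend[OF J P(1-3)] Suc.prems by (metis Suc_le_eq)
  have d: "coord {..<Suc m} = coord {..<m} + sh * tp sh"
  proof (rule fmat_eqI)
    fix i j
    have "(\<Sum>l<Suc m. ent sh i l * ent sh j l) = (\<Sum>l<Suc m. if l = 0 then (if i = m \<and> j = m then 1 else 0) else 0)"
      by (intro sum.cong refl) (auto simp: sh_def)
    also have "\<dots> = (if i = m \<and> j = m then 1 else 0)" by (subst sum.delta) auto
    finally show "ent (coord {..<Suc m}) i j = ent (coord {..<m} + sh * tp sh) i j"
      by (auto simp: ent_times[OF bs] simp del: sum.lessThan_Suc)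
  qed
  have "P' * (V * coord {..<m}) = V * coord {..<m}" using P(4) P'(4) by (metis mult.assoc)
  moreover have "P' * (V * (sh * tp sh)) = V * (sh * tp sh)" using P'(5) by (metis mult.assoc)
  ultimately have "P' * (V * coord {..<Suc m}) = V * coord {..<Suc m}" unfolding d by (simp add: distrib_left)
  then show ?case using P' by blast
qed

lemma trace_quad_inner: "trace_quad p r S W = inner (fm p p S) (Pj p r W)"
proof -
  have b: "bnd (fm p p S) p" by (rule bnd_fm) auto
  have "trace_quad p r S W = (\<Sum>i<p. \<Sum>a<r. \<Sum>j<p. W i a * S i j * W j a)"
    unfolding trace_quad_def by (rule sum.swap)
  also have "\<dots> = (\<Sum>i<p. \<Sum>j<p. \<Sum>a<r. W i a * S i j * W j a)"
    by (intro sum.cong refl sum.swap)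
  also have "\<dots> = inner (fm p p S) (Pj p r W)"
    unfolding inner_fmat_bnd[OF b] by (auto intro!: sum.cong simp: ent_Pj sum_distrib_left algebra_simps)
  finally show ?thesis .
qed

section \<open>Spectral decomposition and the variational principle\<close>

locale eig =
  fixes p r :: nat and M W E :: rmat and \<nu> :: "nat \<Rightarrow> real"
  assumes E: "orthonormal_cols p p E"
    and ev: "\<And>a i. a < p \<Longrightarrow> i < p \<Longrightarrow> (\<Sum>j<p. M i j * E j a) = \<nu> a * E i a"
    and dec: "\<And>a b. a \<le> b \<Longrightarrow> b < p \<Longrightarrow> \<nu> b \<le> \<nu> a"
    and W: "\<And>i a. i < p \<Longrightarrow> a < r \<Longrightarrow> W i a = E i a"
    and rp: "r \<le> p"
begin

abbreviation "Ef \<equiv> fm p p E"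
definition "Nf = fm p p (\<lambda>a b. if a = b then \<nu> a else 0)"

lemma gram: "tp Ef * Ef = coord {..<p}" by (rule orthonormal_gram[OF E])

text \<open>A rank count replaces invertibility: the projection onto the columns has rank
  \<open>p\<close> inside a space of dimension \<open>p\<close>, so it is the whole
  identity.\<close>

lemma gram': "Ef * tp Ef = coord {..<p}"
proof -
  have "(norm (coord {..<p} - Pj p p E))\<^sup>2 = 0"
    by (subst proj_norm_sub) (auto simp: proj_Pj E coord_Pj norm_Pj norm_coord)
  then show ?thesis by (simp add: Pj_def)
qed

lemma ME: "fm p p M * Ef = Ef * Nf"
proof (rule fmat_eqI)
  fix i a
  have b: "bnd (fm p p M) p" "bnd Ef p" by (rule bnd_fm; simp)+
  have "(\<Sum>l<p. ent Ef i l * ent Nf l a) = (\<Sum>l<p. if l = a then ent Ef i a * \<nu> a else 0)"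
    by (intro sum.cong refl) (auto simp: Nf_def)
  then show "ent (fm p p M * Ef) i a = ent (Ef * Nf) i a"
    unfolding ent_times[OF b(1)] ent_times[OF b(2)] using ev[of a i] by (auto simp: mult.commute)
qed

lemma M_eq: "fm p p M = Ef * Nf * tp Ef"
proof -
  have "fm p p M * coord {..<p} = fm p p M" by (rule fm_coord)
  then show ?thesis by (simp add: gram'[symmetric] ME mult.assoc[symmetric])
qed

lemma Pj_eq: "Pj p r W = Ef * coord {..<r} * tp Ef"
proof -
  have "fm p r W = Ef * coord {..<r}"
    using rp W by (intro fmat_eqI) (auto simp: ent_coord_r)
  then show ?thesis by (simp add: Pj_def mult.assoc) (simp add: mult.assoc[symmetric] coord_mult)
qed

lemma orth_W: "orthonormal_cols p r W"
  using E W rp unfolding orthonormal_cols_def by (auto simp: W)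

lemma inner_M: "inner (fm p p M) P = (\<Sum>a<p. \<nu> a * ent (tp Ef * P * Ef) a a)"
proof -
  have b: "bnd Nf p" unfolding Nf_def by (rule bnd_fm) auto
  have "inner (fm p p M) P = inner Nf (tp Ef * P * Ef)"
    unfolding M_eq using inner_mult_r[of "Ef * Nf" "tp Ef" P] inner_mult_l[of Ef Nf "P * Ef"] by (simp add: mult.assoc)
  also have "\<dots> = (\<Sum>a<p. \<Sum>b<p. if b = a then \<nu> a * ent (tp Ef * P * Ef) a a else 0)"
    unfolding inner_fmat_bnd[OF b] by (intro sum.cong refl) (auto simp: Nf_def)
  finally show ?thesis by simp
qed

lemma proj_conj: assumes "proj P" "coord {..<p} * P = P"
  shows "proj (tp Ef * P * Ef)" "norm (tp Ef * P * Ef) = norm P" "bnd (tp Ef * P * Ef) p"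
proof -
  have "tp Ef * P * Ef * (tp Ef * P * Ef) = tp Ef * (P * (Ef * tp Ef) * P) * Ef" by (simp add: mult.assoc)
  also have "P * (Ef * tp Ef) * P = P" using assms by (simp add: gram' mult.assoc projD)
  finally have idem: "tp Ef * P * Ef * (tp Ef * P * Ef) = tp Ef * P * Ef" .
  have "tp (tp Ef * P * Ef) = tp Ef * P * Ef" using assms by (simp add: mult.assoc projD)
  then show "proj (tp Ef * P * Ef)" using idem unfolding proj_def by (rule conjI)
  have gt: "tp (tp Ef) * tp Ef = coord {..<p}" by (simp add: gram')
  have Pc: "P * coord {..<p} = P" using assms by (metis projD(1) tp_times tp_coord)
  have "norm (tp Ef * (P * Ef)) = norm (P * Ef)"
    by (rule isometry_norm[OF gt]) (simp add: mult.assoc[symmetric] assms)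
  also have "\<dots> = norm (P * tp (tp Ef))" by simp
  also have "\<dots> = norm P" by (rule isometry_norm_r[OF gt Pc])
  finally show "norm (tp Ef * P * Ef) = norm P" by (simp add: mult.assoc)
  have "P = coord {..<p} * P * coord {..<p}" using assms Pc by simp
  then have "bnd P p"
    unfolding bnd_def by (metis ent_coord_l ent_coord_r finite_lessThan lessThan_iff not_le)
  then show "bnd (tp Ef * P * Ef) p" by (intro bnd_times) (auto simp: bnd_fm)
qed

text \<open>A diagonal entry of a projection is the squared length of its row, in particular at
  least its own square. These entries are the weights that a competitor puts on the
  eigenvalues.\<close>

lemma proj_diag: assumes "proj C" "bnd C p"
  shows "ent C a a = (\<Sum>b<p. (ent C a b)\<^sup>2)" "0 \<le> ent C a a" "ent C a a \<le> 1" "(\<Sum>a<p. ent C a a) = (norm C)\<^sup>2"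
proof -
  have s: "ent C i j = ent C j i" for i j using projD(1)[OF assms(1)] by (metis ent_tp)
  have d: "ent C a a = (\<Sum>b<p. (ent C a b)\<^sup>2)" for a
  proof -
    have "ent C a a = ent (C * C) a a" by (simp add: projD(2)[OF assms(1)])
    then show ?thesis unfolding ent_times[OF assms(2)] using s by (simp add: power2_eq_square)
  qed
  show "ent C a a = (\<Sum>b<p. (ent C a b)\<^sup>2)" by (rule d)
  show nn: "0 \<le> ent C a a" by (subst d) (simp add: sum_nonneg)
  have "(ent C a a)\<^sup>2 \<le> ent C a a"
  proof (cases "a < p")
    case True
    then have "(ent C a a)\<^sup>2 \<le> (\<Sum>b<p. (ent C a b)\<^sup>2)" by (intro member_le_sum) auto
    then show ?thesis using d by simp
  next
    case False then show ?thesis using assms(2) by (simp add: bnd_def)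
  qed
  then show "ent C a a \<le> 1" using mult_strict_right_mono[of 1 "ent C a a" "ent C a a"]
    by (cases "ent C a a \<le> 1") (auto simp: power2_eq_square)
  show "(\<Sum>a<p. ent C a a) = (norm C)\<^sup>2" unfolding norm_fmat_sq[OF assms(2)] by (intro sum.cong refl d)
qed

text \<open>In the eigenbasis a rank \<open>r\<close> competitor spreads weights in
  \<open>[0, 1]\<close> of total \<open>r\<close> over the eigenvalues; putting full weight on the
  \<open>r\<close> largest is best.\<close>

lemma ky_fan:
  assumes P: "proj P" "coord {..<p} * P = P" "(norm P)\<^sup>2 = real r"
  shows "inner (fm p p M) P \<le> inner (fm p p M) (Pj p r W)"
proof -
  define c where "c a = ent (tp Ef * P * Ef) a a" for a
  have c: "0 \<le> c a" "c a \<le> 1" "(\<Sum>a<p. c a) = real r" for a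
    using proj_diag[OF proj_conj(1,3)[OF P(1,2)]] proj_conj(2)[OF P(1,2)] P(3) by (auto simp: c_def)
  have "tp Ef * Pj p r W * Ef = coord {..<p} * (coord {..<r} * coord {..<p})"
    unfolding Pj_eq using gram by (simp add: mult.assoc) (simp add: mult.assoc[symmetric])
  then have "tp Ef * Pj p r W * Ef = coord {..<r}" using rp by (simp add: coord_mult Int_absorb1 Int_absorb2)
  then have w: "inner (fm p p M) (Pj p r W) = (\<Sum>a<p. \<nu> a * (if a < r then 1 else 0))" by (simp add: inner_M)
  \<comment> \<open>Subtracting the threshold eigenvalue is free, because both systems of weights
    sum to \<open>r\<close>, and makes every term nonnegative. For \<open>r = 0\<close> truncated
    subtraction selects the largest eigenvalue, which also works.\<close>
  have "0 \<le> (\<Sum>a<p. (\<nu> a - \<nu> (r - 1)) * ((if a < r then 1 else 0) - c a))"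
  proof (intro sum_nonneg)
    fix a assume "a \<in> {..<p}"
    then show "0 \<le> (\<nu> a - \<nu> (r - 1)) * ((if a < r then 1 else 0) - c a)"
    proof (cases "a < r")
      case True
      then have "\<nu> (r - 1) \<le> \<nu> a" using rp by (intro dec) auto
      then show ?thesis using True c by simp
    next
      case False
      then have "\<nu> a \<le> \<nu> (r - 1)" using \<open>a \<in> {..<p}\<close> by (intro dec) auto
      then show ?thesis using False c mult_nonpos_nonneg[of "\<nu> a - \<nu> (r - 1)" "c a"] by simp
    qed
  qed
  also have "\<dots> = (\<Sum>a<p. \<nu> a * (if a < r then 1 else 0)) - (\<Sum>a<p. \<nu> a * c a)
      - \<nu> (r - 1) * ((\<Sum>a<p. (if a < r then 1 else 0)) - (\<Sum>a<p. c a))"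
    by (simp add: algebra_simps sum.distrib sum_subtractf sum_distrib_left sum_distrib_right)
  also have "(\<Sum>a<p. (if a < r then 1 else 0)) = real r"
    using rp by (simp add: sum.If_cases lessThan_def[symmetric] Int_absorb1)
  finally show ?thesis unfolding w using c(3) by (simp add: inner_M c_def)
qed

text \<open>A restricted matrix has zero eigenvalues whose eigenvectors may lie off the chosen
  coordinates. Definiteness on \<open>J\<close> yields \<open>k\<close> positive eigenvalues, so the
  first \<open>r \<le> k\<close> eigenvectors avoid that kernel.\<close>

lemma support:
  assumes J: "proj J" "(norm J)\<^sup>2 = real k" "r \<le> k" "coord {..<p} * J = J"
    and M: "J * fm p p M = fm p p M" and c: "c > 0" "\<And>A. c * (norm (J * A))\<^sup>2 \<le> inner A (fm p p M * A)"
  shows "J * Pj p r W = Pj p r W"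
proof -
  define x where "x a = Ef * coord {a}" for a
  have bE: "bnd Ef p" by (rule bnd_fm) auto
  have Mx: "fm p p M * x a = \<nu> a *\<^sub>R x a" if "a < p" for a
  proof -
    have "Nf * coord {a} = \<nu> a *\<^sub>R coord {a}" using that
      by (intro fmat_eqI) (auto simp: ent_coord_r Nf_def)
    then show ?thesis by (simp add: x_def mult.assoc[symmetric] ME) (simp add: mult.assoc)
  qed
  \<comment> \<open>Each eigenvector is either annihilated or fixed by \<open>J\<close>, according
    to whether its eigenvalue vanishes; \<open>J\<close> is therefore diagonal in the eigenbasis and
    its rank counts the nonzero eigenvalues.\<close>
  have Jx: "J * x a = (if \<nu> a \<noteq> 0 then x a else 0)" if a: "a < p" for a
  proof (cases "\<nu> a = 0")
    case True
    then have "c * (norm (J * x a))\<^sup>2 \<le> 0" using c(2)[of "x a"] Mx[OF a] by simp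
    then show ?thesis using True c(1) by (simp add: mult_le_0_iff not_le)
  next
    case False
    have "J * (\<nu> a *\<^sub>R x a) = \<nu> a *\<^sub>R x a" using Mx[OF a] M by (metis mult.assoc)
    then show ?thesis using False by simp
  qed
  have nu: "0 \<le> \<nu> a" if "a < p" for a
  proof -
    have "norm (x a) = norm (coord {a})" unfolding x_def
      by (rule isometry_norm[OF gram]) (use that in \<open>simp add: coord_mult\<close>)
    then have "(norm (x a))\<^sup>2 = 1" by (simp add: norm_coord)
    moreover have "0 \<le> c * (norm (J * x a))\<^sup>2" using c by simp
    ultimately show ?thesis using c(2)[of "x a"] Mx[OF that] by (simp add: power2_norm_eq_inner)
  qed
  have JE: "J * Ef = Ef * coord {a. a < p \<and> \<nu> a \<noteq> 0}"
  proof (rule fmat_eqI)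
    fix i a
    show "ent (J * Ef) i a = ent (Ef * coord {a. a < p \<and> \<nu> a \<noteq> 0}) i a"
    proof (cases "a < p")
      case True
      have "ent (J * Ef) i a = ent (J * Ef * coord {a}) i a" by (simp add: ent_coord_r)
      also have "\<dots> = ent (J * x a) i a" by (simp add: x_def mult.assoc)
      also have "\<dots> = (if \<nu> a \<noteq> 0 then ent Ef i a else 0)" using Jx[OF True] by (simp add: x_def ent_coord_r del: ent_fm)
      finally show ?thesis using True by (simp add: ent_coord_r del: ent_fm)
    next
      case False
      have "J * Ef = J * Ef * coord {..<p}" by (simp add: mult.assoc fm_coord)
      then have "ent (J * Ef) i a = 0" using False by (metis ent_coord_r finite_lessThan lessThan_iff)
      then show ?thesis using False by (simp add: ent_coord_r)
    qed
  qed
  have "tp Ef * J * Ef = coord {..<p} * coord {a. a < p \<and> \<nu> a \<noteq> 0}"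
    by (simp add: mult.assoc JE) (simp add: mult.assoc[symmetric] gram)
  also have "\<dots> = coord {a. a < p \<and> \<nu> a \<noteq> 0}" by (subst coord_mult) (auto intro!: arg_cong[of _ _ coord])
  finally have "real k = real (card {a. a < p \<and> \<nu> a \<noteq> 0})"
    using proj_conj(2)[OF J(1,4)] J(2) norm_coord[of "{a. a < p \<and> \<nu> a \<noteq> 0}"] by simp
  then have kc: "k = card {a. a < p \<and> \<nu> a \<noteq> 0}" by simp
  have "\<nu> a \<noteq> 0" if a: "a < r" for a
  proof
    assume "\<nu> a = 0"
    \<comment> \<open>A zero eigenvalue at position \<open>a\<close> leaves only smaller positions
      for nonzero ones, whence \<open>k \<le> a < r\<close>, a contradiction.\<close>
    have "{a. a < p \<and> \<nu> a \<noteq> 0} \<subseteq> {..<a}"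
    proof
      fix b assume b: "b \<in> {a. a < p \<and> \<nu> a \<noteq> 0}"
      show "b \<in> {..<a}"
      proof (rule ccontr)
        assume "b \<notin> {..<a}"
        then have "\<nu> b \<le> 0" using dec[of a b] b \<open>\<nu> a = 0\<close> by auto
        then show False using nu[of b] b by auto
      qed
    qed
    then have "k \<le> a" unfolding kc using card_mono[of "{..<a}"] by simp
    then show False using a J(3) by simp
  qed
  then have "{a. a < p \<and> \<nu> a \<noteq> 0} \<inter> {..<r} = {..<r}" using rp by auto
  then have "J * (Ef * coord {..<r}) = Ef * coord {..<r}"
    by (simp add: mult.assoc[symmetric] JE) (simp add: mult.assoc coord_mult)
  then show ?thesis unfolding Pj_eq by (metis mult.assoc)
qed

end

lemma leading_eig:
  assumes "leading_eigvecs p r M W" "r \<le> p"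
  obtains E \<nu> where "eig p r M W E \<nu>"
  using assms unfolding leading_eigvecs_def eig_def by metis

section \<open>The spiked model\<close>

lemma mult_le_quad: "2 * x * y \<le> c * x\<^sup>2 + y\<^sup>2 / c" if "c > 0" for x y c :: real
proof -
  have "0 \<le> (c * x - y)\<^sup>2 / c" using that by simp
  also have "\<dots> = c * x\<^sup>2 + y\<^sup>2 / c - 2 * x * y" using that by (simp add: power2_eq_square field_simps)
  finally show ?thesis by simp
qed

text \<open>Every occurrence of \<open>Y\<close> on the right is absorbed: the losses
  \<open>1/8 + 1/4 + 1/4\<close> leave \<open>3/8\<close> of its square. The constant 27 is
  \<open>80/3\<close> rounded up.\<close>

lemma oracle_arith:
  fixes Y :: real
  assumes lam: "lam > 0" and e: "0 \<le> e" "e \<le> 1/8" and \<kappa>: "\<kappa> \<ge> 1"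
    and Y: "Y\<^sup>2 \<le> \<kappa> * lam * D2 + e * Y\<^sup>2 + 2 * e * m * Y + 2 * e * m * N"
    and N: "e * m * N \<le> e * m * (N1 + N2)" "lam * N1\<^sup>2 \<le> 2 * Y\<^sup>2" "N2\<^sup>2 \<le> 2 * D2"
  shows "Y\<^sup>2 \<le> 27 * ((\<kappa> + 1) * lam * D2 + e\<^sup>2 * m\<^sup>2 * (1 + 1 / lam))"
proof -
  define z where "z = e * m"
  define q where "q = z\<^sup>2 / lam"
  have a: "2 * z * Y \<le> 4 * z\<^sup>2 + Y\<^sup>2 / 4" using mult_le_quad[of 4 z Y] by simp
  have b: "2 * z * N1 \<le> 8 * q + Y\<^sup>2 / 4"
  proof -
    have "N1\<^sup>2 / (8 / lam) \<le> Y\<^sup>2 / 4" using N(2) by (simp add: mult.commute)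
    moreover have "2 * z * N1 \<le> 8 / lam * z\<^sup>2 + N1\<^sup>2 / (8 / lam)" using lam by (intro mult_le_quad) simp
    moreover have "8 / lam * z\<^sup>2 = 8 * q" by (simp add: q_def)
    ultimately show ?thesis by linarith
  qed
  have c: "2 * z * N2 \<le> 2 * q + lam * D2"
  proof -
    have "2 * z * N2 \<le> 2 / lam * z\<^sup>2 + N2\<^sup>2 / (2 / lam)" using lam by (intro mult_le_quad) simp
    also have "N2\<^sup>2 / (2 / lam) \<le> (2 * D2) / (2 / lam)" using N(3) lam by (intro divide_right_mono) auto
    finally show ?thesis by (simp add: q_def mult.commute)
  qed
  have d: "e * Y\<^sup>2 \<le> Y\<^sup>2 / 8" using mult_right_mono[OF e(2), of "Y\<^sup>2"] by simp
  have f: "2 * e * m * N \<le> 2 * z * N1 + 2 * z * N2" using N(1) by (simp add: z_def algebra_simps)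
  have g: "2 * e * m * Y = 2 * z * Y" by (simp add: z_def)
  have "Y\<^sup>2 * 3 \<le> 8 * (\<kappa> * lam * D2 + lam * D2) + 32 * z\<^sup>2 + 80 * q"
    using a b c d f g Y unfolding distrib_left by linarith
  moreover have "0 \<le> q" "0 \<le> z\<^sup>2" using lam by (auto simp: q_def)
  moreover have "0 \<le> D2" using N(3) zero_le_power2[of N2] by linarith
  then have "0 \<le> \<kappa> * lam * D2 + lam * D2" using lam \<kappa> by simp
  ultimately have "Y\<^sup>2 \<le> 27 * ((\<kappa> * lam * D2 + lam * D2) + z\<^sup>2 + q)"
    unfolding distrib_left by linarith
  then show ?thesis by (simp add: z_def q_def power_mult_distrib algebra_simps)
qed

text \<open>Absorption leaves \<open>5/8\<close> of the square of \<open>Y\<close> against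
  \<open>11/8\<close> of that of \<open>Y0\<close>; the constants 3 and 26 are \<open>11/5\<close>
  and \<open>128/5\<close> rounded up.\<close>

lemma stage2_arith:
  fixes Y :: real
  assumes lam: "lam > 0" and e: "0 \<le> e" "e \<le> 1/8"
    and Y: "Y\<^sup>2 \<le> Y0\<^sup>2 + e * M" "M \<le> Y\<^sup>2 + Y0\<^sup>2 + 2 * (Y + Y0) + N"
    and N: "N \<le> N1 + N2" "lam * N1\<^sup>2 \<le> 2 * Y\<^sup>2" "lam * N2\<^sup>2 \<le> 2 * Y0\<^sup>2"
  shows "Y\<^sup>2 \<le> 3 * Y0\<^sup>2 + 26 * e\<^sup>2 * (1 + 1 / lam)"
proof -
  define q where "q = e\<^sup>2 / lam"
  have d: "e * Y\<^sup>2 \<le> Y\<^sup>2 / 8" "e * Y0\<^sup>2 \<le> Y0\<^sup>2 / 8"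
    using mult_right_mono[OF e(2), of "Y\<^sup>2"] mult_right_mono[OF e(2), of "Y0\<^sup>2"] by simp_all
  have a: "2 * e * Z \<le> 8 * e\<^sup>2 + Z\<^sup>2 / 8" for Z using mult_le_quad[of 8 e Z] by simp
  have b: "e * Z \<le> 4 * q + X\<^sup>2 / 8" if "lam * Z\<^sup>2 \<le> 2 * X\<^sup>2" for Z X
  proof -
    have "Z\<^sup>2 / (8 / lam) \<le> X\<^sup>2 / 4" using that by (simp add: mult.commute)
    moreover have "2 * e * Z \<le> 8 / lam * e\<^sup>2 + Z\<^sup>2 / (8 / lam)" using lam by (intro mult_le_quad) simp
    moreover have "8 / lam * e\<^sup>2 = 8 * q" by (simp add: q_def)
    ultimately show ?thesis by linarith
  qed
  have "e * M \<le> e * (Y\<^sup>2 + Y0\<^sup>2 + 2 * (Y + Y0) + (N1 + N2))"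
    using e Y(2) N(1) by (intro mult_left_mono) auto
  also have "\<dots> = e * Y\<^sup>2 + e * Y0\<^sup>2 + 2 * e * Y + 2 * e * Y0 + e * N1 + e * N2" by (simp add: algebra_simps)
  finally have "Y\<^sup>2 * 5 \<le> 11 * Y0\<^sup>2 + 128 * e\<^sup>2 + 64 * q"
    using d a[of Y] a[of Y0] b[OF N(2)] b[OF N(3)] Y(1) by linarith
  moreover have "0 \<le> q" "0 \<le> e\<^sup>2" "0 \<le> Y0\<^sup>2" using lam by (auto simp: q_def)
  ultimately have "Y\<^sup>2 \<le> 3 * Y0\<^sup>2 + 26 * (e\<^sup>2 + q)" unfolding distrib_left by linarith
  then show ?thesis by (simp add: q_def algebra_simps)
qed

text \<open>A Gaussian row \<open>g = (u, z)\<close> of length \<open>r + p\<close> yields the data row \<open>tp (T1 + T2) * g\<close>, so the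
  sample covariance error is the error of the identity covariance conjugated by \<open>T1 + T2\<close>.\<close>
definition T1m :: "nat \<Rightarrow> nat \<Rightarrow> rmat \<Rightarrow> (nat \<Rightarrow> real) \<Rightarrow> fmat" where
  "T1m r p V Ls = fm r p (\<lambda>a i. sqrt (Ls a) * V i a)"

definition T2m :: "nat \<Rightarrow> nat \<Rightarrow> fmat" where
  "T2m r p = fm (r + p) p (\<lambda>i j. if i = r + j then 1 else 0)"

definition gcol :: "nat \<Rightarrow> (nat \<times> nat \<Rightarrow> real) \<Rightarrow> nat \<Rightarrow> fmat" where
  "gcol d g t = fm d 1 (\<lambda>a _. g (t, a))"

definition gramE :: "nat \<Rightarrow> nat set \<Rightarrow> nat \<Rightarrow> (nat \<times> nat \<Rightarrow> real) \<Rightarrow> fmat" where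
  "gramE n Ts d g = (1 / real n) *\<^sub>R (\<Sum>t\<in>Ts. gcol d g t * tp (gcol d g t)) - coord {..<d}"

text \<open>Both Gaussian sources share one array: columns below \<open>r\<close> hold the factor
  scores, column \<open>r + j\<close> the noise of coordinate \<open>j\<close>.\<close>

definition Xd :: "nat \<Rightarrow> rmat \<Rightarrow> (nat \<Rightarrow> real) \<Rightarrow> (nat \<times> nat \<Rightarrow> real) \<Rightarrow> rmat" where
  "Xd r V Ls g = (\<lambda>t j. (\<Sum>a<r. g (t, a) * sqrt (Ls a) * V j a) + g (t, r + j))"

lemma tp_gramE: "tp (gramE n Ts d g) = gramE n Ts d g"
  by (simp add: gramE_def tp_sum)

lemma ent_gcol: "ent (gcol d g t * tp (gcol d g t)) a b = (if a < d \<and> b < d then g (t, a) * g (t, b) else 0)"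
proof -
  have b: "bnd (gcol d g t) (Suc d)" unfolding gcol_def by (rule bnd_fm) auto
  have "(\<Sum>l<Suc d. ent (gcol d g t) a l * ent (gcol d g t) b l)
      = (\<Sum>l<Suc d. if l = 0 then (if a < d \<and> b < d then g (t, a) * g (t, b) else 0) else 0)"
    by (intro sum.cong refl) (auto simp: gcol_def)
  also have "\<dots> = (if a < d \<and> b < d then g (t, a) * g (t, b) else 0)" by (subst sum.delta) auto
  finally show ?thesis unfolding ent_times[OF b] ent_tp .
qed

lemma inner_gramE:
  assumes "n > 0" "card Ts = n"
  shows "real n * inner (gramE n Ts d g) H
    = (\<Sum>t\<in>Ts. (\<Sum>a<d. \<Sum>b<d. g (t, a) * ent H a b * g (t, b)) - (\<Sum>a<d. ent H a a))"
proof -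
  have 1: "inner (gcol d g t * tp (gcol d g t)) H = (\<Sum>a<d. \<Sum>b<d. g (t, a) * ent H a b * g (t, b))" for t
  proof -
    have b: "bnd (gcol d g t * tp (gcol d g t)) d" unfolding bnd_def by (auto simp: ent_gcol)
    show ?thesis unfolding inner_fmat_bnd[OF b] by (intro sum.cong refl) (auto simp: ent_gcol)
  qed
  have 2: "inner (coord {..<d}) H = (\<Sum>a<d. ent H a a)"
  proof -
    have "inner (coord {..<d}) H = (\<Sum>a<d. \<Sum>b<d. if b = a then ent H a a else 0)"
      unfolding inner_fmat_bnd[OF bnd_coord[OF subset_refl]] by (intro sum.cong refl) auto
    then show ?thesis by simp
  qed
  show ?thesis using assms
    by (simp add: gramE_def inner_diff_left inner_sum_left 1 2 sum_subtractf algebra_simps)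
qed

section \<open>Signal and noise factors of the covariance\<close>

locale spiked =
  fixes r p :: nat and V :: rmat and Ls :: "nat \<Rightarrow> real" and lam \<kappa> :: real
  assumes V: "orthonormal_cols p r V" and lam: "lam > 0" and \<kappa>: "\<kappa> \<ge> 1"
    and Ls: "\<And>a. a < r \<Longrightarrow> lam \<le> Ls a" "\<And>a. a < r \<Longrightarrow> Ls a \<le> \<kappa> * lam"
begin

abbreviation "T1 \<equiv> T1m r p V Ls"
abbreviation "T2 \<equiv> T2m r p"
abbreviation "Vf \<equiv> fm p r V"
abbreviation "Ip \<equiv> coord {..<p}"
abbreviation "Ir \<equiv> coord {..<r}"
text \<open>The coordinates of a Gaussian row that influence the data in \<open>B\<close>: all
  \<open>r\<close> factors and the noise coordinates of \<open>B\<close>.\<close>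

abbreviation "KK B \<equiv> coord ({..<r} \<union> (+) r ` B)"

lemma tpT1: "tp T1 = Vf * fm r r (\<lambda>a b. if a = b then sqrt (Ls a) else 0)"
proof (rule fmat_eqI)
  fix i a
  have b: "bnd Vf (max p r)" by (rule bnd_fm) auto
  have "(\<Sum>l<max p r. ent Vf i l * ent (fm r r (\<lambda>a b. if a = b then sqrt (Ls a) else 0)) l a)
      = (\<Sum>l<max p r. if l = a then (if i < p \<and> a < r then V i a * sqrt (Ls a) else 0) else 0)"
    by (intro sum.cong refl) auto
  also have "\<dots> = (if i < p \<and> a < r then V i a * sqrt (Ls a) else 0)" by (subst sum.delta) auto
  finally show "ent (tp T1) i a = ent (Vf * fm r r (\<lambda>a b. if a = b then sqrt (Ls a) else 0)) i a"
    unfolding ent_times[OF b] by (auto simp: T1m_def)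
qed

lemma ent_scaled: "ent (X * tp T1) i a = (if a < r then sqrt (Ls a) * ent (X * Vf) i a else 0)"
proof -
  obtain N where N: "bnd X N" using bnd_ex by blast
  show ?thesis unfolding ent_times[OF N] by (auto simp: T1m_def sum_distrib_left intro!: sum.cong)
qed

text \<open>Comparability of the spikes lets signal energy and subspace error be exchanged, at the
  cost of the factor \<open>\<kappa>\<close> in one direction only.\<close>

lemma scaled_norm: "lam * (norm (X * Vf))\<^sup>2 \<le> (norm (X * tp T1))\<^sup>2"
  "(norm (X * tp T1))\<^sup>2 \<le> \<kappa> * lam * (norm (X * Vf))\<^sup>2"
proof -
  obtain N where N: "bnd (X * tp T1) N" "bnd (X * Vf) N" using bnd_ex2 by blast
  have z: "ent (X * Vf) i a = 0" if "\<not> a < r" for i a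
  proof -
    have "X * Vf * coord {..<r} = X * Vf" by (simp add: mult.assoc fm_coord)
    then show ?thesis using that by (metis ent_coord_r finite_lessThan lessThan_iff)
  qed
  have s: "(sqrt (Ls a))\<^sup>2 = Ls a" if "a < r" for a using Ls(1)[OF that] lam by simp
  show "lam * (norm (X * Vf))\<^sup>2 \<le> (norm (X * tp T1))\<^sup>2"
    unfolding norm_fmat_sq[OF N(1)] norm_fmat_sq[OF N(2)] sum_distrib_left
    by (intro sum_mono) (auto simp: ent_scaled power_mult_distrib s z intro!: mult_right_mono Ls)
  show "(norm (X * tp T1))\<^sup>2 \<le> \<kappa> * lam * (norm (X * Vf))\<^sup>2"
    unfolding norm_fmat_sq[OF N(1)] norm_fmat_sq[OF N(2)] sum_distrib_left
    by (intro sum_mono) (auto simp: ent_scaled power_mult_distrib s z intro!: mult_right_mono Ls)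
qed

lemma IrT1: "Ir * T1 = T1" by (rule fmat_eqI) (simp add: ent_coord_l T1m_def)
lemma IpT1: "Ip * tp T1 = tp T1" by (rule fmat_eqI) (simp add: ent_coord_l T1m_def)
lemma IrT2: "Ir * T2 = 0" by (rule fmat_eqI) (simp add: ent_coord_l T2m_def)

lemma T2T2: "tp T2 * T2 = Ip"
proof (rule fmat_eqI)
  fix i j
  have b: "bnd (tp T2) (r + p)" by (simp add: T2m_def bnd_fm)
  have "(\<Sum>l<r+p. ent T2 l i * ent T2 l j) = (\<Sum>l<r+p. if l = r + i then (if i = j \<and> i < p then 1 else 0) else 0)"
    by (intro sum.cong refl) (auto simp: T2m_def)
  also have "\<dots> = (if i = j \<and> i < p then 1 else 0)" by (subst sum.delta) auto
  finally show "ent (tp T2 * T2) i j = ent Ip i j" unfolding ent_times[OF b] ent_tp by auto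
qed

lemma T1T2: "tp T1 * T2 = 0" "tp T2 * T1 = 0"
proof -
  have "tp T1 * T2 = tp (Ir * T1) * T2" by (simp only: IrT1)
  also have "\<dots> = 0" by (simp add: mult.assoc IrT2)
  finally show *: "tp T1 * T2 = 0" .
  have "tp T2 * T1 = tp (tp T1 * T2)" by simp
  then show "tp T2 * T1 = 0" by (simp only: * tp_simps)
qed

text \<open>Factor and noise coordinates are disjoint, so the mixed products vanish and
  \<open>T1 + T2\<close> is a factor of the population covariance.\<close>

lemma TT: "tp (T1 + T2) * (T1 + T2) = tp T1 * T1 + Ip"
  by (simp add: distrib_left distrib_right T1T2 T2T2)

lemma Id_T: "coord {..<r + p} * (T1 + T2) = T1 + T2"
  by (rule fmat_eqI) (auto simp: ent_coord_l T1m_def T2m_def)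

lemma xcol: "tp (T1 + T2) * gcol (r + p) g t = fm p 1 (\<lambda>i _. Xd r V Ls g t i)"
proof (rule fmat_eqI)
  fix i j
  have b: "bnd (tp (T1 + T2)) (r + p)" by (auto simp: T1m_def T2m_def bnd_def)
  have "(\<Sum>l<r+p. ent (T1 + T2) l i * ent (gcol (r + p) g t) l j) =
     (\<Sum>l<r+p. (if l < r then (if i < p \<and> j < 1 then g (t, l) * sqrt (Ls l) * V i l else 0) else 0)
        + (if l = r + i then (if i < p \<and> j < 1 then g (t, r + i) else 0) else 0))"
    by (intro sum.cong refl) (auto simp: gcol_def T1m_def T2m_def)
  also have "\<dots> = (\<Sum>l<r+p. (if l < r then (if i < p \<and> j < 1 then g (t, l) * sqrt (Ls l) * V i l else 0) else 0))
      + (if i < p \<and> j < 1 then g (t, r + i) else 0)"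
  proof -
    have "(\<Sum>l<r+p. if l = r + i then (if i < p \<and> j < 1 then g (t, r + i) else 0) else 0)
        = (if i < p \<and> j < 1 then g (t, r + i) else 0)" by (subst sum.delta) auto
    then show ?thesis unfolding sum.distrib by simp
  qed
  also have "(\<Sum>l<r+p. (if l < r then (if i < p \<and> j < 1 then g (t, l) * sqrt (Ls l) * V i l else 0) else 0))
      = (\<Sum>l<r. (if i < p \<and> j < 1 then g (t, l) * sqrt (Ls l) * V i l else 0))"
    by (rule sum.mono_neutral_cong_right) auto
  finally show "ent (tp (T1 + T2) * gcol (r + p) g t) i j = ent (fm p 1 (\<lambda>i _. Xd r V Ls g t i)) i j"
    unfolding ent_times[OF b] ent_tp by (auto simp: Xd_def)
qed

lemma sample_cov:
  "fm p p (\<lambda>i j. (\<Sum>t\<in>Ts. Xd r V Ls g t i * Xd r V Ls g t j) / real n)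
    = tp T1 * T1 + Ip + tp (T1 + T2) * gramE n Ts (r + p) g * (T1 + T2)"
proof -
  have x: "tp (T1 + T2) * (gcol (r + p) g t * tp (gcol (r + p) g t)) * (T1 + T2)
      = gcol p (\<lambda>(t, i). Xd r V Ls g t i) t * tp (gcol p (\<lambda>(t, i). Xd r V Ls g t i) t)" for t
  proof -
    have "gcol p (\<lambda>(t, i). Xd r V Ls g t i) t = tp (T1 + T2) * gcol (r + p) g t"
      unfolding xcol by (simp add: gcol_def)
    then show ?thesis by (simp add: mult.assoc)
  qed
  have "tp (T1 + T2) * gramE n Ts (r + p) g * (T1 + T2)
      = (1 / real n) *\<^sub>R (\<Sum>t\<in>Ts. tp (T1 + T2) * (gcol (r + p) g t * tp (gcol (r + p) g t)) * (T1 + T2))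
        - tp (T1 + T2) * (T1 + T2)"
    unfolding gramE_def right_diff_distrib left_diff_distrib mult_scaleR_right mult_scaleR_left sum_distrib_left sum_distrib_right
    by (simp only: mult.assoc Id_T)
  then have "tp (T1 + T2) * gramE n Ts (r + p) g * (T1 + T2) + (tp T1 * T1 + Ip)
      = (1 / real n) *\<^sub>R (\<Sum>t\<in>Ts. gcol p (\<lambda>(t, i). Xd r V Ls g t i) t * tp (gcol p (\<lambda>(t, i). Xd r V Ls g t i) t))"
    unfolding x TT by simp
  also have "\<dots> = fm p p (\<lambda>i j. (\<Sum>t\<in>Ts. Xd r V Ls g t i * Xd r V Ls g t j) / real n)"
    by (rule fmat_eqI) (auto simp: ent_gcol)
  finally show ?thesis by (simp add: add.commute)
qed

lemma KK_facts: assumes "B \<subseteq> {..<p}"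
  shows "proj (KK B)" "KK B * Ir = Ir" "KK B * T2 * coord B = T2 * coord B" "KK B * T1 = T1"
proof -
  have fB: "finite B" using assms finite_subset by blast
  show "proj (KK B)" using fB by simp
  show 1: "KK B * Ir = Ir" using fB by (simp add: coord_mult)
  show "KK B * T1 = T1" using 1 IrT1 by (metis mult.assoc)
  show "KK B * T2 * coord B = T2 * coord B" unfolding mult.assoc
    by (rule fmat_eqI) (use fB in \<open>auto simp: ent_coord_l ent_coord_r T2m_def\<close>)
qed

lemma restrict_fm: "B \<subseteq> {..<p} \<Longrightarrow> fm p p (restrict_mat B M) = coord B * fm p p M * coord B"
  by (rule fmat_eqI) (auto simp: ent_coord_r ent_coord_l restrict_mat_def finite_subset)

text \<open>The error sits between the two copies of \<open>T1 + T2\<close>, so it is relative to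
  the population form, and that form dominates the identity on \<open>B\<close>. Large spikes
  therefore do no harm.\<close>

lemma restricted_pd:
  assumes B: "B \<subseteq> {..<p}" and S: "S = tp T1 * T1 + Ip + tp (T1 + T2) * F * (T1 + T2)"
    and F: "opb (KK B * F * KK B) e" "e \<le> 1"
  shows "(1 - e) * (norm (coord B * A))\<^sup>2 \<le> inner A (coord B * S * coord B * A)"
proof -
  let ?J = "coord B" and ?K = "KK B" and ?T = "T1 + T2"
  note K = KK_facts[OF B]
  have fB: "finite B" using B finite_subset by blast
  have JI: "Ip * ?J = ?J" using fB B by (simp add: coord_mult Int_absorb1)
  define x where "x = ?T * (?J * A)"
  have KT: "?K * (?T * (?J * X)) = ?T * (?J * X)" for X
    using K(3,4) by (simp add: distrib_left distrib_right mult.assoc[symmetric])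
  have "inner A (?J * S * ?J * A) = inner (?J * A) (S * (?J * A))"
    by (simp add: inner_mult_l mult.assoc)
  also have "\<dots> = inner (?J * A) ((tp T1 * T1 + Ip) * (?J * A)) + inner (?J * A) (tp ?T * F * ?T * (?J * A))"
    unfolding S distrib_right inner_add_right ..
  also have "inner (?J * A) (tp ?T * F * ?T * (?J * A)) = inner x (F * x)"
    using inner_mult_l[of ?T "?J * A" "F * x"] by (simp add: x_def mult.assoc)
  also have "inner x (F * x) = inner (?K * x) (F * (?K * x))" using KT by (simp add: x_def)
  also have "\<dots> = inner x (?K * F * ?K * x)"
    using inner_mult_l[of ?K x "F * (?K * x)"] by (simp add: projD(1)[OF K(1)] mult.assoc)
  also have "inner (?J * A) ((tp T1 * T1 + Ip) * (?J * A)) = (norm x)\<^sup>2"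
    unfolding TT[symmetric] x_def power2_norm_eq_inner by (simp add: inner_mult_l[of ?T] mult.assoc)
  finally have eq: "inner A (?J * S * ?J * A) = (norm x)\<^sup>2 + inner x (?K * F * ?K * x)" .
  have "\<bar>inner x (?K * F * ?K * x)\<bar> \<le> norm x * (e * norm x)"
    by (rule order_trans[OF Cauchy_Schwarz_ineq2 mult_left_mono[OF opbD(1)[OF F(1)]]]) simp
  then have "inner x (?K * F * ?K * x) \<ge> - e * (norm x)\<^sup>2" by (simp add: power2_eq_square algebra_simps)
  then have 1: "inner A (?J * S * ?J * A) \<ge> (1 - e) * (norm x)\<^sup>2" unfolding eq by (simp add: algebra_simps)
  have n: "(norm x)\<^sup>2 = (norm (T1 * (?J * A)))\<^sup>2 + (norm (?J * A))\<^sup>2"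
  proof -
    have "(norm x)\<^sup>2 = inner (?J * A) ((tp T1 * T1 + Ip) * (?J * A))"
      unfolding TT[symmetric] x_def power2_norm_eq_inner by (simp add: inner_mult_l[of ?T] mult.assoc)
    also have "\<dots> = inner (?J * A) (tp T1 * (T1 * (?J * A))) + inner (?J * A) (?J * A)"
      by (simp add: distrib_right inner_add_right mult.assoc mult_cancel_l[OF JI])
    finally show ?thesis by (simp add: power2_norm_eq_inner inner_mult_l[of T1])
  qed
  have "(1 - e) * (norm (?J * A))\<^sup>2 \<le> (1 - e) * (norm x)\<^sup>2" using F(2) n by (intro mult_left_mono) auto
  then show ?thesis using 1 by simp
qed

lemma leading_support:
  assumes B: "B \<subseteq> {..<p}" "r \<le> card B"
    and S: "fm p p S = tp T1 * T1 + Ip + tp (T1 + T2) * F1 * (T1 + T2)"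
    and F: "opb (KK B * F1 * KK B) e" "e < 1"
    and W: "leading_eigvecs p r (restrict_mat B S) W"
  shows "coord B * Pj p r W = Pj p r W"
proof -
  let ?J = "coord B"
  obtain E \<nu> where "eig p r (restrict_mat B S) W E \<nu>" using leading_eig[OF W frame_le[OF V]] .
  then interpret eig p r "restrict_mat B S" W E \<nu> .
  have fB: "finite B" using B finite_subset by blast
  have IJ: "Ip * ?J = ?J" using fB B by (simp add: coord_mult Int_absorb1)
  have J: "proj ?J" "(norm ?J)\<^sup>2 = real (card B)" using fB by (simp_all add: norm_coord)
  have Mf: "fm p p (restrict_mat B S) = ?J * fm p p S * ?J" by (rule restrict_fm[OF B(1)])
  show ?thesis
  proof (rule support[OF J B(2) IJ])
    show "?J * fm p p (restrict_mat B S) = fm p p (restrict_mat B S)"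
      unfolding Mf by (simp add: mult.assoc[symmetric] projD[OF J(1)])
    show "(0::real) < 1 - e" using F by simp
    show "(1 - e) * (norm (?J * A))\<^sup>2 \<le> inner A (fm p p (restrict_mat B S) * A)" for A
      unfolding Mf by (rule restricted_pd[OF B(1) S F(1)]) (use F in simp)
  qed
qed

text \<open>The true projection need not live on \<open>B\<close> and cannot compete in the
  restricted problem. A projection of rank \<open>r\<close> inside \<open>B\<close> stands in for
  it, and the discrepancy is paid by \<open>D2\<close>.\<close>

lemma oracle_bound:
  fixes m :: real
  assumes B: "B \<subseteq> {..<p}" "card B = k" "r \<le> k"
    and S: "fm p p S = tp T1 * T1 + Ip + tp (T1 + T2) * F1 * (T1 + T2)"
    and F: "tp F1 = F1" "opb (KK B * F1 * KK B) e" "e \<le> 1/8"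
    and lead: "leading_eigvecs p r (restrict_mat B S) W"
    and D: "(norm ((Ip - coord B) * Vf))\<^sup>2 \<le> D2" and m: "m \<ge> 0" "real r \<le> m\<^sup>2 \<or> real k - real r \<le> m\<^sup>2"
  shows "(norm ((Ip - Pj p r W) * tp T1))\<^sup>2 \<le> 27 * ((\<kappa> + 1) * lam * D2 + e\<^sup>2 * m\<^sup>2 * (1 + 1 / lam))"
proof -
  let ?J = "coord B" and ?W = "Pj p r W" and ?P = "Pj p r V"
  have rp: "r \<le> p" by (rule frame_le[OF V])
  obtain E \<nu> where "eig p r (restrict_mat B S) W E \<nu>" using leading_eig[OF lead rp] .
  then interpret eig p r "restrict_mat B S" W E \<nu> .
  have fB: "finite B" using B finite_subset by blast
  have IJ: "Ip * ?J = ?J" using fB B by (simp add: coord_mult Int_absorb1)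
  have J: "proj ?J" "(norm ?J)\<^sup>2 = real k" using fB B by (simp_all add: norm_coord)
  have Mf: "fm p p (restrict_mat B S) = ?J * fm p p S * ?J" by (rule restrict_fm[OF B(1)])
  have JJ: "?J * ?J = ?J" by (rule projD[OF J(1)])
  have JW: "?J * ?W = ?W"
    by (rule leading_support[OF B(1) _ S F(2) _ lead]) (use B F in auto)
  have "?J * (?J * Vf) = ?J * Vf" by (simp add: mult.assoc[symmetric] JJ)
  then obtain Pt where Pt: "proj Pt" "?J * Pt = Pt" "(norm Pt)\<^sup>2 = real r" "Pt * (?J * Vf * Ir) = ?J * Vf * Ir"
    using proj_span[OF J \<open>r \<le> k\<close>] by blast
  then have PtV: "Pt * (?J * Vf) = ?J * Vf" by (simp add: mult.assoc fm_coord)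
  have PtJ: "Pt * ?J = Pt" using Pt by (metis projD(1) tp_times tp_coord)
  have IPt: "Ip * Pt = Pt" using Pt IJ by (metis mult.assoc)
  have pW: "proj ?W" by (rule proj_Pj[OF orth_W])
  have n: "norm ?W = norm Pt" "norm Ir = norm ?W" "norm ?W = norm ?P" "norm Pt = norm ?P"
    using norm_Pj[OF orth_W] norm_Pj[OF V] Pt(3) norm_coord[of "{..<r}"] by (auto intro: power2_eq_imp_eq)
  define Y where "Y = norm ((Ip - ?W) * tp T1)"
  have opt: "inner (fm p p S) (Pt - ?W) \<le> 0"
  proof -
    \<comment> \<open>Both competitors live on \<open>B\<close>, so cutting the sample covariance
      down to \<open>B\<close> does not change their inner products with it.\<close>
    have c: "inner (?J * fm p p S * ?J) X = inner (fm p p S) X" if "?J * X = X" "X * ?J = X" for X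
      using inner_mult_r[of "?J * fm p p S" ?J X] inner_mult_l[of ?J "fm p p S" "X * ?J"] that by simp
    have "inner (fm p p (restrict_mat B S)) Pt \<le> inner (fm p p (restrict_mat B S)) ?W"
      by (rule ky_fan[OF Pt(1) IPt Pt(3)])
    moreover have "?W * ?J = ?W" using JW pW by (metis projD(1) tp_times tp_coord)
    ultimately show ?thesis unfolding Mf using Pt PtJ JW by (simp add: c inner_diff_right)
  qed
  have T1J: "Pt * ?J * tp T1 = ?J * tp T1"
    unfolding tpT1 using PtV by (simp add: mult.assoc[symmetric])
  have JWn: "(norm (?J - ?W))\<^sup>2 = real k - real r"
    using proj_norm_sub[OF pW J(1) JW] J norm_Pj[OF orth_W] by simp
  have mu: "norm ?W \<le> m \<or> norm (?J - ?W) \<le> m"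
  proof -
    have "(norm ?W)\<^sup>2 \<le> m\<^sup>2 \<or> (norm (?J - ?W))\<^sup>2 \<le> m\<^sup>2"
      using m(2) JWn norm_Pj[OF orth_W] by auto
    then show ?thesis using m(1) power2_le_imp_le by blast
  qed
  have "Y\<^sup>2 \<le> (norm ((Ip - ?J) * tp T1))\<^sup>2 + e * Y\<^sup>2 + 2 * e * m * Y + 2 * e * m * norm (?W - Pt)"
    by (rule oracle_basic[where K = "KK B" and Ir = Ir and ?T1.0 = T1 and ?T2.0 = T2 and E = F1 and S = "fm p p S"])
       (use Pt J IJ n KK_facts[OF B(1)] pW JW T1J S F opt mu in \<open>simp_all add: IrT1 T2T2 IpT1 Y_def\<close>)
  moreover have "(norm ((Ip - ?J) * tp T1))\<^sup>2 \<le> \<kappa> * lam * D2"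
    by (rule order_trans[OF scaled_norm(2)]) (use D lam \<kappa> in \<open>auto intro!: mult_left_mono\<close>)
  ultimately have 1: "Y\<^sup>2 \<le> \<kappa> * lam * D2 + e * Y\<^sup>2 + 2 * e * m * Y + 2 * e * m * norm (?W - Pt)"
    by linarith
  have 2: "e * m * norm (?W - Pt) \<le> e * m * (norm (?W - ?P) + norm (Pt - ?P))"
    using opbD(2)[OF F(2)] m(1) norm_triangle_ineq4[of "?W - ?P" "Pt - ?P"] by (intro mult_left_mono) auto
  have 3: "lam * (norm (?W - ?P))\<^sup>2 \<le> 2 * Y\<^sup>2"
    using scaled_norm(1)[of "Ip - ?W"] proj_diff_norm[OF pW proj_Pj[OF V] n(3), of Ip]
    by (simp add: coord_Pj norm_mult_Pj V Y_def)
  have 4: "(norm (Pt - ?P))\<^sup>2 \<le> 2 * D2"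
  proof -
    have "(norm (Pt - ?P))\<^sup>2 = 2 * (norm ((Ip - Pt) * Vf))\<^sup>2"
      using proj_diff_norm[OF Pt(1) proj_Pj[OF V] n(4), of Ip] IPt by (simp add: coord_Pj norm_mult_Pj V)
    \<comment> \<open>\<open>Pt\<close> fixes the rows kept in \<open>B\<close>; only the omitted
      rows remain, contracted by the complement of \<open>Pt\<close>.\<close>
    also have "(Ip - Pt) * Vf = (Ip - ?J) * Vf - Pt * ((Ip - ?J) * Vf)"
      by (simp add: left_diff_distrib right_diff_distrib coord_fm_p PtV)
    also have "2 * (norm \<dots>)\<^sup>2 \<le> 2 * (norm ((Ip - ?J) * Vf))\<^sup>2"
      using proj_pythag[OF Pt(1), of "(Ip - ?J) * Vf"] by simp
    finally show ?thesis using D by linarith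
  qed
  show ?thesis using oracle_arith[OF lam opbD(2)[OF F(2)] F(3) \<kappa> 1 2 3 4] by (simp add: Y_def)
qed

text \<open>Optimality on the second sample compares missed energies up to noise in a single
  direction. The factor 2 between loss and missed energy turns \<open>3 * 27\<close> and
  \<open>26\<close> into 162 and 52.\<close>

lemma stage2_bound:
  assumes W: "orthonormal_cols p r W" "orthonormal_cols p r W0"
    and S: "fm p p S = tp T1 * T1 + Ip + tp (T1 + T2) * F2 * (T1 + T2)"
    and opt: "trace_quad p r S W0 \<le> trace_quad p r S W"
    and \<eta>: "0 \<le> \<eta>" "\<eta> \<le> 1/8"
      "\<bar>inner F2 ((T1 + T2) * (Pj p r W - Pj p r W0) * tp (T1 + T2))\<bar>
        \<le> \<eta> * norm ((T1 + T2) * (Pj p r W - Pj p r W0) * tp (T1 + T2))"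
    and Y0: "(norm ((Ip - Pj p r W0) * tp T1))\<^sup>2 \<le> 27 * ((\<kappa> + 1) * lam * D2 + e\<^sup>2 * m\<^sup>2 * (1 + 1 / lam))"
  shows "proj_loss p r W V \<le> 162 * (\<kappa> + 1) * D2 + (162 * (e\<^sup>2 * m\<^sup>2) + 52 * \<eta>\<^sup>2) / hfun lam"
proof -
  let ?W = "Pj p r W" and ?R = "Pj p r W0" and ?P = "Pj p r V"
  have pW: "proj ?W" "proj ?R" by (intro proj_Pj W)+
  have n: "norm ?W = norm ?R" "norm ?W = norm ?P" "norm ?R = norm ?P"
    using norm_Pj[OF W(1)] norm_Pj[OF V] norm_Pj[OF W(2)] by (auto intro: power2_eq_imp_eq)
  define Y where "Y = norm ((Ip - ?W) * tp T1)"
  define Y0 where "Y0 = norm ((Ip - ?R) * tp T1)"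
  define M where "M = norm ((T1 + T2) * (?W - ?R) * tp (T1 + T2))"
  have "inner (fm p p S) (?W - ?R) = (norm (?W * tp T1))\<^sup>2 - (norm (?R * tp T1))\<^sup>2
      + inner F2 ((T1 + T2) * (?W - ?R) * tp (T1 + T2))"
    by (rule cov_gap[of _ _ Ip]) (use pW n S in \<open>auto simp: coord_Pj\<close>)
  moreover have "inner (fm p p S) (?W - ?R) \<ge> 0"
    using opt by (simp add: inner_diff_right trace_quad_inner)
  moreover have "(norm (tp T1))\<^sup>2 = (norm (?W * tp T1))\<^sup>2 + Y\<^sup>2" "(norm (tp T1))\<^sup>2 = (norm (?R * tp T1))\<^sup>2 + Y0\<^sup>2"
    using proj_pythag[OF pW(1), of "tp T1"] proj_pythag[OF pW(2), of "tp T1"]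
    by (simp_all add: Y_def Y0_def left_diff_distrib IpT1)
  ultimately have 1: "Y\<^sup>2 \<le> Y0\<^sup>2 + \<eta> * M" using \<eta>(3) unfolding M_def by linarith
  have 2: "M \<le> Y\<^sup>2 + Y0\<^sup>2 + 2 * (Y + Y0) + norm (?W - ?R)"
    unfolding M_def by (rule stage2_noise[where I = Ip]) (auto simp: pW coord_Pj IpT1 T2T2 Y_def Y0_def)
  have 3: "norm (?W - ?R) \<le> norm (?W - ?P) + norm (?R - ?P)"
    using norm_triangle_ineq4[of "?W - ?P" "?R - ?P"] by simp
  have gap: "lam * (norm (Pj p r X - ?P))\<^sup>2 \<le> 2 * (norm ((Ip - Pj p r X) * tp T1))\<^sup>2"
    if "orthonormal_cols p r X" "norm (Pj p r X) = norm ?P" for X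
    using scaled_norm(1)[of "Ip - Pj p r X"] proj_diff_norm[OF proj_Pj[OF that(1)] proj_Pj[OF V] that(2), of Ip]
    by (simp add: coord_Pj norm_mult_Pj V)
  define G where "G = (1 + 1 / lam)"
  have G0: "G \<ge> 0" using lam by (simp add: G_def)
  have "Y\<^sup>2 \<le> 3 * Y0\<^sup>2 + 26 * \<eta>\<^sup>2 * G"
    unfolding G_def
    by (rule stage2_arith[OF lam \<eta>(1,2) 1 2 3]) (use gap[OF W(1) n(2)] gap[OF W(2) n(3)] in \<open>auto simp: Y_def Y0_def\<close>)
  also have "\<dots> \<le> 3 * (27 * ((\<kappa> + 1) * lam * D2 + e\<^sup>2 * m\<^sup>2 * G)) + 26 * \<eta>\<^sup>2 * G"
    using Y0 unfolding Y0_def G_def by linarith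
  finally have "2 * Y\<^sup>2 \<le> 2 * (3 * (27 * ((\<kappa> + 1) * lam * D2 + e\<^sup>2 * m\<^sup>2 * G)) + 26 * \<eta>\<^sup>2 * G)"
    by (rule mult_left_mono) simp
  then have "lam * proj_loss p r W V \<le> 2 * (3 * (27 * ((\<kappa> + 1) * lam * D2 + e\<^sup>2 * m\<^sup>2 * G)) + 26 * \<eta>\<^sup>2 * G)"
    using gap[OF W(1) n(2)] unfolding proj_loss_Pj Y_def by (rule order_trans[rotated])
  also have "\<dots> = lam * (162 * (\<kappa> + 1) * D2 + (162 * (e\<^sup>2 * m\<^sup>2) + 52 * \<eta>\<^sup>2) / hfun lam)"
  proof -
    \<comment> \<open>The rate function enters here: division by \<open>lam\<close> leaves exactly
      the reciprocal of \<open>hfun lam\<close>.\<close>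
    have "G = lam / hfun lam" using lam by (simp add: G_def hfun_def field_simps power2_eq_square)
    then show ?thesis by (simp add: algebra_simps add_divide_distrib)
  qed
  finally show ?thesis using lam by simp
qed

end

section \<open>Gaussian chaos\<close>

abbreviation gauss :: "'i set \<Rightarrow> ('i \<Rightarrow> real) measure" where
  "gauss I \<equiv> PiM I (\<lambda>_. std_normal_distribution)"

lemma prob_std_normal: "prob_space std_normal_distribution"
  by (rule prob_space_normal_density) simp

lemma sigma_finite_std_normal: "sigma_finite_measure std_normal_distribution"
  using prob_std_normal by (rule prob_space_imp_sigma_finite)

interpretation ps: product_sigma_finite "\<lambda>_::'i. std_normal_distribution"
  by (standard) (rule sigma_finite_measure.sigma_finite_countable[OF sigma_finite_std_normal])

lemma prob_gauss: "prob_space (gauss I)"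
  by (rule prob_space_PiM) (rule prob_std_normal)

lemma measurable_ennreal_exp:
  "f \<in> borel_measurable M \<Longrightarrow> (\<lambda>x. ennreal (exp (f x :: real))) \<in> borel_measurable M"
  by measurable

lemma nn_integral_exp_quad:
  assumes "a < 1 / 2"
  shows "(\<integral>\<^sup>+x. ennreal (exp (a * x\<^sup>2 + b * x)) \<partial>std_normal_distribution)
    = ennreal (exp (b\<^sup>2 / (2 * (1 - 2 * a))) / sqrt (1 - 2 * a))"
proof -
  define s where "s = 1 - 2 * a"
  have s: "s > 0" using assms by (simp add: s_def)
  have "std_normal_density x * exp (a * x\<^sup>2 + b * x)
      = exp (b\<^sup>2 / (2 * s)) / sqrt s * normal_density (b / s) (1 / sqrt s) x" for x
  proof -
    have v: "(1 / sqrt s)\<^sup>2 = 1 / s" using s by (simp add: power_divide)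
    have S: "1 / sqrt (2 * pi) = 1 / sqrt s * (1 / sqrt (2 * pi * (1 / s)))"
      using s by (simp add: real_sqrt_divide real_sqrt_mult)
    have "- x\<^sup>2 / 2 + (a * x\<^sup>2 + b * x) = b\<^sup>2 / (2 * s) + - (x - b / s)\<^sup>2 / (2 * (1 / s))"
    proof -
      have a: "a = (1 - s) / 2" by (simp add: s_def)
      show ?thesis using s unfolding a by (simp add: power2_eq_square field_simps)
    qed
    then have E: "exp (- x\<^sup>2 / 2) * exp (a * x\<^sup>2 + b * x) = exp (b\<^sup>2 / (2 * s)) * exp (- (x - b / s)\<^sup>2 / (2 * (1 / s)))"
      by (simp only: exp_add[symmetric])
    have "std_normal_density x * exp (a * x\<^sup>2 + b * x) = 1 / sqrt (2 * pi) * (exp (- x\<^sup>2 / 2) * exp (a * x\<^sup>2 + b * x))"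
      by (simp only: std_normal_density_def mult.assoc)
    also have "\<dots> = exp (b\<^sup>2 / (2 * s)) / sqrt s * normal_density (b / s) (1 / sqrt s) x"
      unfolding E S normal_density_def v by simp
    finally show ?thesis .
  qed
  then have "(\<integral>\<^sup>+x. ennreal (exp (a * x\<^sup>2 + b * x)) \<partial>std_normal_distribution)
     = (\<integral>\<^sup>+x. ennreal (exp (b\<^sup>2 / (2 * s)) / sqrt s) * ennreal (normal_density (b / s) (1 / sqrt s) x) \<partial>lborel)"
    using s by (subst nn_integral_density) (auto simp: ennreal_mult[symmetric] intro!: nn_integral_cong)
  also have "\<dots> = ennreal (exp (b\<^sup>2 / (2 * s)) / sqrt s) * (\<integral>\<^sup>+x. ennreal (normal_density (b / s) (1 / sqrt s) x) \<partial>lborel)"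
    by (rule nn_integral_cmult) simp
  also have "(\<integral>\<^sup>+x. ennreal (normal_density (b / s) (1 / sqrt s) x) \<partial>lborel) = 1"
  proof -
    have "prob_space (density lborel (normal_density (b / s) (1 / sqrt s)))"
      using s by (intro prob_space_normal_density) simp
    from prob_space.emeasure_space_1[OF this] show ?thesis by (simp add: emeasure_density)
  qed
  finally show ?thesis by (simp add: s_def)
qed

lemma inv_sqrt_le_exp:
  assumes "\<bar>x\<bar> \<le> 1 / 2"
  shows "1 / sqrt (1 - x) \<le> exp (x / 2 + x\<^sup>2)"
proof -
  have x: "1 - x > 0" using assms by (simp add: abs_le_iff)
  have "\<bar>ln (1 + (- x)) - (- x)\<bar> \<le> 2 * (- x)\<^sup>2" by (rule abs_ln_one_plus_x_minus_x_bound) (use assms in simp)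
  then have "- ln (1 - x) / 2 \<le> x / 2 + x\<^sup>2" by (simp add: abs_le_iff)
  then have "exp (- (ln (1 - x) / 2)) \<le> exp (x / 2 + x\<^sup>2)" by simp
  also have "exp (- (ln (1 - x) / 2)) = 1 / sqrt (1 - x)"
    using x by (simp add: exp_minus ln_sqrt[symmetric] inverse_eq_divide)
  finally show ?thesis .
qed

lemma inv_sqrt_le_exp':
  assumes "0 \<le> x" "x \<le> 1 / 2"
  shows "1 / sqrt (1 - x) \<le> exp x"
proof -
  have "x\<^sup>2 \<le> x / 2" using assms mult_left_mono[of x "1/2" x] by (simp add: power2_eq_square)
  then have "exp (x / 2 + x\<^sup>2) \<le> exp x" by simp
  moreover have "1 / sqrt (1 - x) \<le> exp (x / 2 + x\<^sup>2)" using assms by (intro inv_sqrt_le_exp) simp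
  ultimately show ?thesis by linarith
qed

text \<open>Integrating out the coordinate of highest rank first, each factor has mean at most one.\<close>
lemma supermartingale_mgf:
  fixes I :: "'i::countable set" and \<alpha> :: "'i \<Rightarrow> real" and \<beta> :: "'i \<Rightarrow> 'i \<Rightarrow> real"
  defines "b S i g \<equiv> \<Sum>j | j \<in> S \<and> to_nat j < to_nat i. \<beta> i j * g j"
  assumes "finite I" and "\<And>i. i \<in> I \<Longrightarrow> \<bar>\<alpha> i\<bar> \<le> 1 / 8"
  shows "(\<integral>\<^sup>+g. ennreal (exp (\<Sum>i\<in>I. 2 * \<alpha> i * ((g i)\<^sup>2 - 1) + 2 * g i * b I i g - 4 * (b I i g)\<^sup>2 - 16 * (\<alpha> i)\<^sup>2)) \<partial>gauss I) \<le> 1"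
  using assms(2,3)
proof (induction I rule: finite_ranking_induct[where f = to_nat])
  case empty
  show ?case by (simp add: prob_space.emeasure_space_1[OF prob_gauss])
next
  case (insert x S)
  have b_old: "b (insert x S) i g = b S i g" if "i \<in> S" for i g
  proof -
    have "{j. j \<in> insert x S \<and> to_nat j < to_nat i} = {j. j \<in> S \<and> to_nat j < to_nat i}"
      using insert(2) that by fastforce
    then show ?thesis by (simp add: b_def)
  qed
  have b_new: "b (insert x S) x (g(x := y)) = b S x g" for g y
  proof -
    have "{j. j \<in> insert x S \<and> to_nat j < to_nat x} = {j. j \<in> S \<and> to_nat j < to_nat x}" by auto
    then show ?thesis unfolding b_def by (intro sum.cong) auto
  qed
  have b_upd: "b S i (g(x := y)) = b S i g" if "x \<notin> S" for i g y
    unfolding b_def using that by (intro sum.cong) auto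
  show ?case
  proof (cases "x \<in> S")
    case True
    then show ?thesis using insert by (simp add: insert_absorb)
  next
    case x: False
    define h where "h g = (\<Sum>i\<in>S. 2 * \<alpha> i * ((g i)\<^sup>2 - 1) + 2 * g i * b S i g - 4 * (b S i g)\<^sup>2 - 16 * (\<alpha> i)\<^sup>2)" for g
    define k where "k c y = 2 * \<alpha> x * (y\<^sup>2 - 1) + 2 * y * c - 4 * c\<^sup>2 - 16 * (\<alpha> x)\<^sup>2" for c y
    have inner: "(\<integral>\<^sup>+y. ennreal (exp (k c y)) \<partial>std_normal_distribution) \<le> 1" for c
    proof -
      have a: "\<bar>\<alpha> x\<bar> \<le> 1 / 8" using insert by simp
      have "exp (k c y) = exp (- 2 * \<alpha> x - 4 * c\<^sup>2 - 16 * (\<alpha> x)\<^sup>2) * exp (2 * \<alpha> x * y\<^sup>2 + 2 * c * y)" for y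
        by (simp add: k_def exp_add[symmetric] algebra_simps)
      then have "(\<integral>\<^sup>+y. ennreal (exp (k c y)) \<partial>std_normal_distribution)
        = ennreal (exp (- 2 * \<alpha> x - 4 * c\<^sup>2 - 16 * (\<alpha> x)\<^sup>2)) * (\<integral>\<^sup>+y. ennreal (exp (2 * \<alpha> x * y\<^sup>2 + 2 * c * y)) \<partial>std_normal_distribution)"
        by (simp add: ennreal_mult nn_integral_cmult)
      also have "\<dots> = ennreal (exp (- 2 * \<alpha> x - 4 * c\<^sup>2 - 16 * (\<alpha> x)\<^sup>2) * (exp ((2 * c)\<^sup>2 / (2 * (1 - 2 * (2 * \<alpha> x)))) / sqrt (1 - 2 * (2 * \<alpha> x))))"
        using a by (subst nn_integral_exp_quad) (auto simp: abs_le_iff ennreal_mult[symmetric])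
      also have "\<dots> \<le> ennreal 1"
      proof (rule ennreal_leI)
        \<comment> \<open>From \<open>\<bar>\<alpha> x\<bar> \<le> 1 / 8\<close> follows
          \<open>1 - 4 * \<alpha> x \<ge> 1 / 2\<close>. This and the second-order bound for the
          normalising root fix the constants 4 and 16 of the compensator.\<close>
        have "(2 * c)\<^sup>2 / (2 * (1 - 2 * (2 * \<alpha> x))) \<le> (2 * c)\<^sup>2 / 1"
          using a by (intro divide_left_mono) (auto simp: abs_le_iff)
        then have 1: "exp ((2 * c)\<^sup>2 / (2 * (1 - 2 * (2 * \<alpha> x)))) \<le> exp (4 * c\<^sup>2)" by (simp add: power_mult_distrib)
        have 2: "1 / sqrt (1 - 4 * \<alpha> x) \<le> exp (4 * \<alpha> x / 2 + (4 * \<alpha> x)\<^sup>2)"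
          using a by (intro inv_sqrt_le_exp) (simp add: abs_mult)
        have "exp ((2 * c)\<^sup>2 / (2 * (1 - 2 * (2 * \<alpha> x)))) * (1 / sqrt (1 - 4 * \<alpha> x))
            \<le> exp (4 * c\<^sup>2) * exp (4 * \<alpha> x / 2 + (4 * \<alpha> x)\<^sup>2)"
          using 1 2 a by (intro mult_mono) (auto simp: abs_le_iff)
        then have "exp (- 2 * \<alpha> x - 4 * c\<^sup>2 - 16 * (\<alpha> x)\<^sup>2) * (exp ((2 * c)\<^sup>2 / (2 * (1 - 2 * (2 * \<alpha> x)))) * (1 / sqrt (1 - 4 * \<alpha> x)))
          \<le> exp (- 2 * \<alpha> x - 4 * c\<^sup>2 - 16 * (\<alpha> x)\<^sup>2) * (exp (4 * c\<^sup>2) * exp (4 * \<alpha> x / 2 + (4 * \<alpha> x)\<^sup>2))"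
          by (intro mult_left_mono) auto
        also have "\<dots> = 1" by (simp add: exp_add[symmetric] power_mult_distrib)
        finally show "exp (- 2 * \<alpha> x - 4 * c\<^sup>2 - 16 * (\<alpha> x)\<^sup>2) * (exp ((2 * c)\<^sup>2 / (2 * (1 - 2 * (2 * \<alpha> x)))) / sqrt (1 - 2 * (2 * \<alpha> x))) \<le> 1"
          by simp
      qed
      finally show ?thesis by simp
    qed
    have bm: "(\<lambda>g. b S' i g) \<in> borel_measurable (gauss (insert x S))" if "S' \<subseteq> insert x S" for S' i
      unfolding b_def using that by (intro borel_measurable_sum borel_measurable_times) auto
    have meas: "(\<lambda>g. \<Sum>i\<in>insert x S. 2 * \<alpha> i * ((g i)\<^sup>2 - 1) + 2 * g i * b (insert x S) i g - 4 * (b (insert x S) i g)\<^sup>2 - 16 * (\<alpha> i)\<^sup>2)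
        \<in> borel_measurable (gauss (insert x S))"
      by (intro borel_measurable_sum borel_measurable_diff borel_measurable_add borel_measurable_times borel_measurable_power borel_measurable_const bm subset_refl) auto
    have "(\<integral>\<^sup>+g. ennreal (exp (\<Sum>i\<in>insert x S. 2 * \<alpha> i * ((g i)\<^sup>2 - 1) + 2 * g i * b (insert x S) i g - 4 * (b (insert x S) i g)\<^sup>2 - 16 * (\<alpha> i)\<^sup>2)) \<partial>gauss (insert x S))
      = (\<integral>\<^sup>+g. (\<integral>\<^sup>+y. ennreal (exp (\<Sum>i\<in>insert x S. 2 * \<alpha> i * (((g(x := y)) i)\<^sup>2 - 1) + 2 * (g(x := y)) i * b (insert x S) i (g(x := y)) - 4 * (b (insert x S) i (g(x := y)))\<^sup>2 - 16 * (\<alpha> i)\<^sup>2)) \<partial>std_normal_distribution) \<partial>gauss S)"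
      using insert x by (intro ps.product_nn_integral_insert measurable_ennreal_exp[OF meas]) auto
    also have "\<dots> = (\<integral>\<^sup>+g. ennreal (exp (h g)) * (\<integral>\<^sup>+y. ennreal (exp (k (b S x g) y)) \<partial>std_normal_distribution) \<partial>gauss S)"
    proof (intro nn_integral_cong)
      fix g
      have "(\<Sum>i\<in>insert x S. 2 * \<alpha> i * (((g(x := y)) i)\<^sup>2 - 1) + 2 * (g(x := y)) i * b (insert x S) i (g(x := y)) - 4 * (b (insert x S) i (g(x := y)))\<^sup>2 - 16 * (\<alpha> i)\<^sup>2)
         = h g + k (b S x g) y" for y
      proof -
        have "(\<Sum>i\<in>S. 2 * \<alpha> i * (((g(x := y)) i)\<^sup>2 - 1) + 2 * (g(x := y)) i * b (insert x S) i (g(x := y)) - 4 * (b (insert x S) i (g(x := y)))\<^sup>2 - 16 * (\<alpha> i)\<^sup>2) = h g"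
          unfolding h_def using x by (intro sum.cong refl) (auto simp: b_old b_upd)
        then show ?thesis using x insert by (simp add: b_new k_def)
      qed
      then show "(\<integral>\<^sup>+y. ennreal (exp (\<Sum>i\<in>insert x S. 2 * \<alpha> i * (((g(x := y)) i)\<^sup>2 - 1) + 2 * (g(x := y)) i * b (insert x S) i (g(x := y)) - 4 * (b (insert x S) i (g(x := y)))\<^sup>2 - 16 * (\<alpha> i)\<^sup>2)) \<partial>std_normal_distribution)
        = ennreal (exp (h g)) * (\<integral>\<^sup>+y. ennreal (exp (k (b S x g) y)) \<partial>std_normal_distribution)"
        unfolding k_def by (simp add: exp_add ennreal_mult nn_integral_cmult)
    qed
    also have "\<dots> \<le> (\<integral>\<^sup>+g. ennreal (exp (h g)) * 1 \<partial>gauss S)"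
      by (intro nn_integral_mono mult_left_mono inner) auto
    also have "\<dots> \<le> 1" using insert x by (simp add: h_def)
    finally show ?thesis .
  qed
qed

text \<open>The square is linearised by an auxiliary independent Gaussian \<open>y\<close>, with
  \<open>exp (c * l^2)\<close> the mean of \<open>exp (sqrt (2 * c) * y * l)\<close>. After
  exchanging integrals the coordinates factorise.\<close>

lemma linear_form_mgf:
  fixes \<beta> :: "'i \<Rightarrow> real"
  assumes "finite I" "c \<ge> 0" "2 * c * (\<Sum>j\<in>I. (\<beta> j)\<^sup>2) < 1"
  shows "(\<integral>\<^sup>+g. ennreal (exp (c * (\<Sum>j\<in>I. \<beta> j * g j)\<^sup>2)) \<partial>gauss I)
    = ennreal (1 / sqrt (1 - 2 * c * (\<Sum>j\<in>I. (\<beta> j)\<^sup>2)))"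
proof -
  define \<tau> where "\<tau> = (\<Sum>j\<in>I. (\<beta> j)\<^sup>2)"
  define w where "w = sqrt (2 * c)"
  have w2: "w\<^sup>2 = 2 * c" using assms by (simp add: w_def)
  interpret G: sigma_finite_measure "gauss I" by (rule ps.sigma_finite[OF assms(1)])
  interpret Nn: sigma_finite_measure std_normal_distribution by (rule sigma_finite_std_normal)
  interpret P: pair_sigma_finite "gauss I" std_normal_distribution ..
  have lin: "(\<lambda>g. \<Sum>j\<in>I. \<beta> j * g j) \<in> borel_measurable (gauss I)"
    by (intro borel_measurable_sum borel_measurable_times) auto
  have "(\<integral>\<^sup>+g. ennreal (exp (c * (\<Sum>j\<in>I. \<beta> j * g j)\<^sup>2)) \<partial>gauss I)
     = (\<integral>\<^sup>+g. (\<integral>\<^sup>+y. ennreal (exp ((w * y) * (\<Sum>j\<in>I. \<beta> j * g j))) \<partial>std_normal_distribution) \<partial>gauss I)"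
  proof (intro nn_integral_cong)
    fix g
    show "ennreal (exp (c * (\<Sum>j\<in>I. \<beta> j * g j)\<^sup>2)) = (\<integral>\<^sup>+y. ennreal (exp ((w * y) * (\<Sum>j\<in>I. \<beta> j * g j))) \<partial>std_normal_distribution)"
      using nn_integral_exp_quad[of 0 "w * (\<Sum>j\<in>I. \<beta> j * g j)"] by (simp add: power_mult_distrib w2 mult_ac)
  qed
  also have "\<dots> = (\<integral>\<^sup>+y. (\<integral>\<^sup>+g. ennreal (exp ((w * y) * (\<Sum>j\<in>I. \<beta> j * g j))) \<partial>gauss I) \<partial>std_normal_distribution)"
  proof -
    have [measurable]: "(\<lambda>z. \<Sum>j\<in>I. \<beta> j * fst z j) \<in> borel_measurable (gauss I \<Otimes>\<^sub>M std_normal_distribution)"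
      by (rule measurable_compose[OF measurable_fst lin])
    show ?thesis by (rule P.Fubini'[symmetric]) (simp add: split_beta', measurable)
  qed
  also have "\<dots> = (\<integral>\<^sup>+y. ennreal (exp (c * \<tau> * y\<^sup>2 + 0 * y)) \<partial>std_normal_distribution)"
  proof (intro nn_integral_cong)
    fix y
    have "(\<integral>\<^sup>+g. ennreal (exp ((w * y) * (\<Sum>j\<in>I. \<beta> j * g j))) \<partial>gauss I)
      = (\<integral>\<^sup>+g. (\<Prod>j\<in>I. ennreal (exp (0 * (g j)\<^sup>2 + w * y * \<beta> j * g j))) \<partial>gauss I)"
      using assms(1) by (simp add: prod_ennreal exp_sum[symmetric] sum_distrib_left mult_ac)
    also have "\<dots> = (\<Prod>j\<in>I. \<integral>\<^sup>+x. ennreal (exp (0 * x\<^sup>2 + w * y * \<beta> j * x)) \<partial>std_normal_distribution)"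
      using assms(1) by (intro ps.product_nn_integral_prod[where f = "\<lambda>j x. ennreal (exp (0 * x\<^sup>2 + w * y * \<beta> j * x))"]) auto
    also have "\<dots> = (\<Prod>j\<in>I. ennreal (exp ((w * y * \<beta> j)\<^sup>2 / 2)))"
      by (subst nn_integral_exp_quad) auto
    also have "\<dots> = ennreal (exp (c * \<tau> * y\<^sup>2 + 0 * y))"
      using assms(1) by (simp add: prod_ennreal exp_sum[symmetric] \<tau>_def sum_distrib_left sum_distrib_right power_mult_distrib w2 mult_ac)
    finally show "(\<integral>\<^sup>+g. ennreal (exp ((w * y) * (\<Sum>j\<in>I. \<beta> j * g j))) \<partial>gauss I) = ennreal (exp (c * \<tau> * y\<^sup>2 + 0 * y))" .
  qed
  also have "\<dots> = ennreal (1 / sqrt (1 - 2 * c * \<tau>))"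
    using assms(3) by (subst nn_integral_exp_quad) (auto simp: \<tau>_def mult_ac)
  finally show ?thesis by (simp add: \<tau>_def)
qed

lemma jensen_exp:
  assumes "finite I" "\<And>i. i \<in> I \<Longrightarrow> 0 \<le> w i" "sum w I = 1"
  shows "exp (\<Sum>i\<in>I. w i * y i) \<le> (\<Sum>i\<in>I. w i * exp (y i :: real))"
proof -
  have "I \<noteq> {}" using assms(3) by auto
  then show ?thesis
    using convex_on_sum[OF assms(1) _ exp_convex assms(3), of y] assms(2) by simp
qed

text \<open>The linear forms share coordinates and are not independent. Jensen with weights
  proportional to their variances reduces to single forms rescaled to the total variance
  \<open>s\<close>; forms of variance zero are dropped, since they cannot be rescaled.\<close>

lemma sum_squares_mgf:
  fixes \<beta> :: "'i \<Rightarrow> 'i \<Rightarrow> real"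
  assumes "finite I" "\<And>i. i \<in> I \<Longrightarrow> J i \<subseteq> I" and s: "s = (\<Sum>i\<in>I. \<Sum>j\<in>J i. (\<beta> i j)\<^sup>2)" "s \<le> 1 / 16"
  shows "(\<integral>\<^sup>+g. ennreal (exp (4 * (\<Sum>i\<in>I. (\<Sum>j\<in>J i. \<beta> i j * g j)\<^sup>2))) \<partial>gauss I) \<le> ennreal (exp (8 * s))"
proof (cases "s = 0")
  case True
  have fJ: "finite (J i)" if "i \<in> I" for i using assms that finite_subset by blast
  have "\<forall>i\<in>I. (\<Sum>j\<in>J i. (\<beta> i j)\<^sup>2) = 0"
    using True s(1) assms(1) by (subst (asm) (2) eq_commute) (auto simp: sum_nonneg_eq_0_iff sum_nonneg)
  then have "\<beta> i j = 0" if "i \<in> I" "j \<in> J i" for i j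
    using that fJ by (auto simp: sum_nonneg_eq_0_iff)
  then have "(\<Sum>j\<in>J i. \<beta> i j * g j) = 0" if "i \<in> I" for i g using that by simp
  then show ?thesis using True by (simp add: prob_space.emeasure_space_1[OF prob_gauss])
next
  case False
  have fJ: "finite (J i)" if "i \<in> I" for i using assms that finite_subset by blast
  define \<tau> where "\<tau> i = (\<Sum>j\<in>J i. (\<beta> i j)\<^sup>2)" for i
  have \<tau>0: "0 \<le> \<tau> i" for i by (simp add: \<tau>_def sum_nonneg)
  have s\<tau>: "s = sum \<tau> I" by (simp add: s \<tau>_def)
  have s0: "s > 0" using False \<tau>0 s\<tau> by (metis order_le_less sum_nonneg)
  define q where "q i g = (\<Sum>j\<in>J i. \<beta> i j * g j)\<^sup>2" for i and g :: "'i \<Rightarrow> real"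
  have qz: "q i g = 0" if "i \<in> I" "\<tau> i = 0" for i g
  proof -
    have "\<beta> i j = 0" if "j \<in> J i" for j
      using \<open>\<tau> i = 0\<close> fJ[OF \<open>i \<in> I\<close>] that by (auto simp: \<tau>_def sum_nonneg_eq_0_iff)
    then show ?thesis by (simp add: q_def)
  qed
  have qm: "q i \<in> borel_measurable (gauss I)" if "i \<in> I" for i
    unfolding q_def using assms(2)[OF that]
    by (intro borel_measurable_power borel_measurable_sum borel_measurable_times) auto
  have single: "(\<integral>\<^sup>+g. ennreal (exp (4 * s / \<tau> i * q i g)) \<partial>gauss I) \<le> ennreal (exp (8 * s))" if i: "i \<in> I" "\<tau> i \<noteq> 0" for i
  proof -
    define \<beta>' where "\<beta>' j = (if j \<in> J i then \<beta> i j else 0)" for j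
    have 1: "(\<Sum>j\<in>J i. \<beta> i j * g j) = (\<Sum>j\<in>I. \<beta>' j * g j)" for g
      unfolding \<beta>'_def using assms i by (intro sum.mono_neutral_cong_left) auto
    have 2: "\<tau> i = (\<Sum>j\<in>I. (\<beta>' j)\<^sup>2)"
      unfolding \<beta>'_def \<tau>_def using assms i by (intro sum.mono_neutral_cong_left) auto
    have "2 * (4 * s / \<tau> i) * \<tau> i = 8 * s" using i by simp
    then have "(\<integral>\<^sup>+g. ennreal (exp (4 * s / \<tau> i * q i g)) \<partial>gauss I) = ennreal (1 / sqrt (1 - 8 * s))"
      unfolding q_def 1 using linear_form_mgf[OF assms(1), of "4 * s / \<tau> i" \<beta>'] s0 s(2) \<tau>0[of i] unfolding 2 by simp
    also have "\<dots> \<le> ennreal (exp (8 * s))" using s0 s(2) by (intro ennreal_leI inv_sqrt_le_exp') auto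
    finally show ?thesis .
  qed
  define L where "L = {i \<in> I. \<tau> i \<noteq> 0}"
  have L: "finite L" "L \<subseteq> I" "sum \<tau> L = s" using assms(1) s\<tau> by (auto simp: L_def intro!: sum.mono_neutral_left)
  have "ennreal (exp (4 * (\<Sum>i\<in>I. q i g))) \<le> (\<Sum>i\<in>L. ennreal (\<tau> i / s) * ennreal (exp (4 * s / \<tau> i * q i g)))" for g
  proof -
    have "4 * (\<Sum>i\<in>I. q i g) = 4 * (\<Sum>i\<in>L. q i g)"
      using L qz assms(1) by (intro arg_cong[of _ _ "(*) 4"] sum.mono_neutral_right) (auto simp: L_def)
    also have "\<dots> = (\<Sum>i\<in>L. \<tau> i / s * (4 * s / \<tau> i * q i g))"
      unfolding sum_distrib_left using s0 by (intro sum.cong refl) (auto simp: L_def)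
    finally have "exp (4 * (\<Sum>i\<in>I. q i g)) \<le> (\<Sum>i\<in>L. \<tau> i / s * exp (4 * s / \<tau> i * q i g))"
      using jensen_exp[OF L(1), of "\<lambda>i. \<tau> i / s" "\<lambda>i. 4 * s / \<tau> i * q i g"] L(3) s0 \<tau>0
      by (simp add: sum_divide_distrib[symmetric])
    then have "ennreal (exp (4 * (\<Sum>i\<in>I. q i g))) \<le> ennreal (\<Sum>i\<in>L. \<tau> i / s * exp (4 * s / \<tau> i * q i g))"
      by (rule ennreal_leI)
    also have "\<dots> = (\<Sum>i\<in>L. ennreal (\<tau> i / s) * ennreal (exp (4 * s / \<tau> i * q i g)))"
    proof -
      have "(\<Sum>i\<in>L. ennreal (\<tau> i / s) * ennreal (exp (4 * s / \<tau> i * q i g)))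
          = (\<Sum>i\<in>L. ennreal (\<tau> i / s * exp (4 * s / \<tau> i * q i g)))"
        by (intro sum.cong refl ennreal_mult[symmetric]) (use s0 \<tau>0 in auto)
      also have "\<dots> = ennreal (\<Sum>i\<in>L. \<tau> i / s * exp (4 * s / \<tau> i * q i g))"
        by (rule sum_ennreal) (use s0 \<tau>0 in auto)
      finally show ?thesis by simp
    qed
    finally show ?thesis .
  qed
  then have "(\<integral>\<^sup>+g. ennreal (exp (4 * (\<Sum>i\<in>I. q i g))) \<partial>gauss I)
     \<le> (\<integral>\<^sup>+g. (\<Sum>i\<in>L. ennreal (\<tau> i / s) * ennreal (exp (4 * s / \<tau> i * q i g))) \<partial>gauss I)"
    by (rule nn_integral_mono)
  also have "\<dots> = (\<Sum>i\<in>L. \<integral>\<^sup>+g. ennreal (\<tau> i / s) * ennreal (exp (4 * s / \<tau> i * q i g)) \<partial>gauss I)"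
    by (rule nn_integral_sum) (use qm L in \<open>auto intro!: measurable_ennreal_exp borel_measurable_times\<close>)
  also have "\<dots> = (\<Sum>i\<in>L. ennreal (\<tau> i / s) * (\<integral>\<^sup>+g. ennreal (exp (4 * s / \<tau> i * q i g)) \<partial>gauss I))"
    by (intro sum.cong refl nn_integral_cmult) (use qm L in \<open>auto intro!: measurable_ennreal_exp borel_measurable_times\<close>)
  also have "\<dots> \<le> (\<Sum>i\<in>L. ennreal (\<tau> i / s) * ennreal (exp (8 * s)))"
    by (intro sum_mono mult_left_mono single) (auto simp: L_def)
  also have "\<dots> = ennreal (exp (8 * s))"
    using L(3) s0 \<tau>0 by (simp add: sum_distrib_right[symmetric] sum_divide_distrib[symmetric])
  finally show ?thesis by (simp add: q_def)
qed

text \<open>With \<open>X\<close> the centred form and \<open>B\<close> its compensator, \<open>2 * exp X \<le> exp (2 * X - B) + exp B\<close>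
  splits the chaos into a supermartingale and a sum of squared linear forms.\<close>
lemma chaos_mgf:
  fixes I :: "'i::countable set" and A :: "'i \<Rightarrow> 'i \<Rightarrow> real"
  assumes I: "finite I" and sym: "\<And>i j. A i j = A j i"
    and F: "(\<Sum>i\<in>I. \<Sum>j\<in>I. (A i j)\<^sup>2) \<le> F" "F \<le> 1 / 64"
  shows "(\<integral>\<^sup>+g. ennreal (exp ((\<Sum>i\<in>I. \<Sum>j\<in>I. g i * A i j * g j) - (\<Sum>i\<in>I. A i i))) \<partial>gauss I) \<le> ennreal (exp (16 * F))"
proof -
  define J where "J i = {j. j \<in> I \<and> to_nat j < to_nat i}" for i :: 'i
  define b where "b i g = (\<Sum>j\<in>J i. 2 * A i j * g j)" for i and g :: "'i \<Rightarrow> real"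
  define X where "X g = (\<Sum>i\<in>I. A i i * ((g i)\<^sup>2 - 1) + g i * b i g)" for g
  define B where "B g = (\<Sum>i\<in>I. 4 * (b i g)\<^sup>2 + 16 * (A i i)\<^sup>2)" for g
  define D where "D = (\<Sum>i\<in>I. (A i i)\<^sup>2)"
  define R where "R = (\<Sum>i\<in>I. \<Sum>j\<in>J i. (A i j)\<^sup>2)"
  have fJ: "finite (J i)" "J i \<subseteq> I" for i using I by (auto simp: J_def)
  \<comment> \<open>A symmetric double sum is the diagonal plus twice the part below it, where the
    order is the enumeration order of the indices.\<close>
  have split: "(\<Sum>i\<in>I. \<Sum>j\<in>I. f i j) = (\<Sum>i\<in>I. f i i) + 2 * (\<Sum>i\<in>I. \<Sum>j\<in>J i. f i j)"
    if "\<And>i j. f i j = f j i" for f :: "'i \<Rightarrow> 'i \<Rightarrow> real"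
  proof -
    have "(\<Sum>j\<in>I. f i j) = f i i + (\<Sum>j\<in>J i. f i j) + (\<Sum>j\<in>{j\<in>I. to_nat i < to_nat j}. f i j)" if "i \<in> I" for i
    proof -
      have e: "I = insert i (J i \<union> {j\<in>I. to_nat i < to_nat j})"
        using that by (auto simp: J_def) (metis to_nat_split nat_neq_iff inj_to_nat injD)
      show ?thesis
        by (subst e, subst sum.insert) (use I fJ in \<open>auto simp: J_def sum.union_disjoint[symmetric] intro!: sum.union_disjoint\<close>)
    qed
    moreover have "(\<Sum>i\<in>I. \<Sum>j\<in>{j\<in>I. to_nat i < to_nat j}. f i j) = (\<Sum>i\<in>I. \<Sum>j\<in>J i. f i j)"
      unfolding J_def using that by (subst sum.swap_restrict[OF I I]) (auto intro!: sum.cong)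
    ultimately show ?thesis by (simp add: sum.distrib)
  qed
  have FDR: "D + 2 * R \<le> F"
    using F(1) split[of "\<lambda>i j. (A i j)\<^sup>2"] sym by (simp add: D_def R_def)
  have DR0: "0 \<le> D" "0 \<le> R" by (auto simp: D_def R_def sum_nonneg)
  have Aii: "\<bar>A i i\<bar> \<le> 1 / 8" if "i \<in> I" for i
  proof -
    have "(A i i)\<^sup>2 \<le> D" unfolding D_def using that I by (intro member_le_sum) auto
    then have "(A i i)\<^sup>2 \<le> (1 / 8)\<^sup>2" using FDR DR0 F(2) by (simp add: power_divide)
    then show ?thesis using abs_le_square_iff[of "A i i" "1 / 8"] by simp
  qed
  have X: "(\<Sum>i\<in>I. \<Sum>j\<in>I. g i * A i j * g j) - (\<Sum>i\<in>I. A i i) = X g" for g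
  proof -
    have "(\<Sum>i\<in>I. \<Sum>j\<in>I. g i * A i j * g j) = (\<Sum>i\<in>I. g i * A i i * g i) + 2 * (\<Sum>i\<in>I. \<Sum>j\<in>J i. g i * A i j * g j)"
      by (rule split) (simp add: sym mult_ac)
    then show ?thesis unfolding X_def b_def
      by (simp add: sum.distrib sum_subtractf sum_distrib_left algebra_simps power2_eq_square)
  qed
  have bm: "b i \<in> borel_measurable (gauss I)" for i
    unfolding b_def using fJ(2)[of i] by (intro borel_measurable_sum borel_measurable_times) auto
  have cm: "(\<lambda>g. g i) \<in> borel_measurable (gauss I)" if "i \<in> I" for i using that by auto
  have Xm: "X \<in> borel_measurable (gauss I)"
    unfolding X_def by (intro borel_measurable_sum borel_measurable_add borel_measurable_times borel_measurable_diff borel_measurable_power bm cm borel_measurable_const)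
  have Bm: "B \<in> borel_measurable (gauss I)"
    unfolding B_def by (intro borel_measurable_sum borel_measurable_add borel_measurable_times borel_measurable_power bm borel_measurable_const)
  have Beq: "B g = 4 * (\<Sum>i\<in>I. (b i g)\<^sup>2) + 16 * D" for g
    by (simp add: B_def D_def sum.distrib sum_distrib_left)
  have m1: "(\<lambda>g. ennreal (exp (2 * X g - B g))) \<in> borel_measurable (gauss I)"
    by (intro measurable_ennreal_exp borel_measurable_diff borel_measurable_times Xm Bm borel_measurable_const)
  have m2: "(\<lambda>g. ennreal (exp (B g))) \<in> borel_measurable (gauss I)"
    by (intro measurable_ennreal_exp Bm)
  have e2: "(\<integral>\<^sup>+g. ennreal (exp (B g)) \<partial>gauss I) \<le> ennreal (exp (16 * F))"
  proof -
    have M4: "(\<lambda>g. ennreal (exp (4 * (\<Sum>i\<in>I. (b i g)\<^sup>2)))) \<in> borel_measurable (gauss I)"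
      by (intro measurable_ennreal_exp borel_measurable_times borel_measurable_sum borel_measurable_power bm borel_measurable_const)
    have "(\<integral>\<^sup>+g. ennreal (exp (B g)) \<partial>gauss I) = ennreal (exp (16 * D)) * (\<integral>\<^sup>+g. ennreal (exp (4 * (\<Sum>i\<in>I. (b i g)\<^sup>2))) \<partial>gauss I)"
      unfolding Beq exp_add
      by (subst nn_integral_cmult[OF M4, symmetric]) (simp add: ennreal_mult mult.commute)
    \<comment> \<open>\<open>D\<close> and \<open>R\<close> are the energies on and below the
      diagonal. The exponents add to \<open>16 * (D + 2 * R)\<close>, which is at most
      \<open>16 * F\<close>.\<close>
    also have "\<dots> \<le> ennreal (exp (16 * D)) * ennreal (exp (8 * (4 * R)))"
    proof (intro mult_left_mono)
      have "4 * R = (\<Sum>i\<in>I. \<Sum>j\<in>J i. (2 * A i j)\<^sup>2)" by (simp add: R_def power_mult_distrib sum_distrib_left)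
      then show "(\<integral>\<^sup>+g. ennreal (exp (4 * (\<Sum>i\<in>I. (b i g)\<^sup>2))) \<partial>gauss I) \<le> ennreal (exp (8 * (4 * R)))"
        unfolding b_def by (rule sum_squares_mgf[OF I fJ(2)]) (use FDR DR0 F(2) in linarith)
    qed simp
    also have "\<dots> \<le> ennreal (exp (16 * F))"
      using FDR by (simp add: ennreal_mult[symmetric] exp_add[symmetric])
    finally show ?thesis .
  qed
  have e1: "(\<integral>\<^sup>+g. ennreal (exp (2 * X g - B g)) \<partial>gauss I) \<le> 1"
  proof -
    have "2 * X g - B g = (\<Sum>i\<in>I. 2 * A i i * ((g i)\<^sup>2 - 1) + 2 * g i * b i g - 4 * (b i g)\<^sup>2 - 16 * (A i i)\<^sup>2)" for g
      by (simp add: X_def B_def sum_distrib_left sum_subtractf[symmetric] algebra_simps)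
    then show ?thesis
      using supermartingale_mgf[OF I, of "\<lambda>i. A i i" "\<lambda>i j. 2 * A i j"] Aii by (simp add: b_def J_def)
  qed
  have "(\<integral>\<^sup>+g. ennreal (exp (X g)) \<partial>gauss I) \<le> (\<integral>\<^sup>+g. ennreal (1 / 2) * (ennreal (exp (2 * X g - B g)) + ennreal (exp (B g))) \<partial>gauss I)"
  proof (rule nn_integral_mono)
    fix g
    have "2 * exp (X g) \<le> exp (2 * X g - B g) + exp (B g)"
    proof -
      define u v where "u = exp (X g - B g / 2)" and "v = exp (B g / 2)"
      have "exp (X g) = u * v" "exp (2 * X g - B g) = u\<^sup>2" "exp (B g) = v\<^sup>2"
        by (simp_all add: u_def v_def exp_add[symmetric] power2_eq_square)
      then show ?thesis using sum_squares_bound[of u v] by (simp add: mult.assoc)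
    qed
    then have "exp (X g) \<le> 1 / 2 * (exp (2 * X g - B g) + exp (B g))" by simp
    then show "ennreal (exp (X g)) \<le> ennreal (1 / 2) * (ennreal (exp (2 * X g - B g)) + ennreal (exp (B g)))"
      by (metis ennreal_leI ennreal_mult ennreal_plus exp_ge_zero add_nonneg_nonneg half_gt_zero less_eq_real_def zero_less_one)
  qed
  also have "\<dots> = ennreal (1 / 2) * ((\<integral>\<^sup>+g. ennreal (exp (2 * X g - B g)) \<partial>gauss I) + (\<integral>\<^sup>+g. ennreal (exp (B g)) \<partial>gauss I))"
    by (simp only: nn_integral_cmult[OF borel_measurable_add[OF m1 m2]] nn_integral_add[OF m1 m2])
  also have "\<dots> \<le> ennreal (1 / 2) * (ennreal (exp (16 * F)) + ennreal (exp (16 * F)))"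
  proof (intro mult_left_mono add_mono e2)
    have "0 \<le> F" using FDR DR0 by linarith
    then have "1 \<le> ennreal (exp (16 * F))" by simp
    then show "(\<integral>\<^sup>+g. ennreal (exp (2 * X g - B g)) \<partial>gauss I) \<le> ennreal (exp (16 * F))" using e1 by (rule order_trans[rotated])
  qed auto
  also have "\<dots> = ennreal (exp (16 * F))"
  proof -
    have "ennreal (exp (16 * F)) + ennreal (exp (16 * F)) = ennreal (2 * exp (16 * F))"
      by (simp add: ennreal_plus[symmetric] del: ennreal_plus)
    moreover have "ennreal (1 / 2) * ennreal (2 * exp (16 * F)) = ennreal (1 / 2 * (2 * exp (16 * F)))"
      by (rule ennreal_mult[symmetric]) auto
    ultimately show ?thesis by (simp only:) simp
  qed
  finally show ?thesis by (simp add: X)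
qed

section \<open>Exponential moments of squared quadratic forms\<close>

lemma sum_exp_neg_le: "(\<Sum>j\<le>m. exp (- real j)) \<le> 2"
proof -
  have e2: "exp 1 \<ge> (2::real)" using exp_ge_add_one_self[of "1::real"] by simp
  have "(\<Sum>j\<le>m. exp (- real j)) \<le> (\<Sum>j\<le>m. (1 / 2) ^ j)"
  proof (rule sum_mono)
    fix j
    have "exp (- real j) = exp (-1) ^ j" by (simp add: exp_of_nat_mult[symmetric])
    also have "\<dots> \<le> (1 / 2) ^ j" using e2 by (intro power_mono) (auto simp: exp_minus field_simps)
    finally show "exp (- real j) \<le> (1 / 2) ^ j" .
  qed
  also have "(\<Sum>j\<le>m. (1 / 2 :: real) ^ j) \<le> 2"
  proof -
    have "(1 - 1 / 2) * (\<Sum>j\<le>m. (1 / 2 :: real) ^ j) = 1 - (1 / 2) ^ Suc m" by (rule sum_gp_basic)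
    moreover have "0 \<le> (1 / 2 :: real) ^ Suc m" by (rule zero_le_power) simp
    moreover have "x \<le> 2" if "(1 - 1 / 2) * x = 1 - y" "0 \<le> y" for x y :: real using that by simp
    ultimately show ?thesis by blast
  qed
  finally show ?thesis .
qed

definition quadf :: "nat \<Rightarrow> fmat \<Rightarrow> (nat \<times> nat \<Rightarrow> real) \<Rightarrow> nat \<Rightarrow> real" where
  "quadf d H g t = (\<Sum>a<d. \<Sum>b<d. g (t, a) * ent H a b * g (t, b)) - (\<Sum>a<d. ent H a a)"

lemma quadf_meas: "t \<in> T \<Longrightarrow> (\<lambda>g. quadf d H g t) \<in> borel_measurable (gauss (T \<times> {..<d}))"
  unfolding quadf_def
  by (intro borel_measurable_diff borel_measurable_sum borel_measurable_times borel_measurable_const) auto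

text \<open>The admissible range of \<open>\<theta>\<close> is where \<open>\<theta> * H\<close> has
  Frobenius energy at most \<open>1 / 64\<close>.\<close>

lemma row_mgf:
  assumes H: "tp H = H" "bnd H d" "norm H \<le> 1" and \<theta>: "\<bar>\<theta>\<bar> \<le> 1 / 8"
  shows "(\<integral>\<^sup>+g. ennreal (exp (\<theta> * quadf d H g t)) \<partial>gauss ({t} \<times> {..<d})) \<le> ennreal (exp (16 * \<theta>\<^sup>2))"
proof -
  let ?I = "{t} \<times> {..<d}"
  define A where "A i j = \<theta> * ent H (snd i) (snd j)" for i j :: "nat \<times> nat"
  have re: "(\<Sum>i\<in>?I. f i) = (\<Sum>a<d. f (t, a))" for f :: "nat \<times> nat \<Rightarrow> real"
  proof -
    have "?I = (\<lambda>a. (t, a)) ` {..<d}" by auto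
    then show ?thesis by (simp add: sum.reindex inj_on_def)
  qed
  have sym: "A i j = A j i" for i j using H(1) by (metis A_def ent_tp)
  have "(\<Sum>i\<in>?I. \<Sum>j\<in>?I. (A i j)\<^sup>2) = \<theta>\<^sup>2 * (norm H)\<^sup>2"
    by (simp add: re A_def norm_fmat_sq[OF H(2)] power_mult_distrib sum_distrib_left)
  also have "\<dots> \<le> \<theta>\<^sup>2 * 1" using H(3) by (intro mult_left_mono) (auto simp: power_le_one)
  finally have F: "(\<Sum>i\<in>?I. \<Sum>j\<in>?I. (A i j)\<^sup>2) \<le> \<theta>\<^sup>2" by simp
  have "\<theta>\<^sup>2 \<le> (1 / 8)\<^sup>2" using \<theta> by (simp add: abs_le_square_iff[symmetric])
  then have F2: "\<theta>\<^sup>2 \<le> 1 / 64" by (simp add: power_divide)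
  have "\<theta> * quadf d H g t = (\<Sum>i\<in>?I. \<Sum>j\<in>?I. g i * A i j * g j) - (\<Sum>i\<in>?I. A i i)" for g
    by (simp add: re A_def quadf_def right_diff_distrib sum_distrib_left mult_ac)
  then show ?thesis using chaos_mgf[OF _ sym F F2] by simp
qed

lemma rows_mgf:
  assumes T: "finite T" and H: "tp H = H" "bnd H d" "norm H \<le> 1" and \<theta>: "\<bar>\<theta>\<bar> \<le> 1 / 8"
  shows "(\<integral>\<^sup>+g. ennreal (exp (\<theta> * (\<Sum>t\<in>T. quadf d H g t))) \<partial>gauss (T \<times> {..<d}))
    \<le> ennreal (exp (16 * real (card T) * \<theta>\<^sup>2))"
  using T
proof (induction T)
  case empty
  show ?case by (simp add: prob_space.emeasure_space_1[OF prob_gauss])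
next
  case (insert t T)
  let ?D = "{..<d}"
  have e: "insert t T \<times> ?D = T \<times> ?D \<union> {t} \<times> ?D" by auto
  have dj: "(T \<times> ?D) \<inter> ({t} \<times> ?D) = {}" using insert by auto
  have m: "(\<lambda>g. ennreal (exp (\<theta> * (\<Sum>t\<in>insert t T. quadf d H g t)))) \<in> borel_measurable (gauss (T \<times> ?D \<union> {t} \<times> ?D))"
    unfolding e[symmetric] by (intro measurable_ennreal_exp borel_measurable_times borel_measurable_sum quadf_meas borel_measurable_const)
  have mt: "(\<lambda>g. ennreal (exp (\<theta> * quadf d H g t))) \<in> borel_measurable (gauss ({t} \<times> ?D))"
    by (intro measurable_ennreal_exp borel_measurable_times quadf_meas borel_measurable_const) simp
  have q1: "quadf d H (merge (T \<times> ?D) ({t} \<times> ?D) (x, y)) t' = quadf d H x t'" if "t' \<in> T" for x y t'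
    unfolding quadf_def using that by (auto simp: merge_def intro!: arg_cong2[of _ _ _ _ "(-)"] sum.cong)
  have q2: "quadf d H (merge (T \<times> ?D) ({t} \<times> ?D) (x, y)) t = quadf d H y t" for x y
    unfolding quadf_def using insert(2) by (auto simp: merge_def intro!: arg_cong2[of _ _ _ _ "(-)"] sum.cong)
  have "(\<integral>\<^sup>+g. ennreal (exp (\<theta> * (\<Sum>t\<in>insert t T. quadf d H g t))) \<partial>gauss (insert t T \<times> ?D))
     = (\<integral>\<^sup>+x. (\<integral>\<^sup>+y. ennreal (exp (\<theta> * (\<Sum>t'\<in>insert t T. quadf d H (merge (T \<times> ?D) ({t} \<times> ?D) (x, y)) t'))) \<partial>gauss ({t} \<times> ?D)) \<partial>gauss (T \<times> ?D))"
    unfolding e by (rule ps.product_nn_integral_fold[OF dj _ _ m]) (use insert in auto)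
  also have "\<dots> = (\<integral>\<^sup>+x. ennreal (exp (\<theta> * (\<Sum>t'\<in>T. quadf d H x t'))) * (\<integral>\<^sup>+y. ennreal (exp (\<theta> * quadf d H y t)) \<partial>gauss ({t} \<times> ?D)) \<partial>gauss (T \<times> ?D))"
    using insert(1,2) by (subst nn_integral_cmult[OF mt, symmetric]) (simp add: q1 q2 distrib_left exp_add ennreal_mult mult.commute)
  also have "\<dots> \<le> (\<integral>\<^sup>+x. ennreal (exp (\<theta> * (\<Sum>t'\<in>T. quadf d H x t'))) * ennreal (exp (16 * \<theta>\<^sup>2)) \<partial>gauss (T \<times> ?D))"
    by (intro nn_integral_mono mult_left_mono row_mgf H \<theta>) auto
  also have "\<dots> = (\<integral>\<^sup>+x. ennreal (exp (\<theta> * (\<Sum>t'\<in>T. quadf d H x t'))) \<partial>gauss (T \<times> ?D)) * ennreal (exp (16 * \<theta>\<^sup>2))"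
    by (intro nn_integral_multc measurable_ennreal_exp borel_measurable_times borel_measurable_sum quadf_meas borel_measurable_const)
  also have "\<dots> \<le> ennreal (exp (16 * real (card T) * \<theta>\<^sup>2)) * ennreal (exp (16 * \<theta>\<^sup>2))"
    by (intro mult_right_mono insert.IH) auto
  also have "\<dots> = ennreal (exp (16 * real (card (insert t T)) * \<theta>\<^sup>2))"
    using insert by (simp add: ennreal_mult[symmetric] exp_add[symmetric] algebra_simps)
  finally show ?case .
qed

text \<open>Truncating at 1 keeps to the range where the deviations of a chaos are sub-Gaussian.\<close>
definition psi :: "nat \<Rightarrow> real \<Rightarrow> real" where
  "psi n z = exp (real n / 128 * min (z\<^sup>2) 1)"

text \<open>Peeling by the integer part \<open>j\<close> of the exponent. The slope
  \<open>\<theta> j\<close> is \<open>z / 32\<close> at \<open>z^2 = 128 * j / n\<close>, the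
  maximiser of \<open>\<theta> * n * z - 16 * n * \<theta>^2\<close>. The tilt gains
  \<open>4 * j\<close> while its moment costs \<open>2 * j\<close>, so the weight
  \<open>exp (1 - 3 * j)\<close> leaves a summable series. Truncation stops the levels at
  \<open>n div 128\<close>, which keeps the slopes admissible.\<close>

lemma psi_le_mixture:
  assumes n: "n > 0"
  defines "\<theta> \<equiv> \<lambda>j. sqrt (128 * real j / real n) / 32"
  shows "psi n z \<le> (\<Sum>j\<le>n div 128. exp (1 - 3 * real j) * (exp (\<theta> j * (real n * z)) + exp (- \<theta> j * (real n * z))))"
proof -
  define v where "v = real n / 128 * min (z\<^sup>2) 1"
  define j where "j = nat \<lfloor>v\<rfloor>"
  have v0: "v \<ge> 0" by (simp add: v_def)
  have j: "real j \<le> v" "v < real j + 1" using v0 by (auto simp: j_def)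
  have "v \<le> real n / 128" using n by (simp add: v_def)
  then have "128 * real j \<le> real n" using j by linarith
  then have "real (128 * j) \<le> real n" by simp
  then have jm: "j \<le> n div 128" unfolding of_nat_le_iff by simp
  define w where "w = min (z\<^sup>2) 1"
  have "128 * real j / real n \<le> w" using j(1) n unfolding v_def w_def[symmetric] by (simp add: field_simps)
  then have "128 * real j / real n \<le> z\<^sup>2" by (simp add: w_def)
  then have "sqrt (128 * real j / real n) \<le> \<bar>z\<bar>" by (metis real_sqrt_abs real_sqrt_le_mono)
  then have "\<theta> j * (real n * \<bar>z\<bar>) \<ge> \<theta> j * (real n * sqrt (128 * real j / real n))"
    unfolding \<theta>_def by (intro mult_left_mono) auto
  also have "\<theta> j * (real n * sqrt (128 * real j / real n)) = real n * (sqrt (128 * real j / real n))\<^sup>2 / 32"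
    unfolding \<theta>_def by (simp only: power2_eq_square) (simp only: times_divide_eq_left times_divide_eq_right mult_ac)
  also have "\<dots> = 4 * real j" using n by simp
  finally have t: "4 * real j \<le> \<theta> j * (real n * \<bar>z\<bar>)" .
  have "exp (4 * real j) \<le> exp (\<theta> j * (real n * z)) + exp (- \<theta> j * (real n * z))"
  proof (cases "z \<ge> 0")
    case True
    then have "exp (4 * real j) \<le> exp (\<theta> j * (real n * z))" using t by simp
    then show ?thesis by (smt (verit) exp_gt_zero)
  next
    case False
    then have "exp (4 * real j) \<le> exp (- \<theta> j * (real n * z))" using t by simp
    then show ?thesis by (smt (verit) exp_gt_zero)
  qed
  then have "exp (1 - 3 * real j) * exp (4 * real j) \<le> exp (1 - 3 * real j) * (exp (\<theta> j * (real n * z)) + exp (- \<theta> j * (real n * z)))"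
    by (rule mult_left_mono) simp
  moreover have "psi n z \<le> exp (1 - 3 * real j) * exp (4 * real j)"
    using j(2) by (simp add: psi_def v_def exp_add[symmetric])
  moreover have "exp (1 - 3 * real j) * (exp (\<theta> j * (real n * z)) + exp (- \<theta> j * (real n * z)))
     \<le> (\<Sum>j\<le>n div 128. exp (1 - 3 * real j) * (exp (\<theta> j * (real n * z)) + exp (- \<theta> j * (real n * z))))"
    using jm by (intro member_le_sum[where f = "\<lambda>j. exp (1 - 3 * real j) * (exp (\<theta> j * (real n * z)) + exp (- \<theta> j * (real n * z)))"]) (auto intro: add_nonneg_nonneg)
  ultimately show ?thesis by linarith
qed

lemma gramE_meas:
  assumes "n > 0" "card Ts = n"
  shows "(\<lambda>g. inner (gramE n Ts d g) H) \<in> borel_measurable (gauss (Ts \<times> {..<d}))"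
proof -
  have "inner (gramE n Ts d g) H = (1 / real n) * (\<Sum>t\<in>Ts. quadf d H g t)" for g
    using inner_gramE[OF assms, of d g H] assms(1) by (simp add: quadf_def field_simps)
  then show ?thesis by (simp only:) (intro borel_measurable_times borel_measurable_sum quadf_meas borel_measurable_const)
qed

lemma psi_meas:
  assumes "n > 0" "card Ts = n"
  shows "(\<lambda>g. psi n (inner (gramE n Ts d g) H)) \<in> borel_measurable (gauss (Ts \<times> {..<d}))"
proof -
  have "psi n \<in> borel_measurable borel" unfolding psi_def[abs_def] by measurable
  then show ?thesis by (rule measurable_compose[OF gramE_meas[OF assms]])
qed

lemma psi_bound:
  assumes n: "n > 0" "card Ts = n" and H: "tp H = H" "bnd H d" "norm H \<le> 1"
  shows "(\<integral>\<^sup>+g. ennreal (psi n (inner (gramE n Ts d g) H)) \<partial>gauss (Ts \<times> {..<d})) \<le> 12"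
proof -
  define \<theta> where "\<theta> j = sqrt (128 * real j / real n) / 32" for j
  define m where "m = n div 128"
  define Z where "Z g = real n * inner (gramE n Ts d g) H" for g
  have Zq: "Z g = (\<Sum>t\<in>Ts. quadf d H g t)" for g
    using inner_gramE[OF n, of d g H] by (simp add: Z_def quadf_def)
  have fT: "finite Ts" using n card.infinite by fastforce
  have Zm: "Z \<in> borel_measurable (gauss (Ts \<times> {..<d}))"
    unfolding Z_def by (intro borel_measurable_times gramE_meas n borel_measurable_const)
  note Zm[measurable]
  have \<theta>b: "\<bar>\<theta> j\<bar> \<le> 1 / 8" "16 * real n * (\<theta> j)\<^sup>2 = 2 * real j" if "j \<le> m" for j
  proof -
    have "128 * j \<le> n" using that unfolding m_def by (simp add: less_eq_div_iff_mult_less_eq mult.commute)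
    then have "real (128 * j) \<le> real n" unfolding of_nat_le_iff .
    then have "128 * real j / real n \<le> 1" using n by simp
    then have "sqrt (128 * real j / real n) \<le> sqrt 1" by (rule real_sqrt_le_mono)
    then have "sqrt (128 * real j / real n) \<le> 1" by (simp only: real_sqrt_one)
    moreover have "0 \<le> sqrt (128 * real j / real n)" by simp
    ultimately have "0 \<le> \<theta> j" "\<theta> j \<le> 1 / 8" unfolding \<theta>_def by linarith+
    then show "\<bar>\<theta> j\<bar> \<le> 1 / 8" by (simp only: abs_of_nonneg)
    have "(\<theta> j)\<^sup>2 = (128 * real j / real n) / 1024" by (simp add: \<theta>_def power_divide)
    then show "16 * real n * (\<theta> j)\<^sup>2 = 2 * real j" using n by simp
  qed
  have mgf: "(\<integral>\<^sup>+g. ennreal (exp (c * Z g)) \<partial>gauss (Ts \<times> {..<d})) \<le> ennreal (exp (2 * real j))"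
    if "j \<le> m" "c = \<theta> j \<or> c = - \<theta> j" for c j
  proof -
    have c: "\<bar>c\<bar> \<le> 1 / 8" "16 * real n * c\<^sup>2 = 2 * real j" using \<theta>b[OF that(1)] that(2) by auto
    show ?thesis using rows_mgf[OF fT H c(1)] unfolding Zq n(2) c(2) .
  qed
  have mz: "(\<lambda>g. ennreal (exp (c * Z g))) \<in> borel_measurable (gauss (Ts \<times> {..<d}))" for c
    by (intro measurable_ennreal_exp borel_measurable_times Zm borel_measurable_const)
  have "(\<integral>\<^sup>+g. ennreal (psi n (inner (gramE n Ts d g) H)) \<partial>gauss (Ts \<times> {..<d}))
     \<le> (\<integral>\<^sup>+g. (\<Sum>j\<le>m. ennreal (exp (1 - 3 * real j)) * (ennreal (exp (\<theta> j * Z g)) + ennreal (exp (- \<theta> j * Z g)))) \<partial>gauss (Ts \<times> {..<d}))"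
  proof (rule nn_integral_mono)
    fix g
    have "psi n (inner (gramE n Ts d g) H) \<le> (\<Sum>j\<le>m. exp (1 - 3 * real j) * (exp (\<theta> j * Z g) + exp (- \<theta> j * Z g)))"
      using psi_le_mixture[OF n(1), of "inner (gramE n Ts d g) H"] by (simp add: \<theta>_def m_def Z_def)
    then have "ennreal (psi n (inner (gramE n Ts d g) H)) \<le> ennreal (\<Sum>j\<le>m. exp (1 - 3 * real j) * (exp (\<theta> j * Z g) + exp (- \<theta> j * Z g)))"
      by (rule ennreal_leI)
    also have "\<dots> = (\<Sum>j\<le>m. ennreal (exp (1 - 3 * real j) * (exp (\<theta> j * Z g) + exp (- \<theta> j * Z g))))"
      by (rule sum_ennreal[symmetric]) (auto intro: add_nonneg_nonneg)
    also have "\<dots> = (\<Sum>j\<le>m. ennreal (exp (1 - 3 * real j)) * (ennreal (exp (\<theta> j * Z g)) + ennreal (exp (- \<theta> j * Z g))))"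
      by (intro sum.cong refl) (simp add: ennreal_mult add_nonneg_nonneg)
    finally show "ennreal (psi n (inner (gramE n Ts d g) H)) \<le> \<dots>" .
  qed
  also have "\<dots> = (\<Sum>j\<le>m. \<integral>\<^sup>+g. ennreal (exp (1 - 3 * real j)) * (ennreal (exp (\<theta> j * Z g)) + ennreal (exp (- \<theta> j * Z g))) \<partial>gauss (Ts \<times> {..<d}))"
    by (intro nn_integral_sum) measurable
  also have "\<dots> = (\<Sum>j\<le>m. ennreal (exp (1 - 3 * real j)) * ((\<integral>\<^sup>+g. ennreal (exp (\<theta> j * Z g)) \<partial>gauss (Ts \<times> {..<d})) + (\<integral>\<^sup>+g. ennreal (exp (- \<theta> j * Z g)) \<partial>gauss (Ts \<times> {..<d}))))"
    by (intro sum.cong refl, subst nn_integral_cmult, (intro borel_measurable_add mz)[1], subst nn_integral_add) (auto intro: mz)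
  also have "\<dots> \<le> (\<Sum>j\<le>m. ennreal (exp (1 - 3 * real j)) * (ennreal (exp (2 * real j)) + ennreal (exp (2 * real j))))"
    by (intro sum_mono mult_left_mono add_mono mgf) auto
  also have "\<dots> = ennreal (\<Sum>j\<le>m. 2 * exp 1 * exp (- real j))"
  proof -
    have "ennreal (exp (1 - 3 * real j)) * (ennreal (exp (2 * real j)) + ennreal (exp (2 * real j))) = ennreal (2 * exp 1 * exp (- real j))" for j
    proof -
      have "exp (1 - 3 * real j) * (exp (2 * real j) + exp (2 * real j)) = 2 * exp 1 * exp (- real j)"
        by (simp add: exp_add[symmetric] mult.assoc[symmetric])
      then show ?thesis by (metis ennreal_mult ennreal_plus exp_ge_zero add_nonneg_nonneg)
    qed
    then show ?thesis by (simp add: sum_ennreal)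
  qed
  also have "\<dots> \<le> ennreal 12"
  proof (rule ennreal_leI)
    have "(\<Sum>j\<le>m. exp (- real j)) \<le> 2" by (rule sum_exp_neg_le)
    \<comment> \<open>The constant 12 is the product of 2 for the signs, 3 for \<open>exp 1\<close>
      and 2 for the geometric series.\<close>
    then have "2 * exp 1 * (\<Sum>j\<le>m. exp (- real j)) \<le> 2 * 3 * 2"
      using exp_le by (intro mult_mono) (auto intro: sum_nonneg)
    then show "(\<Sum>j\<le>m. 2 * exp 1 * exp (- real j)) \<le> 12" by (simp add: sum_distrib_left)
  qed
  finally show ?thesis by simp
qed

section \<open>Operator norms from a lattice net\<close>

text \<open>The infimum of all valid constants is itself valid, which avoids bounding the form on a compact sphere.\<close>
lemma opb_of_net:
  assumes E: "tp F = F"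
    and net: "\<And>x. K * x = x \<Longrightarrow> x * coord {0} = x \<Longrightarrow> norm x = 1 \<Longrightarrow>
      \<exists>u. u * coord {0} = u \<and> norm (x - u) \<le> 1 / 4 \<and> norm u \<le> 1 \<and> \<bar>inner (F * u) u\<bar> \<le> a"
    and K: "proj K" "K * F = F" and a: "a \<ge> 0"
  shows "opb F (2 * a)"
proof -
  define valid where "valid s \<longleftrightarrow> 0 \<le> s \<and> (\<forall>x. x * coord {0} = x \<longrightarrow> \<bar>inner (F * x) x\<bar> \<le> s * (norm x)\<^sup>2)" for s
  define s where "s = Inf {s. valid s}"
  have FK: "F * K = F" using K E by (metis projD(1) tp_times)
  have "valid (norm F)"
  proof -
    have "\<bar>inner (F * x) x\<bar> \<le> norm F * (norm x)\<^sup>2" for x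
    proof -
      have "\<bar>inner (F * x) x\<bar> \<le> norm (F * x) * norm x" by (rule Cauchy_Schwarz_ineq2)
      also have "\<dots> \<le> (norm F * norm x) * norm x" by (intro mult_right_mono norm_mult_fmat) auto
      finally show ?thesis by (simp add: power2_eq_square mult.assoc)
    qed
    then show ?thesis by (simp add: valid_def)
  qed
  then have ne: "{s. valid s} \<noteq> {}" by auto
  have bd: "bdd_below {s. valid s}" by (rule bdd_belowI[of _ 0]) (auto simp: valid_def)
  have s0: "0 \<le> s" unfolding s_def by (rule cInf_greatest[OF ne]) (auto simp: valid_def)
  have sv: "\<bar>inner (F * x) x\<bar> \<le> s * (norm x)\<^sup>2" if x: "x * coord {0} = x" for x
  proof (cases "x = 0")
    case False
    have "\<bar>inner (F * x) x\<bar> / (norm x)\<^sup>2 \<le> s" unfolding s_def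
      by (rule cInf_greatest[OF ne]) (use x False in \<open>auto simp: valid_def divide_le_eq\<close>)
    then show ?thesis using False by (simp add: divide_le_eq)
  qed simp
  \<comment> \<open>Polarisation passes from the quadratic to the bilinear form; applied to
    normalised vectors it gives the product of the norms.\<close>
  have pol: "\<bar>inner (F * x) y\<bar> \<le> s / 2 * ((norm x)\<^sup>2 + (norm y)\<^sup>2)" if "x * coord {0} = x" "y * coord {0} = y" for x y
  proof -
    have sm: "inner (F * y) x = inner (F * x) y"
      using inner_mult_l[of F y x] by (simp add: E inner_commute)
    have "4 * inner (F * x) y = inner (F * (x + y)) (x + y) - inner (F * (x - y)) (x - y)"
      by (simp add: distrib_left right_diff_distrib inner_add_left inner_add_right inner_diff_left inner_diff_right sm)
    moreover have "\<bar>inner (F * (x + y)) (x + y)\<bar> \<le> s * (norm (x + y))\<^sup>2" "\<bar>inner (F * (x - y)) (x - y)\<bar> \<le> s * (norm (x - y))\<^sup>2"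
      using that by (auto intro!: sv simp: distrib_right left_diff_distrib)
    moreover have "s * (norm (x + y))\<^sup>2 + s * (norm (x - y))\<^sup>2 = 4 * (s / 2 * ((norm x)\<^sup>2 + (norm y)\<^sup>2))"
      by (simp add: power2_norm_eq_inner inner_add_left inner_add_right inner_diff_left inner_diff_right algebra_simps)
    ultimately show ?thesis by linarith
  qed
  have pol2: "\<bar>inner (F * x) y\<bar> \<le> s * norm x * norm y" if "x * coord {0} = x" "y * coord {0} = y" for x y
  proof (cases "x = 0 \<or> y = 0")
    case False
    have c: "(1 / norm x) *\<^sub>R x * coord {0} = (1 / norm x) *\<^sub>R x" "(1 / norm y) *\<^sub>R y * coord {0} = (1 / norm y) *\<^sub>R y"
      using that by simp_all
    have n: "norm ((1 / norm x) *\<^sub>R x) = 1" "norm ((1 / norm y) *\<^sub>R y) = 1" using False by simp_all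
    have "inner (F * ((1 / norm x) *\<^sub>R x)) ((1 / norm y) *\<^sub>R y) = inner (F * x) y / (norm x * norm y)"
      by simp
    then have "\<bar>inner (F * x) y / (norm x * norm y)\<bar> \<le> s / 2 * (1\<^sup>2 + 1\<^sup>2)"
      using pol[OF c] unfolding n by (simp only:)
    also have "s / 2 * (1\<^sup>2 + 1\<^sup>2) = s" by simp
    finally have "\<bar>inner (F * x) y / (norm x * norm y)\<bar> \<le> s" .
    then have "\<bar>inner (F * x) y\<bar> / (norm x * norm y) \<le> s" by (simp only: abs_divide abs_mult abs_norm_cancel)
    then show ?thesis using False by (simp add: divide_le_eq mult.assoc)
  qed auto
  \<comment> \<open>Replacing a unit vector by a net point costs at most
    \<open>s * (1/4) * 2\<close>. As \<open>s\<close> is the least valid constant,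
    \<open>s \<le> a + s / 2\<close>, that is \<open>s \<le> 2 * a\<close>.\<close>
  have "valid (a + s / 2)"
  proof -
    have unit: "\<bar>inner (F * x) x\<bar> \<le> a + s / 2" if x: "K * x = x" "x * coord {0} = x" "norm x = 1" for x
    proof -
      obtain u where u: "u * coord {0} = u" "norm (x - u) \<le> 1 / 4" "norm u \<le> 1" "\<bar>inner (F * u) u\<bar> \<le> a"
        using net[OF x] by blast
      have sm: "inner (F * u) x = inner (F * x) u"
        using inner_mult_l[of F u x] by (simp add: E inner_commute)
      have "inner (F * x) x = inner (F * u) u + inner (F * (x - u)) (x + u)"
        by (simp add: right_diff_distrib inner_diff_left inner_add_right sm)
      moreover have "\<bar>inner (F * (x - u)) (x + u)\<bar> \<le> s * norm (x - u) * norm (x + u)"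
        by (rule pol2) (simp_all add: left_diff_distrib distrib_right x u)
      moreover have "s * norm (x - u) * norm (x + u) \<le> s * (1 / 4) * 2"
        using u x norm_triangle_ineq[of x u] s0 by (intro mult_mono) auto
      ultimately show ?thesis using u(4) by linarith
    qed
    have "\<bar>inner (F * x) x\<bar> \<le> (a + s / 2) * (norm x)\<^sup>2" if x: "x * coord {0} = x" for x
    proof (cases "K * x = 0")
      case True
      then have "F * x = 0" using FK by (metis mult.assoc mult_zero_right)
      then show ?thesis using a s0 by simp
    next
      case False
      define y where "y = (1 / norm (K * x)) *\<^sub>R (K * x)"
      have y: "K * y = y" "y * coord {0} = y" "norm y = 1"
        using False by (simp_all add: y_def projD(3)[OF K(1)] mult.assoc x)
      have "inner (F * (K * x)) (K * x) = inner (F * x) x"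
      proof -
        have "F * (K * x) = F * x" by (simp add: mult.assoc[symmetric] FK)
        moreover have "inner (F * x) (K * x) = inner (K * (F * x)) x"
          by (simp add: inner_mult_l projD(1)[OF K(1)])
        ultimately show ?thesis by (simp add: mult.assoc[symmetric] K(2))
      qed
      moreover have "K * x = norm (K * x) *\<^sub>R y" using False by (simp add: y_def)
      then have "inner (F * (K * x)) (K * x) = (norm (K * x))\<^sup>2 * inner (F * y) y"
        by (metis inner_scaleR_left inner_scaleR_right mult.assoc mult_scaleR_right power2_eq_square)
      ultimately have "inner (F * x) x = (norm (K * x))\<^sup>2 * inner (F * y) y" by (simp only:)
      then have "\<bar>inner (F * x) x\<bar> = (norm (K * x))\<^sup>2 * \<bar>inner (F * y) y\<bar>" by (simp only: abs_mult abs_power2)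
      also have "\<dots> \<le> (norm x)\<^sup>2 * (a + s / 2)"
        by (intro mult_mono unit[OF y] power_mono proj_norm_le K) auto
      finally show ?thesis by (simp add: mult.commute)
    qed
    then show ?thesis using a s0 by (simp add: valid_def)
  qed
  then have "s \<le> a + s / 2" unfolding s_def by (intro cInf_lower bd) simp
  then have s2a: "s \<le> 2 * a" by simp
  \<comment> \<open>Multiplication by \<open>e j\<close> extracts column \<open>j\<close> as a
    column vector; the bound for vectors is then summed over columns.\<close>
  define e where "e j = fm (Suc j) 1 (\<lambda>b c. if b = j then 1 else 0)" for j
  have ent_e: "ent (A * e j) i c = (if c = 0 then ent A i j else 0)" for A i j c
  proof -
    have b: "bnd (e j) (Suc j)" unfolding e_def by (rule bnd_fm) auto
    have "(\<Sum>l<Suc j. ent A i l * ent (e j) l c) = (\<Sum>l<Suc j. if l = j then (if c = 0 then ent A i j else 0) else 0)"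
      by (intro sum.cong refl) (auto simp: e_def)
    also have "\<dots> = (if c = 0 then ent A i j else 0)" by (subst sum.delta) auto
    finally show ?thesis unfolding ent_times'[OF b] .
  qed
  have cols: "(norm A)\<^sup>2 = (\<Sum>j<N. (norm (A * e j))\<^sup>2)" if "bnd A N" for A N
  proof -
    have "(norm (A * e j))\<^sup>2 = (\<Sum>i<N. (ent A i j)\<^sup>2)" for j
    proof -
      have b: "bnd (A * e j) (Suc N)" using that by (auto simp: bnd_def ent_e)
      have "(norm (A * e j))\<^sup>2 = (\<Sum>i<Suc N. \<Sum>c<Suc N. if c = 0 then (ent A i j)\<^sup>2 else 0)"
        unfolding norm_fmat_sq[OF b] by (intro sum.cong refl) (auto simp: ent_e)
      also have "\<dots> = (\<Sum>i<Suc N. (ent A i j)\<^sup>2)" by (intro sum.cong refl) (subst sum.delta, auto)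
      also have "\<dots> = (\<Sum>i<N. (ent A i j)\<^sup>2)" using that by (simp add: bnd_def)
      finally show ?thesis .
    qed
    then show ?thesis unfolding norm_fmat_sq[OF that] by (simp only:) (rule sum.swap)
  qed
  have "norm (F * A) \<le> s * norm A" for A
  proof -
    obtain N where N: "bnd F N" "bnd A N" by (rule bnd_ex2)
    have col: "norm (F * (A * e j)) \<le> s * norm (A * e j)" for j
    proof (cases "F * (A * e j) = 0")
      case False
      have c0: "A * e j * coord {0} = A * e j" by (rule fmat_eqI) (simp add: ent_coord_r ent_e)
      have "norm (F * (A * e j)) * norm (F * (A * e j)) = \<bar>inner (F * (A * e j)) (F * (A * e j))\<bar>"
        by (simp add: power2_norm_eq_inner[symmetric] power2_eq_square[symmetric])
      also have "\<dots> \<le> s * norm (A * e j) * norm (F * (A * e j))"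
        by (rule pol2) (simp_all add: mult.assoc c0[unfolded mult.assoc])
      finally show ?thesis using False by (simp add: mult_right_le_imp_le)
    qed (use s0 in simp)
    have "(norm (F * A))\<^sup>2 = (\<Sum>j<N. (norm (F * (A * e j)))\<^sup>2)"
      unfolding cols[OF bnd_times[OF N]] by (simp add: mult.assoc)
    also have "\<dots> \<le> (\<Sum>j<N. (s * norm (A * e j))\<^sup>2)" by (intro sum_mono power_mono col) auto
    also have "\<dots> = (s * norm A)\<^sup>2" by (simp add: power_mult_distrib sum_distrib_left[symmetric] cols[OF N(2)])
    finally show ?thesis by (rule power2_le_imp_le) (use s0 in simp)
  qed
  then show ?thesis using s2a a unfolding opb_def
    by (meson mult_right_mono norm_ge_zero order_trans mult_nonneg_nonneg zero_le_numeral)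
qed

text \<open>Integer coordinates of a lattice of mesh \<open>1 / (4 * sqrt c)\<close> with
  \<open>c = card S\<close>. Rounding \<open>c\<close> coordinates moves a vector by at most
  \<open>1/4\<close>, and a unit vector has l1-norm at most \<open>sqrt c\<close>, which becomes
  \<open>4 * c\<close> in units of the mesh.\<close>

definition netz :: "nat set \<Rightarrow> (nat \<Rightarrow> int) set" where
  "netz S = {z \<in> PiE S (\<lambda>_. {- int (4 * card S)..int (4 * card S)}). (\<Sum>i\<in>S. \<bar>z i\<bar>) \<le> int (4 * card S)}"

definition uvec :: "nat \<Rightarrow> nat set \<Rightarrow> (nat \<Rightarrow> int) \<Rightarrow> fmat" where
  "uvec d S z = fm d 1 (\<lambda>i _. if i \<in> S then real_of_int (z i) / (4 * sqrt (real (card S))) else 0)"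

text \<open>Points outside the unit ball are discarded so that every \<open>u * tp u\<close> has
  norm at most one, as \<open>psi_bound\<close> requires. Rounding towards zero never leaves the
  ball.\<close>

definition net :: "nat \<Rightarrow> nat set \<Rightarrow> fmat set" where
  "net d S = {u \<in> uvec d S ` netz S. norm u \<le> 1}"

lemma finite_netz: "finite S \<Longrightarrow> finite (netz S)"
  unfolding netz_def by (rule finite_subset[OF _ finite_PiE[of S "\<lambda>_. {- int (4 * card S)..int (4 * card S)}"]]) auto

text \<open>Each lattice point in the l1-ball of radius \<open>4 * card S\<close> has exponential weight at least one.\<close>
lemma card_netz: assumes S: "finite S" shows "real (card (netz S)) \<le> exp (6 * real (card S))"
proof -
  define c where "c = card S"
  define R where "R = {- int (4 * c)..int (4 * c)}"
  have "real (card (netz S)) = (\<Sum>z\<in>netz S. 1)" by simp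
  also have "\<dots> \<le> (\<Sum>z\<in>netz S. exp (4 * real c) * (\<Prod>i\<in>S. exp (- real_of_int \<bar>z i\<bar>)))"
  proof (rule sum_mono)
    fix z assume "z \<in> netz S"
    then have "(\<Sum>i\<in>S. \<bar>z i\<bar>) \<le> int (4 * c)" by (simp add: netz_def c_def)
    then have "real_of_int (\<Sum>i\<in>S. \<bar>z i\<bar>) \<le> real_of_int (int (4 * c))" by (simp only: of_int_le_iff)
    then have "(\<Sum>i\<in>S. real_of_int \<bar>z i\<bar>) \<le> 4 * real c" by simp
    then have "exp 0 \<le> exp (4 * real c - (\<Sum>i\<in>S. real_of_int \<bar>z i\<bar>))" by (simp only: exp_le_cancel_iff)
    also have "\<dots> = exp (4 * real c) * (\<Prod>i\<in>S. exp (- real_of_int \<bar>z i\<bar>))"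
      unfolding exp_sum[OF S, symmetric] exp_add[symmetric] by (simp add: sum_negf)
    finally show "1 \<le> exp (4 * real c) * (\<Prod>i\<in>S. exp (- real_of_int \<bar>z i\<bar>))" by simp
  qed
  also have "\<dots> \<le> (\<Sum>z\<in>PiE S (\<lambda>_. R). exp (4 * real c) * (\<Prod>i\<in>S. exp (- real_of_int \<bar>z i\<bar>)))"
    using S by (intro sum_mono2 finite_PiE) (auto simp: netz_def R_def c_def intro!: mult_nonneg_nonneg prod_nonneg)
  also have "\<dots> = exp (4 * real c) * (\<Prod>i\<in>S. \<Sum>j\<in>R. exp (- real_of_int \<bar>j\<bar>))"
    by (subst prod_sum_PiE[OF S]) (auto simp: R_def sum_distrib_left)
  also have "\<dots> \<le> exp (4 * real c) * (\<Prod>i\<in>S. exp 2)"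
  proof (intro mult_left_mono prod_mono conjI)
    \<comment> \<open>Summing the two signs separately counts zero twice, and each coordinate
      contributes at most \<open>4 \<le> exp 2\<close>. With the prefactor
      \<open>exp (4 * c)\<close> this gives the exponent 6.\<close>
    have "R \<subseteq> int ` {..4 * c} \<union> (\<lambda>j. - int j) ` {..4 * c}"
    proof
      fix j assume j: "j \<in> R"
      show "j \<in> int ` {..4 * c} \<union> (\<lambda>j. - int j) ` {..4 * c}"
      proof (cases "j \<ge> 0")
        case True then show ?thesis using j by (auto simp: R_def intro!: image_eqI[of _ _ "nat j"])
      next
        case False then show ?thesis using j by (auto simp: R_def intro!: image_eqI[of _ _ "nat (- j)"])
      qed
    qed
    then have "(\<Sum>j\<in>R. exp (- real_of_int \<bar>j\<bar>)) \<le> (\<Sum>j\<in>int ` {..4 * c} \<union> (\<lambda>j. - int j) ` {..4 * c}. exp (- real_of_int \<bar>j\<bar>))"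
      by (intro sum_mono2) auto
    also have "\<dots> \<le> (\<Sum>j\<in>int ` {..4 * c}. exp (- real_of_int \<bar>j\<bar>)) + (\<Sum>j\<in>(\<lambda>j. - int j) ` {..4 * c}. exp (- real_of_int \<bar>j\<bar>))"
      by (subst sum_Un) (auto intro: sum_nonneg)
    also have "\<dots> = (\<Sum>j\<le>4 * c. exp (- real j)) + (\<Sum>j\<le>4 * c. exp (- real j))"
      by (simp add: sum.reindex inj_on_def)
    also have "\<dots> \<le> 2 * 2" using sum_exp_neg_le[of "4 * c"] by simp
    also have "\<dots> \<le> exp 1 * exp (1::real)"
      using exp_ge_add_one_self[of "1::real"] by (intro mult_mono) auto
    also have "\<dots> = exp (2::real)" by (simp add: exp_add[symmetric])
    finally show "(\<Sum>j\<in>R. exp (- real_of_int \<bar>j\<bar>)) \<le> exp (2::real)" .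
  qed (auto intro: sum_nonneg)
  also have "\<dots> = exp (6 * real c)" by (simp add: c_def exp_of_nat_mult[symmetric] exp_add[symmetric])
  finally show ?thesis by (simp add: c_def)
qed

lemma net_card: "finite S \<Longrightarrow> finite (net d S)" "finite S \<Longrightarrow> real (card (net d S)) \<le> exp (6 * real (card S))"
proof -
  assume S: "finite S"
  have sub: "net d S \<subseteq> uvec d S ` netz S" by (auto simp: net_def)
  show "finite (net d S)" by (rule finite_subset[OF sub]) (simp add: finite_netz S)
  have "card (net d S) \<le> card (netz S)"
    using card_mono[OF _ sub] card_image_le[OF finite_netz[OF S], of "uvec d S"] finite_netz[OF S] by (meson finite_imageI le_trans)
  then show "real (card (net d S)) \<le> exp (6 * real (card S))" using card_netz[OF S] by linarith
qed

lemma net_props: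
  assumes "u \<in> net d S"
  shows "norm u \<le> 1" "u * coord {0} = u" "finite S \<Longrightarrow> coord S * u = u"
    "tp (u * tp u) = u * tp u" "bnd (u * tp u) d" "norm (u * tp u) \<le> 1"
proof -
  obtain z where z: "u = uvec d S z" using assms by (auto simp: net_def)
  show n: "norm u \<le> 1" using assms by (simp add: net_def)
  show "u * coord {0} = u" unfolding z by (rule fmat_eqI) (auto simp: ent_coord_r uvec_def)
  show "finite S \<Longrightarrow> coord S * u = u" unfolding z by (rule fmat_eqI) (auto simp: ent_coord_l uvec_def)
  show "tp (u * tp u) = u * tp u" by simp
  obtain N where N: "bnd u N" using bnd_ex by blast
  show "bnd (u * tp u) d" unfolding bnd_def ent_times[OF N] by (auto simp: z uvec_def)
  show "norm (u * tp u) \<le> 1"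
    using norm_mult_fmat[of u "tp u"] mult_mono[OF n n] by simp
qed

lemma net_cover:
  assumes S: "S \<subseteq> {..<d}" and x: "coord S * x = x" "x * coord {0} = x" "norm x = 1"
  shows "\<exists>u\<in>net d S. norm (x - u) \<le> 1 / 4"
proof -
  define c where "c = card S"
  have fS: "finite S" using S finite_subset by blast
  define y where "y i = ent x i 0" for i
  have ex: "ent x i j = (if i \<in> S \<and> j = 0 then y i else 0)" for i j
    using arg_cong[OF x(1), of "\<lambda>z. ent z i j"] arg_cong[OF x(2), of "\<lambda>z. ent z i j"] fS
    by (auto simp: ent_coord_l ent_coord_r y_def split: if_splits)
  have nrm: "(norm v)\<^sup>2 = (\<Sum>i\<in>S. (w i)\<^sup>2)" if "\<And>i j. ent v i j = (if i \<in> S \<and> j = 0 then w i else 0)" for v w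
  proof -
    have b: "bnd v (Suc d)" using S by (auto simp: bnd_def that)
    have "(norm v)\<^sup>2 = (\<Sum>i<Suc d. \<Sum>j<Suc d. if j = 0 then (if i \<in> S then (w i)\<^sup>2 else 0) else 0)"
      unfolding norm_fmat_sq[OF b] by (intro sum.cong refl) (auto simp: that)
    also have "\<dots> = (\<Sum>i<Suc d. if i \<in> S then (w i)\<^sup>2 else 0)" by (intro sum.cong refl) (subst sum.delta, auto)
    also have "\<dots> = (\<Sum>i\<in>S. (w i)\<^sup>2)"
      using S by (intro sum.mono_neutral_cong_right) auto
    finally show ?thesis .
  qed
  have y1: "(\<Sum>i\<in>S. (y i)\<^sup>2) = 1" using nrm[OF ex] x(3) by simp
  then have "S \<noteq> {}" by auto
  then have c: "c > 0" using fS by (simp add: c_def card_gt_0_iff)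
  define q where "q = 4 * sqrt (real c)"
  have q: "q > 0" "q\<^sup>2 = 16 * real c" using c by (auto simp: q_def power_mult_distrib)
  define z where "z = (\<lambda>i\<in>S. if y i \<ge> 0 then \<lfloor>q * y i\<rfloor> else - \<lfloor>q * - y i\<rfloor>)"
  have z: "\<bar>real_of_int (z i)\<bar> \<le> q * \<bar>y i\<bar>" "\<bar>q * y i - real_of_int (z i)\<bar> \<le> 1" if "i \<in> S" for i
  proof -
    have "0 \<le> q * y i" if "y i \<ge> 0" using q that by simp
    moreover have "0 \<le> q * - y i" if "\<not> y i \<ge> 0" using q that by (intro mult_nonneg_nonneg) auto
    ultimately have f: "y i \<ge> 0 \<Longrightarrow> 0 \<le> \<lfloor>q * y i\<rfloor>" "\<not> y i \<ge> 0 \<Longrightarrow> 0 \<le> \<lfloor>q * - y i\<rfloor>" by auto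
    have "\<bar>real_of_int (z i)\<bar> \<le> q * \<bar>y i\<bar> \<and> \<bar>q * y i - real_of_int (z i)\<bar> \<le> 1"
    proof (cases "y i \<ge> 0")
      case True
      then show ?thesis using that f(1) of_int_floor_le[of "q * y i"] floor_correct[of "q * y i"] by (simp add: z_def) linarith
    next
      case False
      then show ?thesis using that f(2) of_int_floor_le[of "q * - y i"] floor_correct[of "q * - y i"] by (simp add: z_def) linarith
    qed
    then show "\<bar>real_of_int (z i)\<bar> \<le> q * \<bar>y i\<bar>" "\<bar>q * y i - real_of_int (z i)\<bar> \<le> 1" by auto
  qed
  define u where "u = uvec d S z"
  have eu: "ent u i j = (if i \<in> S \<and> j = 0 then real_of_int (z i) / q else 0)" for i j
    using S by (auto simp: u_def uvec_def q_def c_def)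
  have "(\<Sum>i\<in>S. \<bar>y i\<bar>) \<le> sqrt (real c)"
  proof -
    have "(\<Sum>i\<in>S. \<bar>y i\<bar> * 1)\<^sup>2 \<le> (\<Sum>i\<in>S. \<bar>y i\<bar>\<^sup>2) * (\<Sum>i\<in>S. 1\<^sup>2)" by (rule Cauchy_Schwarz_ineq_sum)
    then have "(\<Sum>i\<in>S. \<bar>y i\<bar>)\<^sup>2 \<le> real c" using y1 by (simp add: c_def)
    then show ?thesis by (rule real_le_rsqrt)
  qed
  then have "q * (\<Sum>i\<in>S. \<bar>y i\<bar>) \<le> q * sqrt (real c)" using q by (intro mult_left_mono) auto
  also have "\<dots> = 4 * real c" by (simp add: q_def)
  finally have l1: "q * (\<Sum>i\<in>S. \<bar>y i\<bar>) \<le> 4 * real c" .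
  have "(\<Sum>i\<in>S. \<bar>real_of_int (z i)\<bar>) \<le> (\<Sum>i\<in>S. q * \<bar>y i\<bar>)" by (intro sum_mono z)
  then have "(\<Sum>i\<in>S. \<bar>real_of_int (z i)\<bar>) \<le> 4 * real c" using l1 by (simp add: sum_distrib_left)
  then have "real_of_int (\<Sum>i\<in>S. \<bar>z i\<bar>) \<le> real_of_int (int (4 * c))" by simp
  then have zs: "(\<Sum>i\<in>S. \<bar>z i\<bar>) \<le> int (4 * c)" by (simp only: of_int_le_iff)
  have "\<bar>z i\<bar> \<le> int (4 * c)" if "i \<in> S" for i
  proof -
    have "\<bar>z i\<bar> \<le> (\<Sum>i\<in>S. \<bar>z i\<bar>)" by (rule member_le_sum[where f = "\<lambda>i. \<bar>z i\<bar>"]) (use that fS in auto)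
    then show ?thesis using zs by simp
  qed
  then have "z i \<in> {- int (4 * c)..int (4 * c)}" if "i \<in> S" for i
    using that unfolding abs_le_iff atLeastAtMost_iff by (meson minus_le_iff)
  then have "z \<in> S \<rightarrow> {- int (4 * c)..int (4 * c)}" by (intro Pi_I)
  moreover have "z \<in> extensional S" by (simp add: z_def)
  ultimately have "z \<in> netz S" unfolding netz_def c_def[symmetric] PiE_def using zs by blast
  moreover have "norm u \<le> 1"
  proof -
    have "(norm u)\<^sup>2 = (\<Sum>i\<in>S. (real_of_int (z i) / q)\<^sup>2)" by (rule nrm[OF eu])
    also have "\<dots> \<le> (\<Sum>i\<in>S. (y i)\<^sup>2)"
    proof (rule sum_mono)
      fix i assume "i \<in> S"
      then have "\<bar>real_of_int (z i) / q\<bar> \<le> \<bar>y i\<bar>" using z(1) q by (simp add: divide_le_eq mult.commute)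
      then show "(real_of_int (z i) / q)\<^sup>2 \<le> (y i)\<^sup>2" by (simp only: abs_le_square_iff)
    qed
    finally have "(norm u)\<^sup>2 \<le> 1\<^sup>2" using y1 by simp
    then show ?thesis by (rule power2_le_imp_le) simp
  qed
  ultimately have un: "u \<in> net d S" by (auto simp: net_def u_def)
  have "norm (x - u) \<le> 1 / 4"
  proof -
    have "(norm (x - u))\<^sup>2 = (\<Sum>i\<in>S. (y i - real_of_int (z i) / q)\<^sup>2)"
      by (rule nrm) (simp add: ex eu)
    also have "\<dots> \<le> (\<Sum>i\<in>S. (1 / q)\<^sup>2)"
    proof (rule sum_mono)
      fix i assume i: "i \<in> S"
      have "\<bar>y i - real_of_int (z i) / q\<bar> = \<bar>q * y i - real_of_int (z i)\<bar> / q"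
      proof -
        have "y i - real_of_int (z i) / q = (q * y i - real_of_int (z i)) / q" using q(1) by (simp add: field_simps)
        then show ?thesis using q(1) by simp
      qed
      also have "\<dots> \<le> 1 / q" using z(2)[OF i] q by (intro divide_right_mono) auto
      finally have "\<bar>y i - real_of_int (z i) / q\<bar> \<le> \<bar>1 / q\<bar>" using q by simp
      then show "(y i - real_of_int (z i) / q)\<^sup>2 \<le> (1 / q)\<^sup>2" by (simp only: abs_le_square_iff)
    qed
    also have "\<dots> = (1 / 4)\<^sup>2" using q c by (simp add: power_divide c_def[symmetric])
    finally show ?thesis by (rule power2_le_imp_le) simp
  qed
  then show ?thesis using un by blast
qed

text \<open>On vectors carried by \<open>S\<close> the quadratic form of the compression is the
  inner product with \<open>u * tp u\<close>, a fixed direction for which exponential moments are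
  known.\<close>

lemma opb_gram:
  assumes E: "tp E = E" and S: "S \<subseteq> {..<d}" and a: "0 \<le> a" "\<And>u. u \<in> net d S \<Longrightarrow> \<bar>inner E (u * tp u)\<bar> \<le> a"
  shows "opb (coord S * E * coord S) (2 * a)"
proof -
  let ?K = "coord S"
  have fS: "finite S" using S finite_subset by blast
  have K: "proj ?K" using fS by simp
  show ?thesis
  proof (rule opb_of_net[where K = ?K])
    show "tp (?K * E * ?K) = ?K * E * ?K" by (simp add: E mult.assoc)
    show "?K * (?K * E * ?K) = ?K * E * ?K" by (simp add: mult.assoc projD[OF K])
    fix x assume x: "?K * x = x" "x * coord {0} = x" "norm x = 1"
    obtain u where u: "u \<in> net d S" "norm (x - u) \<le> 1 / 4" using net_cover[OF S x] by blast
    have Ku: "?K * u = u" by (rule net_props(3)[OF u(1) fS])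
    have "inner (?K * E * ?K * u) u = inner E (u * tp u)"
    proof -
      have "inner (?K * E * ?K * u) u = inner (?K * (E * u)) u" by (simp add: mult.assoc Ku)
      also have "\<dots> = inner (E * u) u" by (simp add: inner_mult_l Ku)
      also have "\<dots> = inner E (u * tp u)" by (simp add: inner_mult_r)
      finally show ?thesis .
    qed
    then show "\<exists>u. u * coord {0} = u \<and> norm (x - u) \<le> 1 / 4 \<and> norm u \<le> 1 \<and> \<bar>inner (?K * E * ?K * u) u\<bar> \<le> a"
      using u net_props[OF u(1)] a(2)[OF u(1)] by (intro exI[of _ u]) simp
  qed (use K a in auto)
qed

section \<open>Eigenvalue ties\<close>

text \<open>A selection of subgradients is monotone, so it has countably many discontinuities. A gap
  between right and left difference quotients is such a discontinuity. Steps
  \<open>1 / (j + 1)\<close> keep the condition countable.\<close>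

lemma countable_kinks:
  fixes F m :: "real \<Rightarrow> real"
  assumes sub: "\<And>y y'. F y + m y * (y' - y) \<le> F y'" and q: "q1 < q2"
  shows "countable {y. \<forall>j::nat. q2 \<le> (real j + 1) * (F (y + 1 / (real j + 1)) - F y)
    \<and> (real j + 1) * (F y - F (y - 1 / (real j + 1))) \<le> q1}" (is "countable ?K")
proof -
  have "mono m"
  proof (rule monoI)
    fix x y :: real assume "x \<le> y"
    show "m x \<le> m y"
    proof (cases "x = y")
      case False
      have "m x * (y - x) \<le> m y * (y - x)" using sub[of x y] sub[of y x] by (simp add: algebra_simps)
      then show ?thesis using False \<open>x \<le> y\<close> by (simp add: mult_right_le_imp_le)
    qed simp
  qed
  then have "countable {y. \<not> isCont m y}" by (rule mono_ctble_discont)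
  moreover have "?K \<subseteq> {y. \<not> isCont m y}"
  proof (safe)
    fix y assume K: "\<forall>j::nat. q2 \<le> (real j + 1) * (F (y + 1 / (real j + 1)) - F y)
      \<and> (real j + 1) * (F y - F (y - 1 / (real j + 1))) \<le> q1" and c: "isCont m y"
    have l: "(\<lambda>j. 1 / (real j + 1)) \<longlonglongrightarrow> 0"
      using LIMSEQ_inverse_real_of_nat by (simp add: inverse_eq_divide add.commute)
    have "q2 \<le> m (y + 1 / (real j + 1))" for j
    proof -
      have "F (y + 1 / (real j + 1)) + m (y + 1 / (real j + 1)) * (- (1 / (real j + 1))) \<le> F y"
        using sub[of "y + 1 / (real j + 1)" y] by simp
      then have "(F (y + 1 / (real j + 1)) - F y) \<le> m (y + 1 / (real j + 1)) / (real j + 1)" by simp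
      then have "(real j + 1) * (F (y + 1 / (real j + 1)) - F y) \<le> m (y + 1 / (real j + 1))"
        by (simp add: pos_le_divide_eq mult.commute)
      then show ?thesis using K by (meson order_trans)
    qed
    moreover have "(\<lambda>j. m (y + 1 / (real j + 1))) \<longlonglongrightarrow> m y"
      using tendsto_add[OF tendsto_const l, of y] by (intro isCont_tendsto_compose[OF c]) simp
    ultimately have u: "q2 \<le> m y" by (intro LIMSEQ_le_const) auto
    have "m (y - 1 / (real j + 1)) \<le> q1" for j
    proof -
      have "F (y - 1 / (real j + 1)) + m (y - 1 / (real j + 1)) * (1 / (real j + 1)) \<le> F y"
        using sub[of "y - 1 / (real j + 1)" y] by simp
      then have "m (y - 1 / (real j + 1)) / (real j + 1) \<le> F y - F (y - 1 / (real j + 1))" by simp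
      then have "m (y - 1 / (real j + 1)) \<le> (real j + 1) * (F y - F (y - 1 / (real j + 1)))"
        by (simp add: pos_divide_le_eq mult.commute)
      then show ?thesis using K by (meson order_trans)
    qed
    moreover have "(\<lambda>j. m (y - 1 / (real j + 1))) \<longlonglongrightarrow> m y"
      using tendsto_diff[OF tendsto_const l, of y] by (intro isCont_tendsto_compose[OF c]) simp
    ultimately have "m y \<le> q1" by (intro LIMSEQ_le_const2) auto
    then show False using u q by simp
  qed
  ultimately show ?thesis by (rule countable_subset[rotated])
qed

lemma emeasure_std_normal_countable: "countable C \<Longrightarrow> emeasure std_normal_distribution C = 0"
proof -
  assume "countable C"
  then have "C \<in> null_sets lborel" by (rule countable_imp_null_set_lborel)
  then have "C \<in> null_sets std_normal_distribution"
    by (subst null_sets_density_iff) (auto dest: AE_not_in intro: AE_mp)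
  then show ?thesis by auto
qed

text \<open>Rational cuts make the exceptional set measurable, so that countable sections suffice.\<close>
lemma AE_unique_subgradient:
  fixes f :: "('i \<Rightarrow> real) \<Rightarrow> real"
  assumes I: "finite I" "i \<in> I" and f: "f \<in> borel_measurable (gauss I)"
    and sub: "\<And>g y y'. f (g(i := y)) + m (g(i := y)) * (y' - y) \<le> f (g(i := y'))"
  shows "AE g in gauss I. \<forall>a b. (\<forall>y. f g + a * (y - g i) \<le> f (g(i := y))) \<longrightarrow>
    (\<forall>y. f g + b * (y - g i) \<le> f (g(i := y))) \<longrightarrow> a = b"
proof -
  define Bad where "Bad q1 q2 = {g \<in> space (gauss I). \<forall>j::nat.
      q2 \<le> (real j + 1) * (f (g(i := g i + 1 / (real j + 1))) - f g)
    \<and> (real j + 1) * (f g - f (g(i := g i - 1 / (real j + 1)))) \<le> q1}" for q1 q2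
  have shift: "(\<lambda>g. f (g(i := g i + c))) \<in> borel_measurable (gauss I)" for c
  proof (rule measurable_compose[OF _ f])
    show "(\<lambda>g. g(i := g i + c)) \<in> measurable (gauss I) (gauss I)"
    proof (rule measurable_fun_upd[where J = I])
      show "I = I \<union> {i}" using I by auto
      show "(\<lambda>g. g i + c) \<in> measurable (gauss I) std_normal_distribution"
      proof -
        have "(\<lambda>g. g i + c) \<in> borel_measurable (gauss I)" using I by (intro borel_measurable_add) auto
        then show ?thesis by (simp cong: measurable_cong_sets)
      qed
    qed simp
  qed
  have shift': "(\<lambda>g. f (g(i := g i - c))) \<in> borel_measurable (gauss I)" for c
    using shift[of "- c"] by simp
  have Bm: "Bad q1 q2 \<in> sets (gauss I)" for q1 q2
    unfolding Bad_def using f shift shift' by measurable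
  have null: "emeasure (gauss I) (Bad q1 q2) = 0" if q: "q1 < q2" for q1 q2
  proof -
    have Ii: "insert i (I - {i}) = I" using I by auto
    have "emeasure (gauss I) (Bad q1 q2) = (\<integral>\<^sup>+g. indicator (Bad q1 q2) g \<partial>gauss I)"
      using Bm by simp
    also have "\<dots> = (\<integral>\<^sup>+x. (\<integral>\<^sup>+y. indicator (Bad q1 q2) (x(i := y)) \<partial>std_normal_distribution) \<partial>gauss (I - {i}))"
      using ps.product_nn_integral_insert[of "I - {i}" i "indicator (Bad q1 q2)"] I Bm unfolding Ii by simp
    also have "\<dots> = (\<integral>\<^sup>+x. 0 \<partial>gauss (I - {i}))"
    proof (rule nn_integral_cong)
      fix x
      define F where "F y = f (x(i := y))" for y
      define C where "C = {y. \<forall>j::nat. q2 \<le> (real j + 1) * (F (y + 1 / (real j + 1)) - F y)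
        \<and> (real j + 1) * (F y - F (y - 1 / (real j + 1))) \<le> q1}"
      have cC: "countable C" unfolding C_def
        by (rule countable_kinks[where m = "\<lambda>y. m (x(i := y))"]) (use sub q in \<open>auto simp: F_def\<close>)
      have "(\<integral>\<^sup>+y. indicator (Bad q1 q2) (x(i := y)) \<partial>std_normal_distribution) \<le> (\<integral>\<^sup>+y. indicator C y \<partial>std_normal_distribution)"
        by (intro nn_integral_mono) (auto simp: indicator_def Bad_def C_def F_def)
      also have "\<dots> = 0"
        using emeasure_std_normal_countable[OF cC] null_setsD2[OF countable_imp_null_set_lborel[OF cC]]
        by (subst nn_integral_indicator) auto
      finally show "(\<integral>\<^sup>+y. indicator (Bad q1 q2) (x(i := y)) \<partial>std_normal_distribution) = 0" by simp
    qed
    finally show ?thesis by simp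
  qed
  have "AE g in gauss I. \<forall>q::rat \<times> rat. fst q < snd q \<longrightarrow> g \<notin> Bad (real_of_rat (fst q)) (real_of_rat (snd q))"
  proof (subst AE_all_countable, rule allI)
    fix q :: "rat \<times> rat"
    show "AE g in gauss I. fst q < snd q \<longrightarrow> g \<notin> Bad (real_of_rat (fst q)) (real_of_rat (snd q))"
    proof (cases "fst q < snd q")
      case True
      then have "Bad (real_of_rat (fst q)) (real_of_rat (snd q)) \<in> null_sets (gauss I)"
        using null Bm by (auto simp: of_rat_less)
      then show ?thesis by (auto dest: AE_not_in)
    qed simp
  qed
  then show ?thesis
  proof (rule AE_mp, intro AE_I2 impI allI)
    fix g a b
    assume g: "g \<in> space (gauss I)"
      and nb: "\<forall>q::rat \<times> rat. fst q < snd q \<longrightarrow> g \<notin> Bad (real_of_rat (fst q)) (real_of_rat (snd q))"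
      and a: "\<forall>y. f g + a * (y - g i) \<le> f (g(i := y))" and b: "\<forall>y. f g + b * (y - g i) \<le> f (g(i := y))"
    have "\<not> c < e" if c: "\<forall>y. f g + c * (y - g i) \<le> f (g(i := y))" and e: "\<forall>y. f g + e * (y - g i) \<le> f (g(i := y))" for c e
    proof
      assume "c < e"
      \<comment> \<open>Two rationals strictly between the slopes separate the right from the left
        difference quotients, which puts \<open>g\<close> into one of countably many null
        sets.\<close>
      then obtain q1 where q1: "c < real_of_rat q1" "real_of_rat q1 < e" using of_rat_dense by blast
      then obtain q2 where q2: "real_of_rat q1 < real_of_rat q2" "real_of_rat q2 < e" using of_rat_dense by blast
      have "g \<in> Bad (real_of_rat q1) (real_of_rat q2)"
        unfolding Bad_def
      proof (intro CollectI conjI allI g)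
        fix j :: nat
        have "f g + e * (1 / (real j + 1)) \<le> f (g(i := g i + 1 / (real j + 1)))"
          using e[rule_format, of "g i + 1 / (real j + 1)"] by simp
        then have "e / (real j + 1) \<le> f (g(i := g i + 1 / (real j + 1))) - f g" by simp
        then have "e \<le> (real j + 1) * (f (g(i := g i + 1 / (real j + 1))) - f g)"
          by (simp add: pos_divide_le_eq mult.commute)
        then show "real_of_rat q2 \<le> (real j + 1) * (f (g(i := g i + 1 / (real j + 1))) - f g)" using q2 by simp
        have "f g - c * (1 / (real j + 1)) \<le> f (g(i := g i - 1 / (real j + 1)))"
          using c[rule_format, of "g i - 1 / (real j + 1)"] by simp
        then have "f g - f (g(i := g i - 1 / (real j + 1))) \<le> c / (real j + 1)" by simp
        then have "(real j + 1) * (f g - f (g(i := g i - 1 / (real j + 1)))) \<le> c"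
          by (simp add: pos_le_divide_eq mult.commute)
        then show "(real j + 1) * (f g - f (g(i := g i - 1 / (real j + 1)))) \<le> real_of_rat q1" using q1 by simp
      qed
      then show False using nb[rule_format, of "(q1, q2)"] q2 by (simp add: of_rat_less)
    qed
    from this[OF a b] this[OF b a] show "a = b" by simp
  qed
qed

text \<open>Continuity refers to the full function space, whereas points of the product space are
  constant outside \<open>I\<close>. Those coordinates are trivially measurable, and countably many
  coordinates generate the Borel sets.\<close>

lemma gauss_measurable_continuous:
  fixes f :: "('i::countable \<Rightarrow> real) \<Rightarrow> real"
  assumes "continuous_on UNIV f"
  shows "f \<in> borel_measurable (gauss I)"
proof -
  have "(\<lambda>g. g) \<in> borel_measurable (gauss I)"
  proof (rule measurable_coordinatewise_then_product)
    fix i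
    show "(\<lambda>g. g i) \<in> borel_measurable (gauss I)"
    proof (cases "i \<in> I")
      case False
      then have "g i = undefined" if "g \<in> space (gauss I)" for g :: "'i \<Rightarrow> real"
        using that by (auto simp: space_PiM PiE_def extensional_def)
      then have "(\<lambda>g. g i) \<in> borel_measurable (gauss I) \<longleftrightarrow> (\<lambda>g. undefined :: real) \<in> borel_measurable (gauss I)"
        by (rule measurable_cong)
      then show ?thesis by simp
    qed auto
  qed
  then show ?thesis
    by (rule measurable_compose) (rule borel_measurable_continuous_onI[OF assms])
qed

lemma leading_eigvecs_cong:
  assumes "\<And>i j. i < p \<Longrightarrow> j < p \<Longrightarrow> M i j = M' i j"
  shows "leading_eigvecs p r M W \<longleftrightarrow> leading_eigvecs p r M' W"
proof -
  have "(\<forall>a<p. \<forall>i<p. (\<Sum>j<p. M i j * E j a) = \<nu> a * E i a) \<longleftrightarrow> (\<forall>a<p. \<forall>i<p. (\<Sum>j<p. M' i j * E j a) = \<nu> a * E i a)" for E \<nu>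
  proof -
    have "(\<Sum>j<p. M i j * E j a) = (\<Sum>j<p. M' i j * E j a)" if "i < p" for i a
      using assms that by (intro sum.cong) auto
    then show ?thesis by auto
  qed
  then show ?thesis unfolding leading_eigvecs_def by (simp only:)
qed

section \<open>Convexity of the restricted energy\<close>

context spiked
begin

definition Sg :: "nat \<Rightarrow> nat set \<Rightarrow> (nat \<times> nat \<Rightarrow> real) \<Rightarrow> rmat" where
  "Sg n Ts g = (\<lambda>i j. (\<Sum>t\<in>Ts. Xd r V Ls g t i * Xd r V Ls g t j) / real n)"

definition Xf :: "nat \<Rightarrow> (nat \<times> nat \<Rightarrow> real) \<Rightarrow> fmat" where
  "Xf n g = fm n p (Xd r V Ls g)"

lemma Sg_Xf: "fm p p (Sg n {..<n} g) = (1 / real n) *\<^sub>R (tp (Xf n g) * Xf n g)"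
proof (rule fmat_eqI)
  fix i j
  have b: "bnd (tp (Xf n g)) (max n p)" by (simp add: Xf_def bnd_fm)
  have "(\<Sum>t<max n p. ent (Xf n g) t i * ent (Xf n g) t j)
    = (\<Sum>t<n. if i < p \<and> j < p then Xd r V Ls g t i * Xd r V Ls g t j else 0)"
    by (rule sum.mono_neutral_cong_right) (auto simp: Xf_def)
  then show "ent (fm p p (Sg n {..<n} g)) i j = ent ((1 / real n) *\<^sub>R (tp (Xf n g) * Xf n g)) i j"
    unfolding ent_simps ent_times[OF b] ent_tp by (auto simp: Sg_def)
qed

lemma restricted_energy:
  assumes "B \<subseteq> {..<p}" "n > 0"
  shows "(norm (Xf n g * coord B * A))\<^sup>2 = real n * inner A (coord B * fm p p (Sg n {..<n} g) * coord B * A)"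
proof -
  have "inner (Xf n g * coord B * A) (Xf n g * coord B * A)
     = inner A (coord B * (tp (Xf n g) * Xf n g) * coord B * A)"
    by (simp add: inner_mult_l mult.assoc)
  then show ?thesis unfolding Sg_Xf power2_norm_eq_inner using assms(2) by simp
qed

text \<open>Every choice of leading eigenvectors attains the maximum, so the maximal energy depends
  on the data alone even where the eigenvectors are ambiguous.\<close>

lemma leading_max:
  assumes B: "B \<subseteq> {..<p}" "n > 0" and W: "leading_eigvecs p r (restrict_mat B (Sg n {..<n} g)) W"
    and P: "proj P" "Ip * P = P" "(norm P)\<^sup>2 = real r"
  shows "norm (Xf n g * coord B * P) \<le> norm (Xf n g * coord B * Pj p r W)" "orthonormal_cols p r W"
proof -
  obtain E \<nu> where "eig p r (restrict_mat B (Sg n {..<n} g)) W E \<nu>" using leading_eig[OF W frame_le[OF V]] .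
  then interpret eig p r "restrict_mat B (Sg n {..<n} g)" W E \<nu> .
  have en: "(norm (Xf n g * coord B * Q))\<^sup>2 = real n * inner (fm p p (restrict_mat B (Sg n {..<n} g))) Q" if "proj Q" for Q
  proof -
    have "inner Q (coord B * fm p p (Sg n {..<n} g) * coord B * Q) = inner (coord B * fm p p (Sg n {..<n} g) * coord B * Q) Q"
      by (rule inner_commute)
    also have "\<dots> = inner (coord B * fm p p (Sg n {..<n} g) * coord B) (Q * tp Q)" by (rule inner_mult_r)
    finally show ?thesis unfolding restricted_energy[OF B] restrict_fm[OF B(1)] using projD[OF that] by simp
  qed
  show "orthonormal_cols p r W" by (rule orth_W)
  have "(norm (Xf n g * coord B * P))\<^sup>2 \<le> (norm (Xf n g * coord B * Pj p r W))\<^sup>2"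
    unfolding en[OF P(1)] en[OF proj_Pj[OF orth_W]] by (intro mult_left_mono ky_fan P) auto
  then show "norm (Xf n g * coord B * P) \<le> norm (Xf n g * coord B * Pj p r W)" by (rule power2_le_imp_le) simp
qed

text \<open>A noise coordinate moves one single entry of the data, whereas a factor coordinate moves
  a whole row; this is why derivatives along noise coordinates read off individual fitted
  values.\<close>

lemma ent_Xf_upd:
  assumes "t < n" "i < p"
  shows "Xf n (g((t, r + i) := y)) = Xf n g + (y - g (t, r + i)) *\<^sub>R fm (Suc t) (Suc i) (\<lambda>a b. if a = t \<and> b = i then 1 else 0)"
  using assms by (intro fmat_eqI) (auto simp: Xf_def Xd_def)

lemma inner_unit: "inner A (fm (Suc t) (Suc i) (\<lambda>a b. if a = t \<and> b = i then 1 else 0)) = ent A t i"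
proof -
  let ?e = "fm (Suc t) (Suc i) (\<lambda>a b. if a = t \<and> b = i then 1 else 0)"
  have b: "bnd ?e (max (Suc t) (Suc i))" by (rule bnd_fm) auto
  have "inner ?e A = (\<Sum>a<max (Suc t) (Suc i). \<Sum>b<max (Suc t) (Suc i). if b = i then (if a = t then ent A t i else 0) else 0)"
    unfolding inner_fmat_bnd[OF b] by (intro sum.cong refl) auto
  also have "\<dots> = (\<Sum>a<max (Suc t) (Suc i). if a = t then ent A t i else 0)"
    by (intro sum.cong refl) (subst sum.delta, auto)
  also have "\<dots> = ent A t i" by (subst sum.delta) auto
  finally show ?thesis by (simp add: inner_commute)
qed

text \<open>The top-\<open>r\<close> energy is a maximum of squared norms, hence has a subgradient at every maximiser.\<close>
lemma energy_subgradient: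
  assumes B: "B \<subseteq> {..<p}" "n > 0" and t: "t < n" "i \<in> B"
    and sel: "\<And>g. leading_eigvecs p r (restrict_mat B (Sg n {..<n} g)) (sel g)"
    and W: "leading_eigvecs p r (restrict_mat B (Sg n {..<n} g)) W"
  defines "f \<equiv> \<lambda>g. (norm (Xf n g * coord B * Pj p r (sel g)))\<^sup>2"
  shows "f g + 2 * ent (Xf n g * coord B * Pj p r W * coord B) t i * (y - g (t, r + i)) \<le> f (g((t, r + i) := y))"
proof -
  let ?e = "fm (Suc t) (Suc i) (\<lambda>a b. if a = t \<and> b = i then 1 else 0)" and ?J = "coord B" and ?P = "Pj p r W"
  have ip: "i < p" using B t by auto
  have fB: "finite B" using B finite_subset by blast
  have oW: "orthonormal_cols p r W" by (rule leading_max(2)[OF B W proj_Pj[OF V] coord_Pj norm_Pj[OF V]])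
  have oS: "orthonormal_cols p r (sel g)" for g by (rule leading_max(2)[OF B sel proj_Pj[OF V] coord_Pj norm_Pj[OF V]])
  have fW: "f g \<le> (norm (Xf n g * ?J * ?P))\<^sup>2" unfolding f_def
    by (intro power_mono leading_max(1)[OF B W] proj_Pj oS coord_Pj norm_Pj) auto
  define s where "s = y - g (t, r + i)"
  have "(norm (Xf n (g((t, r + i) := y)) * ?J * ?P))\<^sup>2 \<le> f (g((t, r + i) := y))"
    unfolding f_def by (intro power_mono leading_max(1)[OF B sel] proj_Pj oW coord_Pj norm_Pj) auto
  then have m1: "(norm (Xf n (g((t, r + i) := y)) * ?J * ?P))\<^sup>2 \<le> f (g((t, r + i) := y))" .
  have m2: "Xf n (g((t, r + i) := y)) * ?J * ?P = Xf n g * ?J * ?P + s *\<^sub>R (?e * ?J * ?P)"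
    unfolding ent_Xf_upd[OF t(1) ip] s_def by (simp add: distrib_right)
  have m3: "(norm (Xf n g * ?J * ?P + s *\<^sub>R (?e * ?J * ?P)))\<^sup>2
      = (norm (Xf n g * ?J * ?P))\<^sup>2 + 2 * s * inner (Xf n g * ?J * ?P) (?e * ?J * ?P) + (norm (s *\<^sub>R (?e * ?J * ?P)))\<^sup>2"
    unfolding power2_norm_eq_inner by (simp add: inner_add_left inner_add_right inner_commute)
  have m4: "inner (Xf n g * ?J * ?P) (?e * ?J * ?P) = ent (Xf n g * ?J * ?P * ?J) t i"
  proof -
    have "inner (Xf n g * ?J * ?P) (?e * ?J * ?P) = inner (?e * ?J * ?P) (Xf n g * ?J * ?P)" by (rule inner_commute)
    also have "\<dots> = inner (?e * ?J) (Xf n g * ?J * ?P * tp ?P)" by (rule inner_mult_r)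
    also have "\<dots> = inner ?e (Xf n g * ?J * ?P * tp ?P * tp ?J)" by (rule inner_mult_r)
    also have "\<dots> = inner (Xf n g * ?J * ?P * ?J) ?e"
      using projD[OF proj_Pj[OF oW]] by (simp add: mult.assoc inner_commute)
    finally show ?thesis by (simp only: inner_unit)
  qed
  have "(norm (Xf n g * ?J * ?P))\<^sup>2 + 2 * s * ent (Xf n g * ?J * ?P * ?J) t i + (norm (s *\<^sub>R (?e * ?J * ?P)))\<^sup>2
      \<le> f (g((t, r + i) := y))"
    using m1 unfolding m2 m3 m4 .
  moreover have "0 \<le> (norm (s *\<^sub>R (?e * ?J * ?P)))\<^sup>2" by (rule zero_le_power2)
  moreover have "2 * s * ent (Xf n g * ?J * ?P * ?J) t i = 2 * ent (Xf n g * ?J * ?P * ?J) t i * s"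
    by (simp only: mult_ac)
  ultimately show ?thesis using fW unfolding s_def[symmetric] by linarith
qed

text \<open>The selector is arbitrary and need not be measurable. The energy does not depend on it,
  and its root is a maximum of norms, hence Lipschitz in the data.\<close>

lemma energy_measurable:
  assumes B: "B \<subseteq> {..<p}" "n > 0"
    and sel: "\<And>g. leading_eigvecs p r (restrict_mat B (Sg n {..<n} g)) (sel g)"
  shows "(\<lambda>g. (norm (Xf n g * coord B * Pj p r (sel g)))\<^sup>2) \<in> borel_measurable (gauss I)"
proof (rule gauss_measurable_continuous, intro continuous_on_power)
  define s where "s g = norm (Xf n g * coord B * Pj p r (sel g))" for g
  have fB: "finite B" using B finite_subset by blast
  have oS: "orthonormal_cols p r (sel g)" for g by (rule leading_max(2)[OF B sel proj_Pj[OF V] coord_Pj norm_Pj[OF V]])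
  have le: "s g \<le> s h + norm (Xf n g - Xf n h)" for g h
  proof -
    have "s g = norm (Xf n h * coord B * Pj p r (sel g) + (Xf n g - Xf n h) * coord B * Pj p r (sel g))"
      by (simp add: s_def left_diff_distrib)
    also have "\<dots> \<le> norm (Xf n h * coord B * Pj p r (sel g)) + norm ((Xf n g - Xf n h) * coord B * Pj p r (sel g))"
      by (rule norm_triangle_ineq)
    also have "norm (Xf n h * coord B * Pj p r (sel g)) \<le> s h"
      unfolding s_def by (intro leading_max(1)[OF B sel] proj_Pj oS coord_Pj norm_Pj)
    also have "norm ((Xf n g - Xf n h) * coord B * Pj p r (sel g)) \<le> norm ((Xf n g - Xf n h) * coord B)"
      by (intro proj_norm_le_r proj_Pj oS)
    also have "\<dots> \<le> norm (Xf n g - Xf n h)" by (intro proj_norm_le_r proj_coord fB)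
    finally show ?thesis by simp
  qed
  have cN: "continuous_on UNIV (\<lambda>g. norm (Xf n g - Xf n h))" for h
  proof -
    have b: "bnd (Xf n g - Xf n h) (max n p)" for g by (auto simp: bnd_def Xf_def)
    have "norm (Xf n g - Xf n h) = sqrt (\<Sum>t<max n p. \<Sum>j<max n p. (if t < n \<and> j < p then Xd r V Ls g t j - Xd r V Ls h t j else 0)\<^sup>2)" for g
    proof -
      have "(norm (Xf n g - Xf n h))\<^sup>2 = (\<Sum>t<max n p. \<Sum>j<max n p. (if t < n \<and> j < p then Xd r V Ls g t j - Xd r V Ls h t j else 0)\<^sup>2)"
        unfolding norm_fmat_sq[OF b] by (intro sum.cong refl) (auto simp: Xf_def)
      then show ?thesis by (metis norm_ge_zero real_sqrt_unique)
    qed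
    moreover have "continuous_on UNIV (\<lambda>g. if t < n \<and> j < p then Xd r V Ls g t j - Xd r V Ls h t j else 0)" for t j
      unfolding Xd_def by (cases "t < n \<and> j < p") (auto intro!: continuous_intros)
    ultimately show ?thesis by (simp only:) (intro continuous_on_real_sqrt continuous_on_sum continuous_on_power)
  qed
  show "continuous_on UNIV (\<lambda>g. norm (Xf n g * coord B * Pj p r (sel g)))"
    unfolding s_def[symmetric] continuous_on_eq_continuous_at[OF open_UNIV]
  proof (rule ballI)
    fix h :: "nat \<times> nat \<Rightarrow> real"
    have "isCont (\<lambda>g. norm (Xf n g - Xf n h)) h"
      using cN[of h] by (simp add: continuous_on_eq_continuous_at)
    then have z: "((\<lambda>g. norm (Xf n g - Xf n h)) \<longlongrightarrow> 0) (at h)" unfolding isCont_def by simp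
    have "((\<lambda>g. s g - s h) \<longlongrightarrow> 0) (at h)"
    proof (rule Lim_null_comparison[OF _ z], rule eventuallyI)
      fix g show "norm (s g - s h) \<le> norm (Xf n g - Xf n h)"
        using le[of g h] le[of h g] by (simp add: abs_le_iff norm_minus_commute)
    qed
    then show "isCont s h" unfolding continuous_at by (simp add: LIM_zero_iff)
  qed
qed

text \<open>At an eigenvalue tie the estimator could depend on the second sample through the choice of
  eigenvectors; almost surely all choices give the same restricted fitted values.\<close>
lemma AE_leading_unique:
  assumes B: "B \<subseteq> {..<p}" "n > 0"
    and sel: "\<And>g. leading_eigvecs p r (restrict_mat B (Sg n {..<n} g)) (sel g)"
  shows "AE g in gauss ({..<n} \<times> {..<r + p}). \<forall>W W'.
    leading_eigvecs p r (restrict_mat B (Sg n {..<n} g)) W \<longrightarrow>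
    leading_eigvecs p r (restrict_mat B (Sg n {..<n} g)) W' \<longrightarrow>
    Xf n g * coord B * Pj p r W * coord B = Xf n g * coord B * Pj p r W' * coord B"
proof -
  let ?I = "{..<n} \<times> {..<r + p}" and ?J = "coord B"
  define f where "f g = (norm (Xf n g * coord B * Pj p r (sel g)))\<^sup>2" for g
  have fB: "finite B" using B finite_subset by blast
  have "AE g in gauss ?I. \<forall>x\<in>{..<n} \<times> B. \<forall>a b. (\<forall>y. f g + a * (y - g (fst x, r + snd x)) \<le> f (g((fst x, r + snd x) := y))) \<longrightarrow>
    (\<forall>y. f g + b * (y - g (fst x, r + snd x)) \<le> f (g((fst x, r + snd x) := y))) \<longrightarrow> a = b"
  proof (rule AE_finite_allI)
    show "finite ({..<n} \<times> B)" using fB by simp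
    fix x assume x: "x \<in> {..<n} \<times> B"
    obtain t i where ti: "x = (t, i)" "t < n" "i \<in> B" using x by auto
    show "AE g in gauss ?I. \<forall>a b. (\<forall>y. f g + a * (y - g (fst x, r + snd x)) \<le> f (g((fst x, r + snd x) := y))) \<longrightarrow>
      (\<forall>y. f g + b * (y - g (fst x, r + snd x)) \<le> f (g((fst x, r + snd x) := y))) \<longrightarrow> a = b"
      unfolding ti fst_conv snd_conv
    proof (rule AE_unique_subgradient)
      show "finite ?I" by simp
      show "(t, r + i) \<in> ?I" using ti B by auto
      show "f \<in> borel_measurable (gauss ?I)" unfolding f_def by (rule energy_measurable[OF B sel])
      \<comment> \<open>A subgradient is needed at every point of the line; the fitted value of the
        selector at the moved point provides it.\<close>
      show "f (g((t, r + i) := y)) + (2 * ent (Xf n (g((t, r + i) := y)) * ?J * Pj p r (sel (g((t, r + i) := y))) * ?J) t i) * (y' - y)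
        \<le> f (g((t, r + i) := y'))" for g y y'
        using energy_subgradient[OF B ti(2,3) sel sel, of "g((t, r + i) := y)" y'] by (simp add: f_def)
    qed
  qed
  then show ?thesis
  proof (rule AE_mp, intro AE_I2 impI allI)
    fix g W W'
    assume u: "\<forall>x\<in>{..<n} \<times> B. \<forall>a b. (\<forall>y. f g + a * (y - g (fst x, r + snd x)) \<le> f (g((fst x, r + snd x) := y))) \<longrightarrow>
      (\<forall>y. f g + b * (y - g (fst x, r + snd x)) \<le> f (g((fst x, r + snd x) := y))) \<longrightarrow> a = b"
      and W: "leading_eigvecs p r (restrict_mat B (Sg n {..<n} g)) W" "leading_eigvecs p r (restrict_mat B (Sg n {..<n} g)) W'"
    show "Xf n g * ?J * Pj p r W * ?J = Xf n g * ?J * Pj p r W' * ?J"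
    proof (rule fmat_eqI)
      fix t i
      show "ent (Xf n g * ?J * Pj p r W * ?J) t i = ent (Xf n g * ?J * Pj p r W' * ?J) t i"
      proof (cases "t < n \<and> i \<in> B")
        case True
        then have "(t, i) \<in> {..<n} \<times> B" by auto
        then have "2 * ent (Xf n g * ?J * Pj p r W * ?J) t i = 2 * ent (Xf n g * ?J * Pj p r W' * ?J) t i"
          using bspec[OF u, of "(t, i)"] energy_subgradient[OF B _ _ sel W(1), of t i] energy_subgradient[OF B _ _ sel W(2), of t i] True
          unfolding f_def fst_conv snd_conv by blast
        then show ?thesis by simp
      next
        case False
        have "ent (Xf n g * A * ?J) t i = 0" for A
        proof (cases "t < n")
          case True then show ?thesis using False fB by (simp add: ent_coord_r)
        next
          case tn: False
          have b: "bnd (Xf n g) (max n p)" unfolding Xf_def by (rule bnd_fm) auto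
          have "ent (Xf n g * A) t i = 0" unfolding ent_times[OF b] using tn by (simp add: Xf_def)
          then show ?thesis using fB by (simp add: ent_coord_r)
        qed
        from this[of "?J * Pj p r W"] this[of "?J * Pj p r W'"] show ?thesis by (simp add: mult.assoc)
      qed
    qed
  qed
qed

text \<open>Equal fitted values mean that the data annihilate the difference of the projections;
  definiteness on \<open>B\<close> then forces the difference itself to vanish.\<close>

lemma leading_unique:
  assumes B: "B \<subseteq> {..<p}" "r \<le> card B" "n > 0"
    and F: "opb (KK B * gramE n {..<n} (r + p) g * KK B) e" "e < 1"
    and W: "leading_eigvecs p r (restrict_mat B (Sg n {..<n} g)) W" "leading_eigvecs p r (restrict_mat B (Sg n {..<n} g)) W'"
    and eq: "Xf n g * coord B * Pj p r W * coord B = Xf n g * coord B * Pj p r W' * coord B"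
  shows "Pj p r W = Pj p r W'"
proof -
  let ?J = "coord B"
  have S: "fm p p (Sg n {..<n} g) = tp T1 * T1 + Ip + tp (T1 + T2) * gramE n {..<n} (r + p) g * (T1 + T2)"
    unfolding Sg_def by (rule sample_cov)
  have oW: "orthonormal_cols p r W" "orthonormal_cols p r W'"
    by (rule leading_max(2)[OF B(1,3) W(1) proj_Pj[OF V] coord_Pj norm_Pj[OF V]] leading_max(2)[OF B(1,3) W(2) proj_Pj[OF V] coord_Pj norm_Pj[OF V]])+
  have JW: "?J * Pj p r W = Pj p r W" "?J * Pj p r W' = Pj p r W'"
    by (rule leading_support[OF B(1,2) S F W(1)] leading_support[OF B(1,2) S F W(2)])+
  then have WJ: "Pj p r W * ?J = Pj p r W" "Pj p r W' * ?J = Pj p r W'"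
    using oW by (metis proj_Pj projD(1) tp_times tp_coord)+
  define A where "A = Pj p r W - Pj p r W'"
  have "Xf n g * ?J * A = 0" using eq by (simp add: A_def right_diff_distrib mult.assoc WJ)
  then have "real n * inner A (?J * fm p p (Sg n {..<n} g) * ?J * A) = 0"
    using restricted_energy[OF B(1,3), of g A] by simp
  then have "(1 - e) * (norm (?J * A))\<^sup>2 \<le> 0"
    using restricted_pd[OF B(1) S F(1), of A] F(2) B(3) by simp
  then have "?J * A = 0" using F(2) by (simp add: mult_le_0_iff)
  then show ?thesis by (simp add: A_def right_diff_distrib JW)
qed

end

section \<open>Splitting the sample\<close>

text \<open>Translates the single array of \<open>r + p\<close> columns, which is convenient to cut
  into halves of rows, into the pair of factor and noise arrays. The restrictions are there because
  points of a product space are extensional.\<close>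

definition to_data :: "nat \<Rightarrow> nat \<Rightarrow> nat \<Rightarrow> (nat \<times> nat \<Rightarrow> real) \<Rightarrow> (nat \<times> nat \<Rightarrow> real) \<times> (nat \<times> nat \<Rightarrow> real)" where
  "to_data n p r g = (restrict g ({..<2 * n} \<times> {..<r}), \<lambda>x\<in>{..<2 * n} \<times> {..<p}. g (fst x, r + snd x))"

abbreviation halves :: "nat \<Rightarrow> nat \<Rightarrow> (nat \<times> nat \<Rightarrow> real) \<Rightarrow> (nat \<times> nat \<Rightarrow> real) \<Rightarrow> nat \<times> nat \<Rightarrow> real" where
  "halves n d g1 g2 \<equiv> merge ({..<n} \<times> {..<d}) ({n..<2 * n} \<times> {..<d}) (g1, g2)"

lemma to_data_measurable: "to_data n p r \<in> measurable (gauss ({..<2 * n} \<times> {..<r + p})) (data_space n p r)"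
  unfolding to_data_def[abs_def] data_space_def
proof (rule measurable_Pair)
  show "(\<lambda>g. restrict g ({..<2 * n} \<times> {..<r})) \<in> measurable (gauss ({..<2 * n} \<times> {..<r + p})) (gauss ({..<2 * n} \<times> {..<r}))"
    by (rule measurable_restrict_subset) auto
  show "(\<lambda>g. \<lambda>x\<in>{..<2 * n} \<times> {..<p}. g (fst x, r + snd x)) \<in> measurable (gauss ({..<2 * n} \<times> {..<r + p})) (gauss ({..<2 * n} \<times> {..<p}))"
    by (rule measurable_restrict) (auto intro!: measurable_component_singleton)
qed

text \<open>The translation preserves the law: it splits a product measure into two blocks and
  shifts the indices of the second.\<close>

lemma nn_integral_data_space:
  fixes f :: "_ \<Rightarrow> ennreal"
  assumes f: "f \<in> borel_measurable (data_space n p r)"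
  shows "(\<integral>\<^sup>+\<omega>. f \<omega> \<partial>data_space n p r) = (\<integral>\<^sup>+g. f (to_data n p r g) \<partial>gauss ({..<2 * n} \<times> {..<r + p}))"
proof -
  let ?R = "{..<2 * n}"
  define A where "A = ?R \<times> {..<r}"
  define B where "B = ?R \<times> {..<p}"
  define B' where "B' = ?R \<times> {r..<r + p}"
  have AB: "A \<inter> B' = {}" "A \<union> B' = ?R \<times> {..<r + p}" "finite A" "finite B'" "finite B"
    by (auto simp: A_def B'_def B_def)
  define h where "h x = (fst x, r + snd x)" for x :: "nat \<times> nat"
  have hB: "inj_on h B" "h \<in> B \<rightarrow> B'" by (auto simp: h_def B_def B'_def inj_on_def)
  have fm: "f \<in> borel_measurable (gauss A \<Otimes>\<^sub>M gauss B)" using f by (simp add: data_space_def A_def B_def)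
  interpret SB: sigma_finite_measure "gauss B" by (rule ps.sigma_finite[OF AB(5)])
  have re: "distr (gauss B') (gauss B) (\<lambda>\<omega>. \<lambda>x\<in>B. \<omega> (h x)) = gauss B"
    by (rule distr_PiM_reindex[of B' "\<lambda>_. std_normal_distribution" h B]) (use hB prob_std_normal in auto)
  have rm: "(\<lambda>\<omega>. \<lambda>x\<in>B. \<omega> (h x)) \<in> measurable (gauss B') (gauss B)"
    by (rule measurable_restrict, rule measurable_component_singleton) (use hB in auto)
  have "(\<integral>\<^sup>+\<omega>. f \<omega> \<partial>data_space n p r) = (\<integral>\<^sup>+u. \<integral>\<^sup>+z. f (u, z) \<partial>gauss B \<partial>gauss A)"
    unfolding data_space_def A_def[symmetric] B_def[symmetric] by (rule SB.nn_integral_fst[OF fm, symmetric])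
  also have "\<dots> = (\<integral>\<^sup>+u. \<integral>\<^sup>+z. f (u, \<lambda>x\<in>B. z (h x)) \<partial>gauss B' \<partial>gauss A)"
  proof (rule nn_integral_cong)
    fix u assume u: "u \<in> space (gauss A)"
    have "(\<lambda>z. f (u, z)) \<in> borel_measurable (gauss B)" by (rule measurable_compose[OF measurable_Pair1'[OF u] fm])
    then show "(\<integral>\<^sup>+z. f (u, z) \<partial>gauss B) = (\<integral>\<^sup>+z. f (u, \<lambda>x\<in>B. z (h x)) \<partial>gauss B')"
      by (subst re[symmetric], subst nn_integral_distr[OF rm]) simp_all
  qed
  also have "\<dots> = (\<integral>\<^sup>+u. \<integral>\<^sup>+z. f (to_data n p r (merge A B' (u, z))) \<partial>gauss B' \<partial>gauss A)"
  proof (intro nn_integral_cong)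
    fix u z assume u: "u \<in> space (gauss A)"
    have "restrict (merge A B' (u, z)) A = u"
      using u by (auto simp: space_PiM PiE_def extensional_def merge_def restrict_def fun_eq_iff)
    moreover have "(\<lambda>x\<in>B. merge A B' (u, z) (fst x, r + snd x)) = (\<lambda>x\<in>B. z (h x))"
      by (rule restrict_ext) (auto simp: merge_def h_def A_def B_def B'_def)
    ultimately show "f (u, \<lambda>x\<in>B. z (h x)) = f (to_data n p r (merge A B' (u, z)))"
      by (simp add: to_data_def A_def[symmetric] B_def[symmetric])
  qed
  also have "\<dots> = (\<integral>\<^sup>+g. f (to_data n p r g) \<partial>gauss (A \<union> B'))"
    by (rule ps.product_nn_integral_fold[OF AB(1,3,4), symmetric])
       (unfold AB(2), rule measurable_compose[OF to_data_measurable f])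
  finally show ?thesis unfolding AB(2) .
qed

lemma nn_integral_halves:
  fixes f :: "_ \<Rightarrow> ennreal"
  assumes f: "f \<in> borel_measurable (data_space n p r)"
  shows "(\<integral>\<^sup>+\<omega>. f \<omega> \<partial>data_space n p r)
    = (\<integral>\<^sup>+g1. \<integral>\<^sup>+g2. f (to_data n p r (halves n (r + p) g1 g2)) \<partial>gauss ({n..<2 * n} \<times> {..<r + p}) \<partial>gauss ({..<n} \<times> {..<r + p}))"
proof -
  have e: "{..<2 * n} \<times> {..<r + p} = {..<n} \<times> {..<r + p} \<union> {n..<2 * n} \<times> {..<r + p}" by auto
  show ?thesis unfolding nn_integral_data_space[OF f]
    unfolding e by (rule ps.product_nn_integral_fold)
      (auto simp: e[symmetric] intro: measurable_compose[OF to_data_measurable f])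
qed

lemma data_X_halves:
  assumes "j < p" "r \<le> d - p" "p \<le> d" "d = r + p"
  shows "t < n \<Longrightarrow> data_X r V Ls (to_data n p r (halves n d g1 g2)) t j = Xd r V Ls g1 t j"
    "n \<le> t \<Longrightarrow> t < 2 * n \<Longrightarrow> data_X r V Ls (to_data n p r (halves n d g1 g2)) t j = Xd r V Ls g2 t j"
  using assms by (auto simp: data_X_def to_data_def Xd_def merge_def intro!: sum.cong)

lemma prob_data_space: "prob_space (data_space n p r)"
  unfolding data_space_def by (intro prob_space_pair prob_gauss)

section \<open>Maximal and tail inequalities\<close>

lemma psi_pos: "0 < psi n z" by (simp add: psi_def)

text \<open>This is \<open>x - L \<le> exp (x - L)\<close> with \<open>x = n * z^2 / 128\<close>.
  When \<open>L\<close> is the logarithm of the number of directions, a maximum of squares may be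
  replaced by a sum of \<open>psi\<close> terms and costs only \<open>L\<close> plus a constant in
  the mean.\<close>

lemma square_le_psi:
  assumes "n > 0" "\<bar>z\<bar> \<le> 1"
  shows "z\<^sup>2 \<le> 128 / real n * (L + exp (- L) * psi n z)"
proof -
  have "min (z\<^sup>2) 1 = z\<^sup>2" using assms(2) by (simp add: abs_square_le_1)
  then have "psi n z = exp (real n / 128 * z\<^sup>2)" by (simp add: psi_def)
  then have "exp (- L) * psi n z = exp (real n / 128 * z\<^sup>2 - L)" by (simp add: exp_add[symmetric])
  moreover have "real n / 128 * z\<^sup>2 - L \<le> exp (real n / 128 * z\<^sup>2 - L)"
    using exp_ge_add_one_self[of "real n / 128 * z\<^sup>2 - L"] by linarith
  ultimately have "real n / 128 * z\<^sup>2 - L \<le> exp (- L) * psi n z" by linarith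
  then show ?thesis using assms(1) by (simp add: field_simps)
qed

text \<open>A Markov inequality before integration: the right side dominates the indicator of the
  event that \<open>\<bar>z\<bar>\<close> reaches \<open>c\<close>. Truncation in \<open>psi\<close>
  is the reason for \<open>c \<le> 1\<close>.\<close>

lemma one_le_psi:
  assumes "0 \<le> c" "c \<le> 1" "c \<le> \<bar>z\<bar>"
  shows "1 \<le> exp (- (real n * c\<^sup>2 / 128)) * psi n z"
proof -
  have "c\<^sup>2 \<le> z\<^sup>2" using assms by (metis abs_le_square_iff abs_of_nonneg)
  moreover have "c\<^sup>2 \<le> 1" using assms by (simp add: power_le_one)
  ultimately have "real n / 128 * c\<^sup>2 \<le> real n / 128 * min (z\<^sup>2) 1" by (intro mult_left_mono) auto
  then show ?thesis by (simp add: psi_def exp_add[symmetric])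
qed

lemma psi_sum_bound:
  assumes n: "n > 0" "card Ts = n" and X: "finite X" "c \<ge> 0"
    and H: "\<And>x. x \<in> X \<Longrightarrow> tp (H x) = H x" "\<And>x. x \<in> X \<Longrightarrow> bnd (H x) d" "\<And>x. x \<in> X \<Longrightarrow> norm (H x) \<le> 1"
  shows "(\<lambda>g. c * (\<Sum>x\<in>X. psi n (inner (gramE n Ts d g) (H x)))) \<in> borel_measurable (gauss (Ts \<times> {..<d}))"
    "(\<integral>\<^sup>+g. ennreal (c * (\<Sum>x\<in>X. psi n (inner (gramE n Ts d g) (H x)))) \<partial>gauss (Ts \<times> {..<d})) \<le> ennreal (c * (12 * real (card X)))"
proof -
  let ?G = "gauss (Ts \<times> {..<d})" and ?z = "\<lambda>g x. psi n (inner (gramE n Ts d g) (H x))"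
  have m: "(\<lambda>g. ?z g x) \<in> borel_measurable ?G" for x by (rule psi_meas[OF n])
  show "(\<lambda>g. c * (\<Sum>x\<in>X. ?z g x)) \<in> borel_measurable ?G"
    by (intro borel_measurable_times borel_measurable_const borel_measurable_sum m)
  have "(\<integral>\<^sup>+g. ennreal (c * (\<Sum>x\<in>X. ?z g x)) \<partial>?G) = (\<integral>\<^sup>+g. ennreal c * (\<Sum>x\<in>X. ennreal (?z g x)) \<partial>?G)"
    using X(2) psi_pos by (intro nn_integral_cong) (simp add: ennreal_mult sum_nonneg sum_ennreal less_imp_le)
  also have "\<dots> = ennreal c * (\<Sum>x\<in>X. \<integral>\<^sup>+g. ennreal (?z g x) \<partial>?G)"
    using m by (subst nn_integral_cmult) (auto intro!: borel_measurable_sum simp: nn_integral_sum)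
  also have "\<dots> \<le> ennreal c * (\<Sum>x\<in>X. 12)"
    by (intro mult_left_mono sum_mono psi_bound n H) auto
  also have "\<dots> = ennreal (c * (12 * real (card X)))"
    using X(2) by (simp add: ennreal_mult ennreal_of_nat_eq_real_of_nat mult.commute)
  finally show "(\<integral>\<^sup>+g. ennreal (c * (\<Sum>x\<in>X. ?z g x)) \<partial>?G) \<le> ennreal (c * (12 * real (card X)))" .
qed

text \<open>The estimate \<open>k^k / k! \<le> exp k\<close> is a single term of the exponential
  series.\<close>

lemma card_subsets_le:
  assumes "1 \<le> k" "k \<le> p"
  shows "real (card {B. B \<subseteq> {..<p} \<and> card B = k}) \<le> exp (real k * ln (exp 1 * real p / real k))"
proof -
  have kp: "real k > 0" "real p > 0" using assms by auto
  have c: "card {B. B \<subseteq> {..<p} \<and> card B = k} = p choose k" using n_subsets[of "{..<p}" k] by simp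
  have e: "real k ^ k / fact k \<le> exp (real k)"
  proof -
    have "(\<Sum>n\<in>{k}. real k ^ n /\<^sub>R fact n) \<le> exp (real k)"
      unfolding exp_def by (rule sum_le_suminf[OF summable_exp_generic]) auto
    then show ?thesis by (simp add: divide_inverse mult.commute)
  qed
  have "real (p choose k) * fact k \<le> real p ^ k"
  proof -
    have "(p choose k) * fact k \<le> p ^ k" by (metis binomial_fact_pow)
    then have "real ((p choose k) * fact k) \<le> real (p ^ k)" by (simp only: of_nat_le_iff)
    then show ?thesis by simp
  qed
  then have "real (p choose k) \<le> real p ^ k / fact k" by (simp add: pos_le_divide_eq)
  also have "\<dots> = real p ^ k / real k ^ k * (real k ^ k / fact k)" using kp by simp
  also have "\<dots> \<le> real p ^ k / real k ^ k * exp (real k)" using e by (intro mult_left_mono) auto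
  also have "\<dots> = (exp 1 * real p / real k) ^ k" by (simp add: power_divide power_mult_distrib exp_of_nat_mult[symmetric])
  also have "\<dots> = exp (real k * ln (exp 1 * real p / real k))" using kp by (simp add: exp_of_nat_mult)
  finally show ?thesis unfolding c .
qed

lemma trace_quad_cong:
  assumes "\<And>i j. i < p \<Longrightarrow> j < p \<Longrightarrow> M i j = M' i j"
  shows "trace_quad p r M W = trace_quad p r M' W"
  unfolding trace_quad_def using assms by (intro sum.cong refl) auto

context spiked
begin

definition cand :: "nat \<Rightarrow> (rmat \<Rightarrow> nat set \<Rightarrow> rmat) \<Rightarrow> (nat \<times> nat \<Rightarrow> real) \<Rightarrow> (nat \<times> nat \<Rightarrow> real) \<Rightarrow> nat set \<Rightarrow> fmat" where
  "cand n Vsel g1 g2 B = Pj p r (Vsel (data_X r V Ls (to_data n p r (halves n (r + p) g1 g2))) B)"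

lemma S1_halves:
  "i < p \<Longrightarrow> j < p \<Longrightarrow> S1 n (data_X r V Ls (to_data n p r (halves n (r + p) g1 g2))) i j = Sg n {..<n} g1 i j"
  unfolding S1_def Sg_def using data_X_halves[of _ p r "r + p"] by (auto intro!: sum.cong)

lemma S2_halves:
  "i < p \<Longrightarrow> j < p \<Longrightarrow> S2 n (data_X r V Ls (to_data n p r (halves n (r + p) g1 g2))) i j = Sg n {n..<2 * n} g2 i j"
  unfolding S2_def Sg_def using data_X_halves[of _ p r "r + p"] by (auto intro!: sum.cong)

lemma bnd_T: "bnd ((T1 + T2) * (Pj p r W - Pj p r W') * tp (T1 + T2)) (r + p)"
proof -
  have "bnd (T1 + T2) (r + p)" by (auto simp: bnd_def T1m_def T2m_def)
  moreover have "bnd (Pj p r W - Pj p r W') (r + p)" by (auto simp: bnd_def ent_Pj)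
  ultimately show ?thesis by (intro bnd_times) (simp_all only: bnd_tp)
qed

text \<open>Conditionally on the first sample the candidates are finitely many fixed projections, and
  only the second sample enters through the normalised noise in the directions \<open>H B\<close>.\<close>
lemma conditional_bound:
  fixes m :: real
  assumes n: "n > 0" and k: "r \<le> k" and B0: "B0 \<subseteq> {..<p}" "card B0 = k"
    and D: "(norm ((Ip - coord B0) * Vf))\<^sup>2 \<le> D2" and m: "m \<ge> 0" "real r \<le> m\<^sup>2 \<or> real k - real r \<le> m\<^sup>2"
    and agg: "aggregated_estimator n p r k Vsel Bst"
    and uniq: "\<And>B W W'. B \<subseteq> {..<p} \<Longrightarrow> card B = k \<Longrightarrow> leading_eigvecs p r (restrict_mat B (Sg n {..<n} g1)) W \<Longrightarrow>
      leading_eigvecs p r (restrict_mat B (Sg n {..<n} g1)) W' \<Longrightarrow>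
      Xf n g1 * coord B * Pj p r W * coord B = Xf n g1 * coord B * Pj p r W' * coord B"
    and good: "\<And>B u. B \<subseteq> {..<p} \<Longrightarrow> card B = k \<Longrightarrow> u \<in> net (r + p) ({..<r} \<union> (+) r ` B) \<Longrightarrow>
      \<bar>inner (gramE n {..<n} (r + p) g1) (u * tp u)\<bar> \<le> 1 / 16"
    and Q: "0 \<le> Q" "\<And>u. u \<in> net (r + p) ({..<r} \<union> (+) r ` B0) \<Longrightarrow> (inner (gramE n {..<n} (r + p) g1) (u * tp u))\<^sup>2 \<le> Q"
  shows "\<exists>H :: nat set \<Rightarrow> fmat. (\<forall>B. tp (H B) = H B \<and> bnd (H B) (r + p) \<and> norm (H B) \<le> 1) \<and>
    (\<forall>g2 R. 0 \<le> R \<longrightarrow> (\<forall>B. B \<subseteq> {..<p} \<and> card B = k \<longrightarrow> \<bar>inner (gramE n {n..<2 * n} (r + p) g2) (H B)\<bar> \<le> 1 / 8 \<and>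
        (inner (gramE n {n..<2 * n} (r + p) g2) (H B))\<^sup>2 \<le> R) \<longrightarrow>
      (let X = data_X r V Ls (to_data n p r (halves n (r + p) g1 g2)) in proj_loss p r (Vsel X (Bst X)) V)
        \<le> 162 * (\<kappa> + 1) * D2 + (648 * m\<^sup>2 * Q + 52 * R) / hfun lam)"
proof -
  let ?d = "r + p" and ?E1 = "gramE n {..<n} (r + p) g1"
  let ?X = "\<lambda>g2. data_X r V Ls (to_data n p r (halves n (r + p) g1 g2))"
  have lead: "leading_eigvecs p r (restrict_mat B (Sg n {..<n} g1)) (Vsel (?X g2) B)" if "B \<subseteq> {..<p}" "card B = k" for B g2
  proof -
    have "leading_eigvecs p r (restrict_mat B (S1 n (?X g2))) (Vsel (?X g2) B)"
      using agg that unfolding aggregated_estimator_def by blast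
    moreover have "restrict_mat B (S1 n (?X g2)) i j = restrict_mat B (Sg n {..<n} g1) i j" if "i < p" "j < p" for i j
      using S1_halves[OF that, of n g1 g2] by (simp add: restrict_mat_def)
    ultimately show ?thesis using leading_eigvecs_cong by blast
  qed
  have orth: "orthonormal_cols p r (Vsel (?X g2) B)" if "B \<subseteq> {..<p}" "card B = k" for B g2
    by (rule leading_max(2)[OF that(1) n lead[OF that] proj_Pj[OF V] coord_Pj norm_Pj[OF V]])
  have SBd: "{..<r} \<union> (+) r ` B \<subseteq> {..<?d}" if "B \<subseteq> {..<p}" for B using that by auto
  have opb8: "opb (KK B * ?E1 * KK B) (2 * (1 / 16))" if "B \<subseteq> {..<p}" "card B = k" for B
    by (rule opb_gram[OF tp_gramE SBd[OF that(1)]]) (use good[OF that] in auto)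
  \<comment> \<open>By uniqueness the candidates do not depend on the second sample, so any value of
    it, here zero, may be used to name them.\<close>
  define C where "C B = cand n Vsel g1 (\<lambda>_. 0) B" for B
  have cand: "Pj p r (Vsel (?X g2) B) = C B" if "B \<subseteq> {..<p}" "card B = k" for B g2
    unfolding C_def cand_def
    by (rule leading_unique[OF that(1) _ n opb8[OF that] _ lead[OF that] lead[OF that] uniq[OF that lead[OF that] lead[OF that]]])
       (use that k in auto)
  define M where "M B = (T1 + T2) * (C B - C B0) * tp (T1 + T2)" for B
  \<comment> \<open>If \<open>M B\<close> vanishes, division by zero makes \<open>H B\<close> zero,
    which is still an admissible direction.\<close>
  define H where "H B = (1 / norm (M B)) *\<^sub>R M B" for B
  have tpM: "tp (M B) = M B" for B
  proof -
    have "tp (Pj p r W) = Pj p r W" for W by (simp add: Pj_def)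
    then show ?thesis by (simp add: M_def C_def cand_def mult.assoc)
  qed
  have H: "tp (H B) = H B" "bnd (H B) ?d" "norm (H B) \<le> 1" for B
  proof -
    show "tp (H B) = H B" by (simp add: H_def tpM)
    show "bnd (H B) ?d" using bnd_T unfolding H_def M_def C_def cand_def bnd_def by simp
    show "norm (H B) \<le> 1" by (cases "M B = 0") (simp_all add: H_def)
  qed
  \<comment> \<open>The minimum serves two purposes: \<open>e\<close> stays below the threshold
    \<open>1/8\<close> for absorption, and its square is at most \<open>4 * Q\<close>, which carries
    the rate.\<close>
  define e where "e = 2 * min (1 / 16) (sqrt Q)"
  have e: "e \<le> 1 / 8" "e\<^sup>2 \<le> 4 * Q"
  proof -
    show "e \<le> 1 / 8" by (simp add: e_def)
    have "e\<^sup>2 \<le> (2 * sqrt Q)\<^sup>2" using Q(1) by (intro power_mono) (auto simp: e_def)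
    then show "e\<^sup>2 \<le> 4 * Q" using Q(1) by (simp add: power_mult_distrib)
  qed
  have opb0: "opb (KK B0 * ?E1 * KK B0) e"
    unfolding e_def
  proof (rule opb_gram[OF tp_gramE SBd[OF B0(1)]])
    show "0 \<le> min (1 / 16) (sqrt Q)" using Q(1) by simp
    fix u assume u: "u \<in> net ?d ({..<r} \<union> (+) r ` B0)"
    have "\<bar>inner ?E1 (u * tp u)\<bar> \<le> sqrt Q" using Q(2)[OF u] by (metis real_sqrt_abs real_sqrt_le_mono)
    then show "\<bar>inner ?E1 (u * tp u)\<bar> \<le> min (1 / 16) (sqrt Q)" using good[OF B0 u] by simp
  qed
  have S1: "fm p p (Sg n {..<n} g1) = tp T1 * T1 + Ip + tp (T1 + T2) * ?E1 * (T1 + T2)"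
    unfolding Sg_def by (rule sample_cov)
  have "(let X = ?X g2 in proj_loss p r (Vsel X (Bst X)) V) \<le> 162 * (\<kappa> + 1) * D2 + (648 * m\<^sup>2 * Q + 52 * R) / hfun lam"
    if R: "0 \<le> R" "\<And>B. B \<subseteq> {..<p} \<Longrightarrow> card B = k \<Longrightarrow> \<bar>inner (gramE n {n..<2 * n} ?d g2) (H B)\<bar> \<le> 1 / 8"
      "\<And>B. B \<subseteq> {..<p} \<Longrightarrow> card B = k \<Longrightarrow> (inner (gramE n {n..<2 * n} ?d g2) (H B))\<^sup>2 \<le> R" for g2 R
  proof -
    let ?E2 = "gramE n {n..<2 * n} ?d g2"
    define B where "B = Bst (?X g2)"
    have B: "B \<subseteq> {..<p}" "card B = k"
      and opt: "trace_quad p r (S2 n (?X g2)) (Vsel (?X g2) B0) \<le> trace_quad p r (S2 n (?X g2)) (Vsel (?X g2) B)"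
      using agg B0 unfolding aggregated_estimator_def B_def by blast+
    define \<eta> where "\<eta> = \<bar>inner ?E2 (H B)\<bar>"
    have \<eta>: "0 \<le> \<eta>" "\<eta> \<le> 1 / 8" "\<eta>\<^sup>2 \<le> R" using R(2,3)[OF B] by (auto simp: \<eta>_def)
    have MB: "\<bar>inner ?E2 (M B)\<bar> \<le> \<eta> * norm (M B)"
    proof (cases "M B = 0")
      case False
      then have "M B = norm (M B) *\<^sub>R H B" by (simp add: H_def)
      then have "inner ?E2 (M B) = norm (M B) * inner ?E2 (H B)" by (metis inner_scaleR_right)
      then show ?thesis by (simp add: \<eta>_def abs_mult)
    qed simp
    have S2: "fm p p (Sg n {n..<2 * n} g2) = tp T1 * T1 + Ip + tp (T1 + T2) * ?E2 * (T1 + T2)"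
      unfolding Sg_def by (rule sample_cov)
    have opt': "trace_quad p r (Sg n {n..<2 * n} g2) (Vsel (?X g2) B0) \<le> trace_quad p r (Sg n {n..<2 * n} g2) (Vsel (?X g2) B)"
      using opt trace_quad_cong[of p "S2 n (?X g2)" "Sg n {n..<2 * n} g2", OF S2_halves] by simp
    have Y0: "(norm ((Ip - Pj p r (Vsel (?X g2) B0)) * tp T1))\<^sup>2 \<le> 27 * ((\<kappa> + 1) * lam * D2 + e\<^sup>2 * m\<^sup>2 * (1 + 1 / lam))"
      by (rule oracle_bound[OF B0 k S1 tp_gramE opb0 e(1) lead[OF B0] D m])
    have "proj_loss p r (Vsel (?X g2) B) V \<le> 162 * (\<kappa> + 1) * D2 + (162 * (e\<^sup>2 * m\<^sup>2) + 52 * \<eta>\<^sup>2) / hfun lam"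
      by (rule stage2_bound[OF orth[OF B] orth[OF B0] S2 opt' \<eta>(1,2) _ Y0])
         (use MB in \<open>simp add: M_def cand[OF B] cand[OF B0]\<close>)
    also have "\<dots> \<le> 162 * (\<kappa> + 1) * D2 + (648 * m\<^sup>2 * Q + 52 * R) / hfun lam"
    proof -
      have "e\<^sup>2 * m\<^sup>2 \<le> 4 * Q * m\<^sup>2" using e(2) by (rule mult_right_mono) simp
      then have "162 * (e\<^sup>2 * m\<^sup>2) + 52 * \<eta>\<^sup>2 \<le> 648 * m\<^sup>2 * Q + 52 * R" using \<eta>(3) by (simp add: mult_ac)
      then show ?thesis using lam by (intro add_left_mono divide_right_mono) (auto simp: hfun_def)
    qed
    finally show ?thesis by (simp add: B_def Let_def)
  qed
  then show ?thesis using H by (intro exI[of _ H]) blast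
qed

lemma loss_le_2r:
  assumes n: "n > 0" and agg: "aggregated_estimator n p r k Vsel Bst"
  shows "(let X = data_X r V Ls \<omega> in proj_loss p r (Vsel X (Bst X)) V) \<le> 2 * real (min r (p - r))"
proof -
  define X where "X = data_X r V Ls \<omega>"
  have B: "Bst X \<subseteq> {..<p}" "card (Bst X) = k" using agg unfolding aggregated_estimator_def by blast+
  then have "leading_eigvecs p r (restrict_mat (Bst X) (S1 n X)) (Vsel X (Bst X))"
    using agg unfolding aggregated_estimator_def by blast
  then obtain E \<nu> where "eig p r (restrict_mat (Bst X) (S1 n X)) (Vsel X (Bst X)) E \<nu>"
    using leading_eig frame_le[OF V] by blast
  then have "orthonormal_cols p r (Vsel X (Bst X))" by (rule eig.orth_W)
  then show ?thesis unfolding X_def[symmetric] Let_def using proj_loss_le V by blast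
qed

end

lemma proj_loss_nonneg: "0 \<le> proj_loss p r W V"
  by (simp add: proj_loss_def sum_nonneg)

lemma nn_integral_affine_le:
  assumes M: "prob_space M" and f: "f \<in> borel_measurable M" "\<And>x. 0 \<le> f x" and a: "0 \<le> a"
    and le: "(\<integral>\<^sup>+x. ennreal (f x) \<partial>M) \<le> ennreal b" "0 \<le> b"
  shows "(\<integral>\<^sup>+x. ennreal (a + f x) \<partial>M) \<le> ennreal (a + b)"
proof -
  have "(\<integral>\<^sup>+x. ennreal (a + f x) \<partial>M) = (\<integral>\<^sup>+x. ennreal a + ennreal (f x) \<partial>M)"
    using a f by (intro nn_integral_cong) simp
  also have "\<dots> = ennreal a + (\<integral>\<^sup>+x. ennreal (f x) \<partial>M)"
    using f by (subst nn_integral_add) (auto simp: prob_space.emeasure_space_1[OF M])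
  also have "\<dots> \<le> ennreal (a + b)" using le a by (simp add: add_left_mono)
  finally show ?thesis .
qed

section \<open>Integrated risk bound\<close>

context spiked
begin

text \<open>In each case the loss is dominated pointwise by sums of \<open>psi\<close> terms; these
  are integrated over the second sample with the first fixed, then over the first. The summand
  \<open>12 * real k\<close> is the logarithmic size of a net, \<open>L\<close> that of the family
  of candidate sets.\<close>

lemma core_bound:
  fixes m :: real
  assumes n: "n > 0" and k: "1 \<le> k" "r \<le> k" "k \<le> p" and B0: "B0 \<subseteq> {..<p}" "card B0 = k"
    and D: "(norm ((Ip - coord B0) * Vf))\<^sup>2 \<le> D2" and m: "m \<ge> 0" "real r \<le> m\<^sup>2 \<or> real k - real r \<le> m\<^sup>2"
    and agg: "aggregated_estimator n p r k Vsel Bst" and meas: "estimator_measurable n p r Vsel Bst V Ls"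
  defines "L \<equiv> real k * ln (exp 1 * real p / real k)"
  shows "expected_loss n p r Vsel Bst V Ls \<le> 162 * (\<kappa> + 1) * D2
    + 128 / real n * (648 * m\<^sup>2 * (12 * real k + 12) + 52 * (L + 12)) / hfun lam
    + 24 * real r * (exp (L - real n / 8192) + exp (L + 12 * real k - real n / 32768))"
proof -
  let ?d = "r + p"
  define loss where "loss \<omega> = (let X = data_X r V Ls \<omega> in proj_loss p r (Vsel X (Bst X)) V)" for \<omega>
  define G1 where "G1 = gauss ({..<n} \<times> {..<?d})"
  define G2 where "G2 = gauss ({n..<2 * n} \<times> {..<?d})"
  define T where "T = {B. B \<subseteq> {..<p} \<and> card B = k}"
  define N where "N B = net ?d ({..<r} \<union> (+) r ` B)" for B
  define z1 where "z1 g u = inner (gramE n {..<n} ?d g) (u * tp u)" for g u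
  define \<Phi>0 where "\<Phi>0 g = (\<Sum>u\<in>N B0. psi n (z1 g u))" for g
  define \<Phi>a where "\<Phi>a g = (\<Sum>x\<in>Sigma T N. psi n (z1 g (snd x)))" for g
  define h where "h = hfun lam"
  define w where "w = 128 / real n"
  \<comment> \<open>Weight of the oracle noise in \<open>square_le_psi\<close>, taken at the level
    \<open>12 * real k\<close> of the net of \<open>B0\<close>.\<close>
  define c0 where "c0 = w * (648 * m\<^sup>2 * exp (- (12 * real k))) / h"
  define ca where "ca = 2 * real r * exp (- (real n / 32768))"
  \<comment> \<open>The deterministic part, including what integration over the second sample leaves
    behind.\<close>
  define base where "base = 162 * (\<kappa> + 1) * D2 + w * (648 * m\<^sup>2 * (12 * real k) + 52 * (L + 12)) / h
    + 24 * real r * exp (L - real n / 8192)"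
  have h0: "h > 0" using lam by (simp add: h_def hfun_def)
  have w0: "w > 0" using n by (simp add: w_def)
  have D20: "0 \<le> D2" using D zero_le_power2 by (rule order_trans[rotated])
  have L0: "0 \<le> L"
  proof -
    have "1 \<le> exp 1 * real p / real k"
      using k exp_ge_add_one_self[of "1::real"] by (simp add: le_divide_eq) (smt (verit) mult_right_mono of_nat_le_iff of_nat_0_le_iff mult_le_cancel_right1)
    then show ?thesis by (simp add: L_def)
  qed
  have c0: "0 \<le> c0" and ca: "0 \<le> ca" using w0 h0 by (auto simp: c0_def ca_def)
  have base0: "0 \<le> base" using w0 h0 D20 L0 \<kappa> by (auto simp: base_def intro!: add_nonneg_nonneg mult_nonneg_nonneg divide_nonneg_nonneg)
  have fT: "finite T" unfolding T_def by (rule finite_subset[of _ "Pow {..<p}"]) auto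
  have cT: "real (card T) \<le> exp L" unfolding T_def L_def by (rule card_subsets_le[OF k(1,3)])
  have fSB: "finite ({..<r} \<union> (+) r ` B)" "card ({..<r} \<union> (+) r ` B) \<le> 2 * k" if "B \<in> T" for B
  proof -
    have fB: "finite B" using that finite_subset by (auto simp: T_def)
    then show "finite ({..<r} \<union> (+) r ` B)" by simp
    have "card ({..<r} \<union> (+) r ` B) \<le> r + card B"
      using card_Un_le[of "{..<r}" "(+) r ` B"] card_image_le[OF fB, of "(+) r"] by simp
    then show "card ({..<r} \<union> (+) r ` B) \<le> 2 * k" using that k by (simp add: T_def)
  qed
  \<comment> \<open>A net lives on at most \<open>r + k \<le> 2 * k\<close> coordinates, whence the
    exponent \<open>6 * (2 * k)\<close>.\<close>
  have N: "finite (N B)" "real (card (N B)) \<le> exp (12 * real k)" if "B \<in> T" for B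
  proof -
    show "finite (N B)" unfolding N_def by (rule net_card(1)[OF fSB(1)[OF that]])
    have "real (card (N B)) \<le> exp (6 * real (card ({..<r} \<union> (+) r ` B)))" unfolding N_def by (rule net_card(2)[OF fSB(1)[OF that]])
    also have "\<dots> \<le> exp (12 * real k)" using fSB(2)[OF that] by simp
    finally show "real (card (N B)) \<le> exp (12 * real k)" .
  qed
  have B0T: "B0 \<in> T" using B0 by (simp add: T_def)
  have cR: "card {..<n} = n" "card {n..<2 * n} = n" by auto
  have netH: "tp (u * tp u) = u * tp u" "bnd (u * tp u) ?d" "norm (u * tp u) \<le> 1" if "u \<in> N B" for u B
    using net_props(4-6) that unfolding N_def by blast+
  have f0: "(\<lambda>g. c0 * \<Phi>0 g) \<in> borel_measurable G1" "(\<integral>\<^sup>+g. ennreal (c0 * \<Phi>0 g) \<partial>G1) \<le> ennreal (c0 * (12 * exp (12 * real k)))"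
  proof -
    show "(\<lambda>g. c0 * \<Phi>0 g) \<in> borel_measurable G1" unfolding \<Phi>0_def z1_def G1_def
      by (rule psi_sum_bound(1)[OF n cR(1) N(1)[OF B0T] c0]) (use netH in blast)+
    have "(\<integral>\<^sup>+g. ennreal (c0 * \<Phi>0 g) \<partial>G1) \<le> ennreal (c0 * (12 * real (card (N B0))))" unfolding \<Phi>0_def z1_def G1_def
      by (rule psi_sum_bound(2)[OF n cR(1) N(1)[OF B0T] c0]) (use netH in blast)+
    also have "\<dots> \<le> ennreal (c0 * (12 * exp (12 * real k)))"
      using N(2)[OF B0T] c0 by (intro ennreal_leI mult_left_mono) auto
    finally show "(\<integral>\<^sup>+g. ennreal (c0 * \<Phi>0 g) \<partial>G1) \<le> ennreal (c0 * (12 * exp (12 * real k)))" .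
  qed
  have fa: "(\<lambda>g. ca * \<Phi>a g) \<in> borel_measurable G1" "(\<integral>\<^sup>+g. ennreal (ca * \<Phi>a g) \<partial>G1) \<le> ennreal (ca * (12 * exp (L + 12 * real k)))"
  proof -
    have fS: "finite (Sigma T N)" using fT N(1) by blast
    show "(\<lambda>g. ca * \<Phi>a g) \<in> borel_measurable G1" unfolding \<Phi>a_def z1_def G1_def
      by (rule psi_sum_bound(1)[OF n cR(1) fS ca, of "\<lambda>x. snd x * tp (snd x)"]) (use netH in auto)
    have "(\<integral>\<^sup>+g. ennreal (ca * \<Phi>a g) \<partial>G1) \<le> ennreal (ca * (12 * real (card (Sigma T N))))" unfolding \<Phi>a_def z1_def G1_def
      by (rule psi_sum_bound(2)[OF n cR(1) fS ca, of "\<lambda>x. snd x * tp (snd x)"]) (use netH in auto)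
    also have "\<dots> \<le> ennreal (ca * (12 * exp (L + 12 * real k)))"
    proof -
      have "real (card (Sigma T N)) = (\<Sum>B\<in>T. real (card (N B)))"
        using card_SigmaI[OF fT, of N] N(1) by simp
      also have "\<dots> \<le> (\<Sum>B\<in>T. exp (12 * real k))" by (intro sum_mono N)
      also have "\<dots> = real (card T) * exp (12 * real k)" by simp
      also have "\<dots> \<le> exp L * exp (12 * real k)" using cT by (intro mult_right_mono) auto
      finally show ?thesis using ca by (intro ennreal_leI mult_left_mono) (auto simp: exp_add)
    qed
    finally show "(\<integral>\<^sup>+g. ennreal (ca * \<Phi>a g) \<partial>G1) \<le> ennreal (ca * (12 * exp (L + 12 * real k)))" .
  qed
  have \<Phi>pos: "0 \<le> \<Phi>0 g" "0 \<le> \<Phi>a g" for g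
    by (auto simp: \<Phi>0_def \<Phi>a_def intro!: sum_nonneg less_imp_le[OF psi_pos])
  have loss_meas: "loss \<in> borel_measurable (data_space n p r)"
  proof -
    have "(\<lambda>\<omega>. let X = data_X r V Ls \<omega> in Vsel X (Bst X) i a) \<in> borel_measurable (data_space n p r)" for i a
      using meas unfolding estimator_measurable_def by blast
    then show ?thesis unfolding loss_def[abs_def] Let_def proj_loss_def
      by (intro borel_measurable_sum borel_measurable_power borel_measurable_diff borel_measurable_times borel_measurable_const)
  qed
  have loss0: "0 \<le> loss \<omega>" for \<omega> by (simp add: loss_def Let_def proj_loss_nonneg)
  have loss2r: "loss \<omega> \<le> 2 * real r" for \<omega>
    using loss_le_2r[OF n agg, of \<omega>] by (simp add: loss_def)
  have uniq: "AE g in G1. \<forall>B\<in>T. \<forall>W W'.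
    leading_eigvecs p r (restrict_mat B (Sg n {..<n} g)) W \<longrightarrow>
    leading_eigvecs p r (restrict_mat B (Sg n {..<n} g)) W' \<longrightarrow>
    Xf n g * coord B * Pj p r W * coord B = Xf n g * coord B * Pj p r W' * coord B"
    unfolding G1_def
  proof (rule AE_finite_allI[OF fT])
    fix B assume "B \<in> T"
    then have B: "B \<subseteq> {..<p}" "card B = k" by (auto simp: T_def)
    have "leading_eigvecs p r (restrict_mat B (Sg n {..<n} g)) (Vsel (Xd r V Ls g) B)" for g
      using agg B unfolding aggregated_estimator_def S1_def Sg_def by blast
    then show "AE g in gauss ({..<n} \<times> {..<?d}). \<forall>W W'.
      leading_eigvecs p r (restrict_mat B (Sg n {..<n} g)) W \<longrightarrow>
      leading_eigvecs p r (restrict_mat B (Sg n {..<n} g)) W' \<longrightarrow>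
      Xf n g * coord B * Pj p r W * coord B = Xf n g * coord B * Pj p r W' * coord B"
      by (rule AE_leading_unique[OF B(1) n])
  qed
  have P2: "prob_space G2" and P1: "prob_space G1" unfolding G1_def G2_def by (rule prob_gauss)+
  have inner_bound: "(\<integral>\<^sup>+g2. ennreal (loss (to_data n p r (halves n ?d g1 g2))) \<partial>G2) \<le> ennreal (base + (c0 * \<Phi>0 g1 + ca * \<Phi>a g1))"
    if u: "\<forall>B\<in>T. \<forall>W W'. leading_eigvecs p r (restrict_mat B (Sg n {..<n} g1)) W \<longrightarrow>
      leading_eigvecs p r (restrict_mat B (Sg n {..<n} g1)) W' \<longrightarrow>
      Xf n g1 * coord B * Pj p r W * coord B = Xf n g1 * coord B * Pj p r W' * coord B" for g1
  proof (cases "\<forall>B\<in>T. \<forall>u\<in>N B. \<bar>z1 g1 u\<bar> \<le> 1 / 16")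
    case False
    then obtain B u where Bu: "B \<in> T" "u \<in> N B" "1 / 16 \<le> \<bar>z1 g1 u\<bar>" by force
    \<comment> \<open>On the exceptional event of the first sample the trivial bound
      \<open>2 * r\<close> is charged to \<open>\<Phi>a\<close>. The rate of decay is
      \<open>(1/16)^2 / 128 = 1 / 32768\<close>.\<close>
    have "1 \<le> exp (- (real n * (1 / 16)\<^sup>2 / 128)) * psi n (z1 g1 u)" by (rule one_le_psi) (use Bu in auto)
    also have "\<dots> \<le> exp (- (real n * (1 / 16)\<^sup>2 / 128)) * \<Phi>a g1"
    proof (rule mult_left_mono)
      show "psi n (z1 g1 u) \<le> \<Phi>a g1"
        unfolding \<Phi>a_def using Bu fT N(1) less_imp_le[OF psi_pos]
        by (intro member_le_sum[where f = "\<lambda>x. psi n (z1 g1 (snd x))" and i = "(B, u)", simplified]) auto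
    qed simp
    finally have one: "1 \<le> exp (- (real n / 32768)) * \<Phi>a g1" by (simp add: power_divide)
    have "2 * real r * 1 \<le> 2 * real r * (exp (- (real n / 32768)) * \<Phi>a g1)" by (rule mult_left_mono[OF one]) simp
    then have "2 * real r \<le> ca * \<Phi>a g1" by (simp add: ca_def mult.assoc)
    then have "loss \<omega> \<le> base + (c0 * \<Phi>0 g1 + ca * \<Phi>a g1)" for \<omega>
      using loss2r[of \<omega>] base0 mult_nonneg_nonneg[OF c0 \<Phi>pos(1)[of g1]] by linarith
    then have "(\<integral>\<^sup>+g2. ennreal (loss (to_data n p r (halves n ?d g1 g2))) \<partial>G2) \<le> (\<integral>\<^sup>+g2. ennreal (base + (c0 * \<Phi>0 g1 + ca * \<Phi>a g1)) \<partial>G2)"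
      by (intro nn_integral_mono ennreal_leI)
    then show ?thesis by (simp add: prob_space.emeasure_space_1[OF P2])
  next
    case good: True
    define Q where "Q = w * (12 * real k + exp (- (12 * real k)) * \<Phi>0 g1)"
    have Q0: "0 \<le> Q" using w0 \<Phi>pos by (simp add: Q_def)
    have Qz: "(z1 g1 u)\<^sup>2 \<le> Q" if "u \<in> N B0" for u
    proof -
      have "\<bar>z1 g1 u\<bar> \<le> 1" using good B0T that by force
      then have "(z1 g1 u)\<^sup>2 \<le> w * (12 * real k + exp (- (12 * real k)) * psi n (z1 g1 u))"
        unfolding w_def by (rule square_le_psi[OF n])
      also have "\<dots> \<le> Q"
        unfolding Q_def \<Phi>0_def using w0 that N(1)[OF B0T] less_imp_le[OF psi_pos]
        by (intro mult_left_mono add_left_mono member_le_sum) auto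
      finally show ?thesis .
    qed
    obtain H where H: "\<And>B. tp (H B) = H B" "\<And>B. bnd (H B) ?d" "\<And>B. norm (H B) \<le> 1"
      and Hb: "\<And>g2 R. 0 \<le> R \<Longrightarrow> (\<forall>B. B \<subseteq> {..<p} \<and> card B = k \<longrightarrow> \<bar>inner (gramE n {n..<2 * n} ?d g2) (H B)\<bar> \<le> 1 / 8 \<and>
        (inner (gramE n {n..<2 * n} ?d g2) (H B))\<^sup>2 \<le> R) \<Longrightarrow>
        loss (to_data n p r (halves n ?d g1 g2)) \<le> 162 * (\<kappa> + 1) * D2 + (648 * m\<^sup>2 * Q + 52 * R) / hfun lam"
      using conditional_bound[OF n k(2) B0 D m agg, of g1 Q] u good Q0 Qz unfolding T_def N_def z1_def loss_def by blast
    define z2 where "z2 g2 B = inner (gramE n {n..<2 * n} ?d g2) (H B)" for g2 B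
    define \<Phi>2 where "\<Phi>2 g2 = (\<Sum>B\<in>T. psi n (z2 g2 B))" for g2
    define A1 where "A1 = 162 * (\<kappa> + 1) * D2 + (648 * m\<^sup>2 * Q + 52 * (w * L)) / h"
    \<comment> \<open>The first summand is the maximal inequality over the candidates; the second
      charges the trivial bound when some direction exceeds \<open>1/8\<close>, with decay
      \<open>(1/8)^2 / 128 = 1 / 8192\<close>.\<close>
    define c2 where "c2 = 52 * (w * exp (- L)) / h + 2 * real r * exp (- (real n / 8192))"
    have A10: "0 \<le> A1" using D20 \<kappa> Q0 w0 L0 h0 by (simp add: A1_def)
    have c20: "0 \<le> c2" using w0 h0 by (simp add: c2_def)
    have \<Phi>20: "0 \<le> \<Phi>2 g2" for g2 by (auto simp: \<Phi>2_def intro!: sum_nonneg less_imp_le[OF psi_pos])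
    have psi2: "psi n (z2 g2 B) \<le> \<Phi>2 g2" if "B \<in> T" for g2 B
      unfolding \<Phi>2_def using that fT less_imp_le[OF psi_pos] by (intro member_le_sum) auto
    have lb: "loss (to_data n p r (halves n ?d g1 g2)) \<le> A1 + c2 * \<Phi>2 g2" for g2
    proof (cases "\<forall>B\<in>T. \<bar>z2 g2 B\<bar> \<le> 1 / 8")
      case True
      define R where "R = w * (L + exp (- L) * \<Phi>2 g2)"
      have R0: "0 \<le> R" using w0 L0 \<Phi>20 by (simp add: R_def)
      have "(z2 g2 B)\<^sup>2 \<le> R" if "B \<in> T" for B
      proof -
        have "\<bar>z2 g2 B\<bar> \<le> 1" using True that by force
        then have "(z2 g2 B)\<^sup>2 \<le> w * (L + exp (- L) * psi n (z2 g2 B))"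
          unfolding w_def by (rule square_le_psi[OF n])
        also have "\<dots> \<le> R" unfolding R_def using w0 psi2[OF that] by (intro mult_left_mono add_left_mono) auto
        finally show ?thesis .
      qed
      then have "loss (to_data n p r (halves n ?d g1 g2)) \<le> 162 * (\<kappa> + 1) * D2 + (648 * m\<^sup>2 * Q + 52 * R) / h"
        unfolding h_def using True by (intro Hb[OF R0]) (auto simp: T_def z2_def)
      also have "\<dots> = A1 + 52 * (w * exp (- L)) / h * \<Phi>2 g2"
        by (simp add: A1_def R_def distrib_left add_divide_distrib)
      also have "\<dots> \<le> A1 + c2 * \<Phi>2 g2" using \<Phi>20[of g2] by (simp add: c2_def distrib_right)
      finally show ?thesis .
    next
      case False
      then obtain B where B: "B \<in> T" "1 / 8 \<le> \<bar>z2 g2 B\<bar>" by force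
      have "1 \<le> exp (- (real n * (1 / 8)\<^sup>2 / 128)) * psi n (z2 g2 B)" by (rule one_le_psi) (use B in auto)
      also have "\<dots> \<le> exp (- (real n * (1 / 8)\<^sup>2 / 128)) * \<Phi>2 g2" using psi2[OF B(1)] by (intro mult_left_mono) auto
      finally have one: "1 \<le> exp (- (real n / 8192)) * \<Phi>2 g2" by (simp add: power_divide)
      have "2 * real r * 1 \<le> 2 * real r * (exp (- (real n / 8192)) * \<Phi>2 g2)" by (rule mult_left_mono[OF one]) simp
      also have "\<dots> \<le> c2 * \<Phi>2 g2" using w0 h0 \<Phi>20[of g2] by (simp add: c2_def distrib_right)
      finally show ?thesis using loss2r[of "to_data n p r (halves n ?d g1 g2)"] A10 by linarith
    qed
    have "(\<integral>\<^sup>+g2. ennreal (loss (to_data n p r (halves n ?d g1 g2))) \<partial>G2) \<le> (\<integral>\<^sup>+g2. ennreal (A1 + c2 * \<Phi>2 g2) \<partial>G2)"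
      by (intro nn_integral_mono ennreal_leI lb)
    also have "\<dots> \<le> ennreal (A1 + c2 * (12 * real (card T)))"
    proof (rule nn_integral_affine_le[OF P2 _ _ A10])
      show "(\<lambda>g2. c2 * \<Phi>2 g2) \<in> borel_measurable G2" unfolding \<Phi>2_def z2_def G2_def
        by (rule psi_sum_bound(1)[OF n cR(2) fT c20]) (use H in auto)
      show "(\<integral>\<^sup>+g2. ennreal (c2 * \<Phi>2 g2) \<partial>G2) \<le> ennreal (c2 * (12 * real (card T)))" unfolding \<Phi>2_def z2_def G2_def
        by (rule psi_sum_bound(2)[OF n cR(2) fT c20]) (use H in auto)
    qed (use c20 \<Phi>20 in auto)
    also have "\<dots> \<le> ennreal (base + (c0 * \<Phi>0 g1 + ca * \<Phi>a g1))"
    proof (rule ennreal_leI)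
      have "c2 * (12 * real (card T)) \<le> c2 * (12 * exp L)" using cT c20 by (intro mult_left_mono) auto
      also have "\<dots> = w * (52 * 12) / h * (exp (- L) * exp L) + 24 * real r * (exp (- (real n / 8192)) * exp L)"
        by (simp add: c2_def algebra_simps)
      also have "\<dots> = w * (52 * 12) / h + 24 * real r * exp (L - real n / 8192)"
        by (simp add: exp_add[symmetric])
      finally have "A1 + c2 * (12 * real (card T)) \<le> base + c0 * \<Phi>0 g1"
        by (simp add: A1_def base_def Q_def c0_def algebra_simps add_divide_distrib)
      then show "A1 + c2 * (12 * real (card T)) \<le> base + (c0 * \<Phi>0 g1 + ca * \<Phi>a g1)"
        using mult_nonneg_nonneg[OF ca \<Phi>pos(2)[of g1]] by linarith
    qed
    finally show ?thesis .
  qed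
  have "(\<integral>\<^sup>+\<omega>. ennreal (loss \<omega>) \<partial>data_space n p r)
     = (\<integral>\<^sup>+g1. \<integral>\<^sup>+g2. ennreal (loss (to_data n p r (halves n ?d g1 g2))) \<partial>G2 \<partial>G1)"
    unfolding G1_def G2_def by (rule nn_integral_halves) (use loss_meas in measurable)
  also have "\<dots> \<le> (\<integral>\<^sup>+g1. ennreal (base + (c0 * \<Phi>0 g1 + ca * \<Phi>a g1)) \<partial>G1)"
    by (rule nn_integral_mono_AE, rule AE_mp[OF uniq]) (intro AE_I2 impI inner_bound)
  also have "\<dots> \<le> ennreal (base + (c0 * (12 * exp (12 * real k)) + ca * (12 * exp (L + 12 * real k))))"
  proof (rule nn_integral_affine_le[OF P1 _ _ base0])
    show "(\<lambda>g. c0 * \<Phi>0 g + ca * \<Phi>a g) \<in> borel_measurable G1" by (intro borel_measurable_add f0 fa)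
    have "(\<integral>\<^sup>+g. ennreal (c0 * \<Phi>0 g + ca * \<Phi>a g) \<partial>G1) = (\<integral>\<^sup>+g. ennreal (c0 * \<Phi>0 g) + ennreal (ca * \<Phi>a g) \<partial>G1)"
      using c0 ca \<Phi>pos by (intro nn_integral_cong) simp
    also have "\<dots> = (\<integral>\<^sup>+g. ennreal (c0 * \<Phi>0 g) \<partial>G1) + (\<integral>\<^sup>+g. ennreal (ca * \<Phi>a g) \<partial>G1)"
      using f0(1) fa(1) by (intro nn_integral_add) auto
    also have "\<dots> \<le> ennreal (c0 * (12 * exp (12 * real k))) + ennreal (ca * (12 * exp (L + 12 * real k)))"
      by (intro add_mono f0 fa)
    finally show "(\<integral>\<^sup>+g. ennreal (c0 * \<Phi>0 g + ca * \<Phi>a g) \<partial>G1) \<le> ennreal (c0 * (12 * exp (12 * real k)) + ca * (12 * exp (L + 12 * real k)))"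
      using c0 ca by simp
  qed (use c0 ca \<Phi>pos in auto)
  also have "base + (c0 * (12 * exp (12 * real k)) + ca * (12 * exp (L + 12 * real k)))
    = 162 * (\<kappa> + 1) * D2 + w * (648 * m\<^sup>2 * (12 * real k + 12) + 52 * (L + 12)) / h
    + 24 * real r * (exp (L - real n / 8192) + exp (L + 12 * real k - real n / 32768))" (is "_ = ?rhs")
  proof -
    have "c0 * (12 * exp (12 * real k)) = w * (648 * m\<^sup>2 * 12) / h * (exp (- (12 * real k)) * exp (12 * real k))"
      by (simp add: c0_def algebra_simps)
    also have "\<dots> = w * (648 * m\<^sup>2 * 12) / h" by (simp add: exp_add[symmetric])
    finally have 1: "c0 * (12 * exp (12 * real k)) = w * (648 * m\<^sup>2 * 12) / h" .
    have 2: "ca * (12 * exp (L + 12 * real k)) = 24 * real r * exp (L + 12 * real k - real n / 32768)"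
      by (simp add: ca_def exp_add[symmetric] mult_ac)
    show ?thesis unfolding 1 2 base_def by (simp add: algebra_simps add_divide_distrib)
  qed
  finally have fin: "(\<integral>\<^sup>+\<omega>. ennreal (loss \<omega>) \<partial>data_space n p r) \<le> ennreal ?rhs" .
  have rhs0: "0 \<le> ?rhs" using D20 \<kappa> w0 h0 L0 by (intro add_nonneg_nonneg mult_nonneg_nonneg divide_nonneg_nonneg) auto
  have "expected_loss n p r Vsel Bst V Ls = enn2real (\<integral>\<^sup>+\<omega>. ennreal (loss \<omega>) \<partial>data_space n p r)"
    unfolding expected_loss_def loss_def[symmetric] using loss_meas loss0 by (intro integral_eq_nn_integral) auto
  also have "\<dots> \<le> ?rhs" by (rule enn2real_leI[OF rhs0 fin])
  finally show ?thesis by (simp add: w_def h_def)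
qed

lemma expected_loss_le:
  assumes n: "n > 0" and agg: "aggregated_estimator n p r k Vsel Bst"
  shows "expected_loss n p r Vsel Bst V Ls \<le> 2 * real (min r (p - r))"
proof -
  interpret prob_space "data_space n p r" by (rule prob_data_space)
  show ?thesis
  proof (cases "integrable (data_space n p r) (\<lambda>\<omega>. let X = data_X r V Ls \<omega> in proj_loss p r (Vsel X (Bst X)) V)")
    case True
    then have "expected_loss n p r Vsel Bst V Ls \<le> (\<integral>\<omega>. 2 * real (min r (p - r)) \<partial>data_space n p r)"
      unfolding expected_loss_def by (intro integral_mono loss_le_2r[OF n agg]) auto
    then show ?thesis by (simp add: prob_space)
  next
    \<comment> \<open>The integral of a non-integrable function is zero by convention, so the bound
      persists.\<close>
    case False
    then show ?thesis by (simp add: expected_loss_def not_integrable_integral_eq)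
  qed
qed

end

section \<open>Effective dimension\<close>

text \<open>Integral comparison in discrete form: by the mean value theorem each term is at most a
  difference of powers, and these telescope.\<close>

lemma powr_tail_sum:
  fixes b :: real
  assumes b: "b > 1" and k: "1 \<le> k"
  shows "(\<Sum>j\<in>{k<..p}. real j powr (- b)) \<le> real k powr (1 - b) / (b - 1)"
proof -
  have step: "real (Suc j) powr (- b) \<le> (real j powr (1 - b) - real (Suc j) powr (1 - b)) / (b - 1)" if "1 \<le> j" for j
  proof -
    have "\<exists>z>real j. z < real (Suc j) \<and> real (Suc j) powr (1 - b) - real j powr (1 - b) = (real (Suc j) - real j) * ((1 - b) * z powr (1 - b - 1))"
      by (rule MVT2) (use that in \<open>auto intro!: derivative_eq_intros\<close>)
    then obtain z where z: "real j < z" "z < real (Suc j)"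
      "real (Suc j) powr (1 - b) - real j powr (1 - b) = (1 - b) * z powr (- b)" by auto
    have "real (Suc j) powr (- b) \<le> z powr (- b)" using z that b by (intro powr_mono2') auto
    then have "(b - 1) * real (Suc j) powr (- b) \<le> (b - 1) * z powr (- b)" using b by (intro mult_left_mono) auto
    also have "\<dots> = real j powr (1 - b) - real (Suc j) powr (1 - b)" using z(3) by (simp add: algebra_simps)
    finally show ?thesis using b by (simp add: pos_le_divide_eq mult.commute)
  qed
  have "(\<Sum>j\<in>{k<..k + m}. real j powr (- b)) \<le> (real k powr (1 - b) - real (k + m) powr (1 - b)) / (b - 1)" for m
  proof (induction m)
    case (Suc m)
    have "{k<..k + Suc m} = insert (Suc (k + m)) {k<..k + m}" by auto
    then have "(\<Sum>j\<in>{k<..k + Suc m}. real j powr (- b)) = real (Suc (k + m)) powr (- b) + (\<Sum>j\<in>{k<..k + m}. real j powr (- b))"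
      by simp
    also have "\<dots> \<le> (real (k + m) powr (1 - b) - real (Suc (k + m)) powr (1 - b)) / (b - 1)
        + (real k powr (1 - b) - real (k + m) powr (1 - b)) / (b - 1)"
      by (intro add_mono step Suc.IH) (use k in simp)
    finally show ?case by (simp add: diff_divide_distrib)
  qed simp
  note sums = this
  show ?thesis
  proof (cases "k \<le> p")
    case True
    have "(\<Sum>j\<in>{k<..p}. real j powr (- b)) \<le> (real k powr (1 - b) - real p powr (1 - b)) / (b - 1)"
      using sums[of "p - k"] True by simp
    also have "\<dots> \<le> real k powr (1 - b) / (b - 1)" using b by (intro divide_right_mono) auto
    finally show ?thesis .
  next
    case False
    then show ?thesis using b by simp
  qed
qed

lemma weak_lq_rows:
  assumes q: "0 < q" and s: "weak_lq q p r V \<le> s"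
  obtains \<sigma> where "bij_betw \<sigma> {..<p} {..<p}" "\<And>j. j < p \<Longrightarrow> real (Suc j) * row_norm r V (\<sigma> j) powr q \<le> s"
proof -
  let ?f = "row_norm r V"
  define xs where "xs = rev (sort_key ?f [0..<p])"
  have len: "length xs = p" by (simp add: xs_def)
  have "sort (map ?f [0..<p]) = map ?f (sort_key ?f [0..<p])" by (rule properties_for_sort) auto
  then have L: "rev (sort (map ?f [0..<p])) = map ?f xs" by (simp add: xs_def rev_map)
  have "bij_betw ((!) xs) {..<p} {..<p}"
    by (rule bij_betw_nth) (auto simp: xs_def)
  moreover have "real (Suc j) * ?f (xs ! j) powr q \<le> s" if j: "j < p" for j
  proof -
    let ?M = "insert 0 ((\<lambda>j. real j * (map ?f xs ! (j - 1)) powr q) ` {1..p})"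
    \<comment> \<open>The weak norm counts positions from one, lists from zero; position
      \<open>Suc j\<close> is list index \<open>j\<close>.\<close>
    have "real (Suc j) * ?f (xs ! j) powr q = (\<lambda>j. real j * (map ?f xs ! (j - 1)) powr q) (Suc j)"
      using j len by simp
    then have "real (Suc j) * ?f (xs ! j) powr q \<in> ?M" using j by (intro insertI2 image_eqI[of _ _ "Suc j"]) auto
    then have "real (Suc j) * ?f (xs ! j) powr q \<le> Max ?M" by (intro Max_ge) auto
    also have "\<dots> \<le> s" using s q unfolding weak_lq_def Let_def L by simp
    finally show ?thesis .
  qed
  ultimately show ?thesis by (rule that)
qed

text \<open>The row at position \<open>j\<close> has squared norm at most
  \<open>(s / j) powr (2 / q)\<close>, summable because \<open>q < 2\<close>, and
  \<open>1 / (2 / q - 1) = q / (2 - q)\<close>. The bound is set to zero at \<open>k = p\<close>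
  because the balance of the effective dimension is available only below \<open>p\<close>.\<close>

lemma weak_lq_tail:
  assumes q: "0 < q" "q < 2" and s: "weak_lq q p r V \<le> s" "0 \<le> s" and k: "1 \<le> k" "k \<le> p"
  obtains B where "B \<subseteq> {..<p}" "card B = k"
    "(\<Sum>i\<in>{..<p} - B. (row_norm r V i)\<^sup>2) \<le> (if k < p then q / (2 - q) * (real k * (s / real k) powr (2 / q)) else 0)"
proof -
  obtain \<sigma> where \<sigma>: "bij_betw \<sigma> {..<p} {..<p}" "\<And>j. j < p \<Longrightarrow> real (Suc j) * row_norm r V (\<sigma> j) powr q \<le> s"
    using weak_lq_rows[OF q(1) s(1)] by blast
  define B where "B = \<sigma> ` {..<k}"
  define b where "b = 2 / q"
  have b: "b > 1" using q by (simp add: b_def)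
  have inj: "inj_on \<sigma> {..<p}" using \<sigma>(1) by (simp add: bij_betw_def)
  have im: "\<sigma> ` {..<p} = {..<p}" using \<sigma>(1) by (simp add: bij_betw_def)
  have B1: "B \<subseteq> {..<p}" using im k by (auto simp: B_def)
  have B2: "card B = k" unfolding B_def using card_image[OF inj_on_subset[OF inj, of "{..<k}"]] k by auto
  have rest: "{..<p} - B = \<sigma> ` {k..<p}"
  proof -
    have "\<sigma> ` ({..<p} - {..<k}) = \<sigma> ` {..<p} - \<sigma> ` {..<k}"
      by (rule inj_on_image_set_diff[OF inj]) (use k in auto)
    then have "{..<p} - B = \<sigma> ` ({..<p} - {..<k})" by (simp add: B_def im)
    moreover have "{..<p} - {..<k} = {k..<p}" by auto
    ultimately show ?thesis by simp
  qed
  have row: "(row_norm r V (\<sigma> j))\<^sup>2 \<le> s powr b * real (Suc j) powr (- b)" if "j < p" for j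
  proof -
    let ?x = "row_norm r V (\<sigma> j)"
    have x0: "0 \<le> ?x" by (simp add: row_norm_def sum_nonneg)
    have "?x powr q \<le> s / real (Suc j)" using \<sigma>(2)[OF that] by (simp add: pos_le_divide_eq mult.commute)
    then have "(?x powr q) powr b \<le> (s / real (Suc j)) powr b" using b by (intro powr_mono2) auto
    moreover have "(?x powr q) powr b = ?x\<^sup>2" using q x0 by (simp add: powr_powr b_def)
    moreover have "(s / real (Suc j)) powr b = s powr b / real (Suc j) powr b"
      by (rule powr_divide)
    then have "(s / real (Suc j)) powr b = s powr b * real (Suc j) powr (- b)"
      by (simp only: powr_minus divide_inverse)
    ultimately show ?thesis by simp
  qed
  have "(\<Sum>i\<in>{..<p} - B. (row_norm r V i)\<^sup>2) = (\<Sum>j\<in>{k..<p}. (row_norm r V (\<sigma> j))\<^sup>2)"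
    unfolding rest using sum.reindex[OF inj_on_subset[OF inj, of "{k..<p}"]] by (auto simp: subset_iff)
  also have "\<dots> \<le> (\<Sum>j\<in>{k..<p}. s powr b * real (Suc j) powr (- b))" by (intro sum_mono row) auto
  also have "\<dots> = s powr b * (\<Sum>j\<in>{k..<p}. real (Suc j) powr (- b))" by (simp add: sum_distrib_left)
  also have "(\<Sum>j\<in>{k..<p}. real (Suc j) powr (- b)) = (\<Sum>j\<in>{k<..p}. real j powr (- b))"
  proof -
    have "{k<..p} = Suc ` {k..<p}" by (auto simp: image_iff)
    then show ?thesis by (simp only: sum.reindex[OF inj_Suc] comp_def)
  qed
  finally have t: "(\<Sum>i\<in>{..<p} - B. (row_norm r V i)\<^sup>2) \<le> s powr b * (\<Sum>j\<in>{k<..p}. real j powr (- b))" .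
  have "s powr b * (\<Sum>j\<in>{k<..p}. real j powr (- b)) \<le> s powr b * (real k powr (1 - b) / (b - 1))"
    by (intro mult_left_mono powr_tail_sum b k) auto
  also have "\<dots> = q / (2 - q) * (real k * (s / real k) powr b)"
  proof -
    have "real k powr (1 - b) = real k * real k powr (- b)" using k powr_add[of "real k" 1 "- b"] by simp
    moreover have "(s / real k) powr b = s powr b / real k powr b"
      by (rule powr_divide)
    then have "(s / real k) powr b = s powr b * real k powr (- b)"
      by (simp only: powr_minus divide_inverse)
    moreover have "1 / (b - 1) = q / (2 - q)" using q by (simp add: b_def field_simps)
    ultimately show ?thesis by (simp add: divide_inverse mult_ac)
  qed
  finally have "(\<Sum>i\<in>{..<p} - B. (row_norm r V i)\<^sup>2) \<le> q / (2 - q) * (real k * (s / real k) powr (2 / q))"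
    using t by (simp add: b_def)
  moreover have "(\<Sum>i\<in>{..<p} - B. (row_norm r V i)\<^sup>2) = 0" if "\<not> k < p"
    unfolding rest using that by simp
  ultimately have "(\<Sum>i\<in>{..<p} - B. (row_norm r V i)\<^sup>2)
      \<le> (if k < p then q / (2 - q) * (real k * (s / real k) powr (2 / q)) else 0)"
    by (cases "k < p") auto
  then show ?thesis by (rule that[OF B1 B2])
qed

lemma x_eff_upper:
  assumes x: "0 \<le> x" "x \<le> real p" "x \<le> s * (real n * hfun lam / (real r + ln (exp 1 * real p / x))) powr (q / 2)"
  shows "x \<le> x_eff q s p r n lam"
  unfolding x_eff_def by (rule cSup_upper) (use x in \<open>auto intro!: bdd_aboveI[of _ "real p"]\<close>)

lemma ln_ep_ge: "0 < x \<Longrightarrow> x \<le> real p \<Longrightarrow> 1 \<le> ln (exp 1 * real p / x)"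
proof -
  assume x: "0 < x" "x \<le> real p"
  then have "exp 1 \<le> exp 1 * real p / x" by (simp add: pos_le_divide_eq)
  then have "ln (exp 1) \<le> ln (exp 1 * real p / x)" using x by (subst ln_le_cancel_iff) (auto intro!: divide_pos_pos)
  then show ?thesis by simp
qed

text \<open>The right side of the defining inequality grows with \<open>x\<close>, because
  \<open>ln (exp 1 * p / x)\<close> falls. If it still exceeded \<open>k\<close> at
  \<open>k < p\<close>, a larger point would be admissible, against the choice of the supremum.
  Rearranged at \<open>k\<close>, this balances the tail against the stochastic error.\<close>

lemma k_eff_balance:
  assumes q: "0 < q" "q < 2" and s: "0 \<le> s" and lam: "lam > 0" and n: "n > 0"
    and k: "k = k_eff q s p r n lam" "1 \<le> k" "k < p"
  shows "(s / real k) powr (2 / q) \<le> (real r + ln (exp 1 * real p / real k)) / (real n * hfun lam)"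
proof -
  define R where "R x = s * (real n * hfun lam / (real r + ln (exp 1 * real p / x))) powr (q / 2)" for x
  have nh: "real n * hfun lam > 0" using lam n by (simp add: hfun_def)
  have "R (real k) \<le> real k"
  proof (rule ccontr)
    assume c: "\<not> R (real k) \<le> real k"
    \<comment> \<open>Any point above \<open>k\<close> and below both \<open>p\<close> and the value
      of the right side at \<open>k\<close> is admissible by monotonicity.\<close>
    define x where "x = min (real p) (R (real k))"
    have x: "real k < x" "x \<le> real p" "x \<le> R (real k)" "0 < x" using c k by (auto simp: x_def)
    have "R (real k) \<le> R x"
    proof -
      have 1: "1 \<le> ln (exp 1 * real p / x)" by (rule ln_ep_ge) (use x in auto)
      have "ln (exp 1 * real p / x) \<le> ln (exp 1 * real p / real k)"
        using x k by (subst ln_le_cancel_iff) (auto intro!: divide_pos_pos divide_left_mono)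
      then have "real n * hfun lam / (real r + ln (exp 1 * real p / real k)) \<le> real n * hfun lam / (real r + ln (exp 1 * real p / x))"
        using nh 1 by (intro divide_left_mono mult_pos_pos) (auto intro: add_nonneg_pos)
      moreover have "0 \<le> real n * hfun lam / (real r + ln (exp 1 * real p / real k))"
        using nh ln_ep_ge[of "real k" p] k by (intro divide_nonneg_nonneg) auto
      ultimately show ?thesis unfolding R_def using s q by (intro mult_left_mono powr_mono2) auto
    qed
    then have "x \<le> x_eff q s p r n lam" using x by (intro x_eff_upper) (auto simp: R_def)
    also have "\<dots> \<le> real k" using k q by (simp add: k_eff_def) (use of_nat_ceiling in blast)
    finally show False using x by simp
  qed
  have den: "0 < real r + ln (exp 1 * real p / real k)" using ln_ep_ge[of "real k" p] k by auto
  define u where "u = real n * hfun lam / (real r + ln (exp 1 * real p / real k))"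
  have u: "u > 0" using nh den by (simp add: u_def)
  have "s * u powr (q / 2) \<le> real k" using \<open>R (real k) \<le> real k\<close> by (simp add: R_def u_def)
  moreover have "s / y \<le> 1 / U" if "s * U \<le> y" "0 < U" "0 < y" for U y :: real
    using that by (simp add: field_simps)
  ultimately have "s / real k \<le> u powr (- (q / 2))"
    unfolding powr_minus_divide using u k(2) by simp
  then have "(s / real k) powr (2 / q) \<le> (u powr (- (q / 2))) powr (2 / q)" using s q by (intro powr_mono2) auto
  also have "\<dots> = u powr (- 1)" using q by (simp only: powr_powr) simp
  also have "\<dots> = 1 / u" using u by (simp only: powr_minus_divide) simp
  finally show ?thesis by (simp add: u_def)
qed

text \<open>Close to zero the denominator grows at most like \<open>1 / x\<close>, so the right side
  decays no faster than \<open>x powr (q / 2)\<close>. Since \<open>q < 2\<close>, this beats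
  \<open>x\<close> itself and some positive \<open>x\<close> is admissible.\<close>

lemma k_eff_pos:
  assumes q: "0 < q" "q < 2" and s: "0 < s" and lam: "lam > 0" and n: "n > 0" and p: "p > 0"
  shows "1 \<le> k_eff q s p r n lam"
proof -
  have nh: "real n * hfun lam > 0" using lam n by (simp add: hfun_def)
  define c where "c = (real r + exp 1) * real p"
  have c: "c > 0" using p by (simp add: c_def add_nonneg_pos)
  define A where "A = s * (real n * hfun lam / c) powr (q / 2)"
  have "real n * hfun lam / c > 0" using nh c by (rule divide_pos_pos)
  then have "0 < (real n * hfun lam / c) powr (q / 2)" unfolding powr_gt_zero by linarith
  then have A: "A > 0" unfolding A_def by (intro mult_pos_pos s)
  \<comment> \<open>The second entry solves \<open>x = A * x powr (q / 2)\<close>.\<close>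
  define x where "x = min (real p) (A powr (1 / (1 - q / 2)))"
  have x: "0 < x" "x \<le> real p" "x \<le> A powr (1 / (1 - q / 2))" using p A by (auto simp: x_def)
  have den0: "0 < real r + ln (exp 1 * real p / x)" using ln_ep_ge[OF x(1,2)] by (simp add: add_nonneg_pos)
  have "ln (exp 1 * real p / x) \<le> exp 1 * real p / x"
    using x p ln_le_minus_one[of "exp 1 * real p / x"] by simp
  moreover have "real r \<le> real r * real p / x" using x by (simp add: pos_le_divide_eq mult_left_mono)
  ultimately have den: "real r + ln (exp 1 * real p / x) \<le> c / x"
    by (simp add: c_def distrib_right add_divide_distrib)
  have "real n * hfun lam / c * x = real n * hfun lam / (c / x)" using x c by simp
  also have "\<dots> \<le> real n * hfun lam / (real r + ln (exp 1 * real p / x))"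
    using den den0 nh x c by (intro divide_left_mono) auto
  finally have "(real n * hfun lam / c * x) powr (q / 2) \<le> (real n * hfun lam / (real r + ln (exp 1 * real p / x))) powr (q / 2)"
    using nh c x q by (intro powr_mono2) auto
  then have 1: "A * x powr (q / 2) \<le> s * (real n * hfun lam / (real r + ln (exp 1 * real p / x))) powr (q / 2)"
    using s by (simp only: A_def powr_mult mult.assoc mult_le_cancel_left_pos)
  have "x powr (1 - q / 2) \<le> (A powr (1 / (1 - q / 2))) powr (1 - q / 2)" using x q by (intro powr_mono2) auto
  also have "\<dots> = A" using A q by (simp add: powr_powr)
  finally have "x powr (1 - q / 2) * x powr (q / 2) \<le> A * x powr (q / 2)" by (rule mult_right_mono) simp
  also have "x powr (1 - q / 2) * x powr (q / 2) = x" using x by (simp add: powr_add[symmetric])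
  finally have "x \<le> x_eff q s p r n lam" using 1 x by (intro x_eff_upper) auto
  then have "0 < x_eff q s p r n lam" using x by simp
  then show ?thesis using q by (simp add: k_eff_def Suc_le_eq)
qed

section \<open>From the risk bound to the rate\<close>

context spiked
begin

lemma norm_tail_rows:
  assumes "B \<subseteq> {..<p}"
  shows "(norm ((Ip - coord B) * Vf))\<^sup>2 = (\<Sum>i\<in>{..<p} - B. (row_norm r V i)\<^sup>2)"
proof -
  have fB: "finite B" using assms finite_subset by blast
  have e: "ent ((Ip - coord B) * Vf) i a = (if i \<in> {..<p} - B \<and> a < r then V i a else 0)" for i a
    using fB by (auto simp: left_diff_distrib ent_coord_l)
  have b: "bnd ((Ip - coord B) * Vf) (max p r)" by (auto simp: bnd_def e)
  have "(norm ((Ip - coord B) * Vf))\<^sup>2 = (\<Sum>i<max p r. if i \<in> {..<p} - B then (\<Sum>a<r. (V i a)\<^sup>2) else 0)"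
    unfolding norm_fmat_sq[OF b]
  proof (intro sum.cong refl)
    fix i
    show "(\<Sum>j<max p r. (ent ((Ip - coord B) * Vf) i j)\<^sup>2) = (if i \<in> {..<p} - B then (\<Sum>a<r. (V i a)\<^sup>2) else 0)"
      unfolding e by (auto intro!: sum.mono_neutral_cong_right split: if_splits)
  qed
  also have "\<dots> = (\<Sum>i\<in>{..<p} - B. \<Sum>a<r. (V i a)\<^sup>2)"
    by (intro sum.mono_neutral_cong_right) auto
  finally show ?thesis by (simp add: row_norm_def sum_nonneg)
qed

text \<open>The trace of the true projection splits into the rows in \<open>B\<close>, which carry
  at most \<open>card B\<close>, and the tail. A tail below one then gives \<open>r \<le> k\<close>
  by integrality.\<close>

lemma rank_le_card_plus_tail:
  assumes "B \<subseteq> {..<p}"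
  shows "real r \<le> real (card B) + (norm ((Ip - coord B) * Vf))\<^sup>2"
proof -
  have fB: "finite B" using assms finite_subset by blast
  have "real r = (norm (Pj p r V))\<^sup>2" by (simp add: norm_Pj V)
  also have "\<dots> = (norm (coord B * Pj p r V))\<^sup>2 + (norm (Pj p r V - coord B * Pj p r V))\<^sup>2"
    by (rule proj_pythag[OF proj_coord[OF fB]])
  also have "Pj p r V - coord B * Pj p r V = (Ip - coord B) * Pj p r V" by (simp add: left_diff_distrib coord_Pj)
  also have "norm ((Ip - coord B) * Pj p r V) = norm ((Ip - coord B) * Vf)" by (rule norm_mult_Pj[OF V])
  also have "(norm (coord B * Pj p r V))\<^sup>2 \<le> (norm (coord B))\<^sup>2"
    by (intro power_mono proj_norm_le_r proj_Pj V) auto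
  finally show ?thesis by (simp add: norm_coord fB)
qed

text \<open>Exceptional events must be small against \<open>1 / (n * hfun lam)\<close>. As
  \<open>hfun lam \<le> lam\<close>, this is where \<open>ln lam\<close> must be small against
  \<open>n\<close>.\<close>

lemma exp_tail_bound:
  assumes n: "n > 0" and L: "1 \<le> L" "real r \<le> L" and C0: "10 ^ 6 * ln lam \<le> real n" and y: "y \<le> - real n / 65536"
  shows "24 * real r * exp y \<le> 4 * 10 ^ 6 * L / (real n * hfun lam)"
proof -
  have h: "0 < hfun lam" "hfun lam \<le> lam" using lam by (auto simp: hfun_def power2_eq_square pos_divide_le_eq)
  have "lam = exp (ln lam)" using lam by simp
  also have "\<dots> \<le> exp (real n / 10 ^ 6)" using C0 by simp
  finally have lamn: "lam \<le> exp (real n / 10 ^ 6)" .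
  have "real n / 131072 \<le> exp (real n / 131072)" using exp_ge_add_one_self[of "real n / 131072"] by linarith
  then have nb: "real n \<le> 131072 * exp (real n / 131072)" by simp
  \<comment> \<open>Half of the decay \<open>n / 65536\<close> pays for the factor \<open>n\<close>,
    the other half for \<open>lam \<le> exp (n / 10^6)\<close>.\<close>
  have "real n * hfun lam * exp y \<le> (131072 * exp (real n / 131072)) * exp (real n / 10 ^ 6) * exp (- real n / 65536)"
    using h lamn nb y by (intro mult_mono) auto
  also have "\<dots> = 131072 * exp (real n / 131072 + real n / 10 ^ 6 + - real n / 65536)" by (simp only: exp_add mult.assoc)
  also have "\<dots> \<le> 131072 * exp 0" using n by (intro mult_left_mono) (auto simp: field_simps)
  finally have e: "exp y \<le> 131072 / (real n * hfun lam)"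
    using n h by (simp add: pos_le_divide_eq mult.commute)
  have "24 * real r * exp y \<le> 24 * L * (131072 / (real n * hfun lam))"
    using L e by (intro mult_mono) auto
  also have "\<dots> \<le> 4 * 10 ^ 6 * L / (real n * hfun lam)"
    using L n h by (simp add: divide_right_mono)
  finally show ?thesis .
qed

text \<open>Here \<open>m\<close> bounds the rank or the corank itself, so its square root is passed
  to \<open>core_bound\<close>. Additive constants are absorbed by
  \<open>1 \<le> k \<le> L\<close>.\<close>

lemma rate_bound:
  assumes n: "n > 0" and r: "1 \<le> r" "r \<le> k" and k: "k \<le> p" and B0: "B0 \<subseteq> {..<p}" "card B0 = k"
    and D: "(norm ((Ip - coord B0) * Vf))\<^sup>2 \<le> D2" and m: "m \<ge> 0" "real r \<le> m \<or> real k - real r \<le> m"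
    and agg: "aggregated_estimator n p r k Vsel Bst" and meas: "estimator_measurable n p r Vsel Bst V Ls"
  defines "L \<equiv> real k * ln (exp 1 * real p / real k)"
  assumes n1: "10 ^ 6 * L \<le> real n" and n2: "10 ^ 6 * ln lam \<le> real n"
  shows "expected_loss n p r Vsel Bst V Ls \<le> 162 * (\<kappa> + 1) * D2 + 10 ^ 7 * (m * real k + L) / (real n * hfun lam)"
proof -
  have n1': "1000000 * L \<le> real n" using n1 by simp
  have k1: "1 \<le> k" using r by simp
  have h: "0 < hfun lam" using lam by (auto simp: hfun_def)
  have kL: "real k \<le> L"
    using mult_left_mono[OF ln_ep_ge[of "real k" p], of "real k"] k k1 by (simp add: L_def)
  have L1: "1 \<le> L" "real r \<le> L" using kL k1 r by linarith+
  have "expected_loss n p r Vsel Bst V Ls \<le> 162 * (\<kappa> + 1) * D2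
    + 128 / real n * (648 * (sqrt m)\<^sup>2 * (12 * real k + 12) + 52 * (L + 12)) / hfun lam
    + 24 * real r * (exp (L - real n / 8192) + exp (L + 12 * real k - real n / 32768))"
    unfolding L_def by (rule core_bound[OF n k1 r(2) k B0 D _ _ agg meas]) (use m in auto)
  also have "128 / real n * (648 * (sqrt m)\<^sup>2 * (12 * real k + 12) + 52 * (L + 12)) / hfun lam
      \<le> 128 * (648 * m * (24 * real k) + 52 * (13 * L)) / (real n * hfun lam)"
  proof -
    have "648 * (sqrt m)\<^sup>2 * (12 * real k + 12) + 52 * (L + 12) \<le> 648 * m * (24 * real k) + 52 * (13 * L)"
    proof -
      have "648 * m * (12 * real k + 12) \<le> 648 * m * (24 * real k)" using m(1) k1 by (intro mult_left_mono) auto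
      moreover have "(sqrt m)\<^sup>2 = m" using m(1) by simp
      ultimately show ?thesis using L1 by simp
    qed
    then have "128 * (648 * (sqrt m)\<^sup>2 * (12 * real k + 12) + 52 * (L + 12)) / (real n * hfun lam)
      \<le> 128 * (648 * m * (24 * real k) + 52 * (13 * L)) / (real n * hfun lam)"
      using n h by (intro divide_right_mono mult_left_mono) auto
    then show ?thesis by simp
  qed
  \<comment> \<open>The product \<open>128 * 648 * 24\<close> is just below \<open>2 * 10^6\<close>;
    with twice \<open>4 * 10^6\<close> from the tails the total is \<open>10^7\<close>.\<close>
  also have "128 * (648 * m * (24 * real k) + 52 * (13 * L)) / (real n * hfun lam) \<le> 2 * 10 ^ 6 * (m * real k + L) / (real n * hfun lam)"
  proof -
    have "0 \<le> m * real k" using m by simp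
    then show ?thesis using L1 n h by (intro divide_right_mono) auto
  qed
  \<comment> \<open>The threshold \<open>10^6\<close> is sufficient here:
    \<open>L + 12 * k \<le> 13 * L \<le> 13 * n / 10^6\<close>, and this is below
    \<open>n / 65536\<close>, half of the available decay \<open>n / 32768\<close>.\<close>
  also have "24 * real r * (exp (L - real n / 8192) + exp (L + 12 * real k - real n / 32768))
      \<le> 4 * 10 ^ 6 * L / (real n * hfun lam) + 4 * 10 ^ 6 * L / (real n * hfun lam)"
    unfolding distrib_left
    by (intro add_mono exp_tail_bound n L1 n2) (use n1' kL L1 in linarith)+
  also have "162 * (\<kappa> + 1) * D2 + 2 * 10 ^ 6 * (m * real k + L) / (real n * hfun lam) + (4 * 10 ^ 6 * L / (real n * hfun lam) + 4 * 10 ^ 6 * L / (real n * hfun lam))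
    \<le> 162 * (\<kappa> + 1) * D2 + 10 ^ 7 * (m * real k + L) / (real n * hfun lam)"
  proof -
    have "2 * 10 ^ 6 * (m * real k + L) + (4 * 10 ^ 6 * L + 4 * 10 ^ 6 * L) \<le> 10 ^ 7 * (m * real k + L)"
      using mult_nonneg_nonneg[OF m(1), of "real k"] by simp
    then have "(2 * 10 ^ 6 * (m * real k + L) + (4 * 10 ^ 6 * L + 4 * 10 ^ 6 * L)) / (real n * hfun lam) \<le> 10 ^ 7 * (m * real k + L) / (real n * hfun lam)"
      using n h by (intro divide_right_mono) auto
    moreover have "(x + (y + z)) / w = x / w + (y / w + z / w)" for x y z w :: real by (simp only: add_divide_distrib)
    ultimately show ?thesis by (simp only:)
  qed
  finally show ?thesis by simp
qed

end

section \<open>Rates\<close>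

lemma spiked_in_Theta:
  assumes "\<kappa> > 1" "in_Theta \<kappa> q s p r lam V Ls"
  shows "spiked r p V Ls lam \<kappa>"
  using assms unfolding in_Theta_def spiked_def by auto

lemma aggregated_card_le: "aggregated_estimator n p r k Vsel Bst \<Longrightarrow> k \<le> p"
  unfolding aggregated_estimator_def using card_mono[of "{..<p}"] by (metis card_lessThan finite_lessThan)

lemma entropy_nonneg: "k \<le> p \<Longrightarrow> 0 \<le> real k * ln (exp 1 * real p / real k)"
proof (cases "k = 0")
  case False
  moreover assume "k \<le> p"
  ultimately have "1 \<le> ln (exp 1 * real p / real k)" by (intro ln_ep_ge) auto
  then show ?thesis by (intro mult_nonneg_nonneg) auto
qed simp

text \<open>A set of size \<open>k\<close> contains all nonzero rows, so there is no tail: this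
  gives \<open>r \<le> k\<close> without a lower bound on \<open>n * hfun lam\<close> and leaves
  only the stochastic error.\<close>

lemma exact_sparse_rate:
  assumes \<kappa>: "\<kappa> > 1" and n: "n \<ge> 1" and k: "k = k_eff 0 s p r n lam"
    and n1: "10 ^ 6 * max (real k * ln (exp 1 * real p / real k)) (ln lam) \<le> real n"
    and agg: "aggregated_estimator n p r k Vsel Bst"
    and Th: "in_Theta \<kappa> 0 s p r lam V Ls" and meas: "estimator_measurable n p r Vsel Bst V Ls"
  shows "expected_loss n p r Vsel Bst V Ls \<le> min (2 * real (min r (p - r))) (2 * 10 ^ 7 * Psi0 k p r n lam)" "r \<le> k"
proof -
  interpret spiked r p V Ls lam \<kappa> by (rule spiked_in_Theta[OF \<kappa> Th])
  have n0: "n > 0" using n by simp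
  have kp: "k \<le> p" by (rule aggregated_card_le[OF agg])
  define L where "L = real k * ln (exp 1 * real p / real k)"
  have L0: "0 \<le> L" unfolding L_def by (rule entropy_nonneg[OF kp])
  have nh: "0 < real n * hfun lam" using n0 lam by (simp add: hfun_def)
  define S where "S = {i \<in> {..<p}. row_norm r V i \<noteq> 0}"
  have "real (card S) \<le> s" using Th by (simp add: in_Theta_def weak_lq_def S_def)
  then have Sk: "card S \<le> k" unfolding k k_eff_def by simp linarith
  have "\<exists>B. S \<subseteq> B \<and> B \<subseteq> {..<p} \<and> card B = k"
    using exists_subset_between[of S k "{..<p}"] Sk kp by (auto simp: S_def)
  then obtain B where B: "S \<subseteq> B" "B \<subseteq> {..<p}" "card B = k" by blast
  have tail: "(norm ((Ip - coord B) * Vf))\<^sup>2 = 0"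
    unfolding norm_tail_rows[OF B(2)] using B(1) by (intro sum.neutral) (auto simp: S_def)
  show rk: "r \<le> k" using rank_le_card_plus_tail[OF B(2)] tail B(3) by simp
  have "expected_loss n p r Vsel Bst V Ls \<le> 2 * 10 ^ 7 * Psi0 k p r n lam"
  \<comment> \<open>Without factors \<open>k\<close> may be zero, where the entropy estimates fail;
    the trivial bound is then zero.\<close>
  proof (cases "r = 0")
    case True
    then have "expected_loss n p r Vsel Bst V Ls \<le> 0" using expected_loss_le[OF n0 agg] by simp
    also have "0 \<le> 2 * 10 ^ 7 * Psi0 k p r n lam"
      using True L0 nh by (simp add: Psi0_def L_def[symmetric])
    finally show ?thesis .
  next
    case False
    define m where "m = min (real r) (real k - real r)"
    have m: "0 \<le> m" "m \<le> real r" "m \<le> real k - real r" using rk by (auto simp: m_def)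
    have "expected_loss n p r Vsel Bst V Ls \<le> 162 * (\<kappa> + 1) * 0 + 10 ^ 7 * (m * real k + L) / (real n * hfun lam)"
      unfolding L_def
      by (rule rate_bound[OF n0 _ rk kp B(2,3) _ m(1) _ agg meas]) (use False tail n1 in \<open>auto simp: m_def\<close>)
    also have "\<dots> \<le> 10 ^ 7 * (2 * (real r * (real k - real r) + L)) / (real n * hfun lam)"
    proof -
      \<comment> \<open>Writing \<open>m * k\<close> as \<open>m * (k - r) + m * r\<close> and
        bounding \<open>m\<close> by \<open>r\<close> in the first and by \<open>k - r\<close> in
        the second term gives \<open>2 * r * (k - r)\<close>.\<close>
      have "m * (real k - real r) \<le> real r * (real k - real r)" "m * real r \<le> (real k - real r) * real r"
        using m rk by (auto intro!: mult_right_mono)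
      then have "m * real k + L \<le> 2 * (real r * (real k - real r) + L)" using L0 by (simp add: algebra_simps)
      then show ?thesis using nh by (simp add: divide_right_mono)
    qed
    also have "\<dots> = 2 * 10 ^ 7 * Psi0 k p r n lam" by (simp add: Psi0_def L_def)
    finally show ?thesis .
  qed
  then show "expected_loss n p r Vsel Bst V Ls \<le> min (2 * real (min r (p - r))) (2 * 10 ^ 7 * Psi0 k p r n lam)"
    using expected_loss_le[OF n0 agg] by simp
qed

lemma sparse_rate:
  assumes \<kappa>: "\<kappa> > 1" and q: "0 < q" "q < 2" and n: "n \<ge> 1" and k: "k = k_eff q s p r n lam"
    and C0: "10 ^ 6 \<le> C0" "q / (2 - q) < C0"
    and nh_ge: "C0 * real k * (real r + ln (exp 1 * real p / real k)) \<le> real n * hfun lam"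
    and n1: "C0 * max (real k * ln (exp 1 * real p / real k)) (ln lam) \<le> real n"
    and agg: "aggregated_estimator n p r k Vsel Bst"
    and Th: "in_Theta \<kappa> q s p r lam V Ls" and meas: "estimator_measurable n p r Vsel Bst V Ls"
  shows "expected_loss n p r Vsel Bst V Ls
    \<le> min (2 * real (min r (p - r))) ((162 * (\<kappa> + 1) * (q / (2 - q)) + 2 * 10 ^ 7) * Psi k p r n lam)"
proof -
  interpret spiked r p V Ls lam \<kappa> by (rule spiked_in_Theta[OF \<kappa> Th])
  have n0: "n > 0" using n by simp
  have kp: "k \<le> p" by (rule aggregated_card_le[OF agg])
  define c where "c = q / (2 - q)"
  have c: "0 \<le> c" "c < C0" using q C0 by (auto simp: c_def)
  define L where "L = real k * ln (exp 1 * real p / real k)"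
  have L0: "0 \<le> L" unfolding L_def by (rule entropy_nonneg[OF kp])
  have nh: "0 < real n * hfun lam" using n0 lam by (simp add: hfun_def)
  have Psi: "Psi k p r n lam = (real r * real k + L) / (real n * hfun lam)" by (simp add: Psi_def L_def)
  have Psi0: "0 \<le> Psi k p r n lam" unfolding Psi using L0 nh by simp
  have C: "0 \<le> 162 * (\<kappa> + 1) * c + 2 * 10 ^ 7" using \<kappa> c by simp
  have "expected_loss n p r Vsel Bst V Ls \<le> (162 * (\<kappa> + 1) * c + 2 * 10 ^ 7) * Psi k p r n lam"
  proof (cases "r = 0")
    case True
    then have "expected_loss n p r Vsel Bst V Ls \<le> 0" using expected_loss_le[OF n0 agg] by simp
    also have "0 \<le> (162 * (\<kappa> + 1) * c + 2 * 10 ^ 7) * Psi k p r n lam" using C Psi0 by (rule mult_nonneg_nonneg)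
    finally show ?thesis .
  next
    case False
    have s: "weak_lq q p r V \<le> s" using Th by (simp add: in_Theta_def)
    \<comment> \<open>With a nonpositive radius all rows would vanish, which is impossible for a
      frame with \<open>r > 0\<close>.\<close>
    have s0: "0 < s"
    proof (rule ccontr)
      assume "\<not> 0 < s"
      obtain \<sigma> where \<sigma>: "bij_betw \<sigma> {..<p} {..<p}" "\<And>j. j < p \<Longrightarrow> real (Suc j) * row_norm r V (\<sigma> j) powr q \<le> s"
        using weak_lq_rows[OF q(1) s] by blast
      have "row_norm r V i = 0" if "i < p" for i
      proof -
        have "i \<in> \<sigma> ` {..<p}" using \<sigma>(1) that by (simp add: bij_betw_def)
        then obtain j where j: "j < p" "i = \<sigma> j" by blast
        have "real (Suc j) * row_norm r V i powr q \<le> 0" using \<sigma>(2)[OF j(1)] \<open>\<not> 0 < s\<close> unfolding j(2) by (meson not_less order_trans)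
        then have "row_norm r V i powr q \<le> 0" by (simp add: mult_le_0_iff)
        then show ?thesis by simp
      qed
      then have "(norm ((Ip - coord {}) * Vf))\<^sup>2 = 0" by (subst norm_tail_rows) auto
      then show False using rank_le_card_plus_tail[of "{}"] False by simp
    qed
    have p0: "p > 0" using frame_le[OF V] False by simp
    have k1: "1 \<le> k" unfolding k by (rule k_eff_pos[OF q s0 lam n0 p0])
    obtain B where B: "B \<subseteq> {..<p}" "card B = k"
      and tail: "(\<Sum>i\<in>{..<p} - B. (row_norm r V i)\<^sup>2) \<le> (if k < p then q / (2 - q) * (real k * (s / real k) powr (2 / q)) else 0)"
      using weak_lq_tail[OF q s less_imp_le[OF s0] k1 kp] by blast
    have "(if k < p then q / (2 - q) * (real k * (s / real k) powr (2 / q)) else 0) \<le> c * Psi k p r n lam"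
    proof (cases "k < p")
      case True
      have "real k * (s / real k) powr (2 / q) \<le> real k * ((real r + ln (exp 1 * real p / real k)) / (real n * hfun lam))"
        by (intro mult_left_mono k_eff_balance[OF q less_imp_le[OF s0] lam n0 k k1 True]) simp
      also have "\<dots> = Psi k p r n lam" by (simp add: Psi_def algebra_simps)
      finally have "c * (real k * (s / real k) powr (2 / q)) \<le> c * Psi k p r n lam" using c(1) by (rule mult_left_mono)
      then show ?thesis using True by (simp only: c_def if_True)
    qed (use c Psi0 in simp)
    then have D: "(norm ((Ip - coord B) * Vf))\<^sup>2 \<le> c * Psi k p r n lam"
      using tail unfolding norm_tail_rows[OF B(1)] by linarith
    have "C0 * (real r * real k + L) \<le> real n * hfun lam" using nh_ge by (simp add: L_def algebra_simps)
    then have "C0 * Psi k p r n lam \<le> 1" unfolding Psi using nh by (simp add: divide_le_eq)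
    \<comment> \<open>A tail strictly below one is what yields \<open>r \<le> k\<close>; for this
      reason \<open>C0\<close> strictly exceeds \<open>q / (2 - q)\<close>.\<close>
    then have "c * Psi k p r n lam < 1"
    proof (cases "Psi k p r n lam = 0")
      case False
      then have "c * Psi k p r n lam < C0 * Psi k p r n lam" using Psi0 c by (intro mult_strict_right_mono) auto
      then show ?thesis using \<open>C0 * Psi k p r n lam \<le> 1\<close> by simp
    qed simp
    then have "real r < real k + 1" using rank_le_card_plus_tail[OF B(1)] D B(2) by linarith
    then have rk: "r \<le> k" by linarith
    have mono: "10 ^ 6 * x \<le> real n" if "x \<le> max L (ln lam)" for x
    proof -
      have "10 ^ 6 * x \<le> 10 ^ 6 * max L (ln lam)" using that by simp
      also have "\<dots> \<le> C0 * max L (ln lam)" using C0(1) L0 by (intro mult_right_mono) auto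
      finally show ?thesis using n1 by (simp add: L_def)
    qed
    have "expected_loss n p r Vsel Bst V Ls \<le> 162 * (\<kappa> + 1) * (c * Psi k p r n lam) + 10 ^ 7 * (real r * real k + L) / (real n * hfun lam)"
      unfolding L_def
      by (rule rate_bound[OF n0 _ rk kp B D _ _ agg meas])
         (use False mono[of L] mono[of "ln lam"] in \<open>auto simp: L_def\<close>)
    also have "\<dots> = (162 * (\<kappa> + 1) * c + 10 ^ 7) * Psi k p r n lam" by (simp add: Psi algebra_simps)
    also have "\<dots> \<le> (162 * (\<kappa> + 1) * c + 2 * 10 ^ 7) * Psi k p r n lam" using Psi0 by (intro mult_right_mono) auto
    finally show ?thesis .
  qed
  then show ?thesis using expected_loss_le[OF n0 agg] by (simp add: c_def)
qed


theorem theorem4: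
  fixes \<kappa> q :: real
  assumes "\<kappa> > 1" and "0 \<le> q" and "q < 2"
  shows "\<exists>C0 C :: real.
    (\<forall>(s::real) (p::nat) (r::nat) (n::nat) (lam::real) Vsel Bst.
       let k = k_eff q s p r n lam in
       n \<ge> 1 \<longrightarrow>
       lam \<ge> C0 * sqrt (ln (real n) / real n) \<longrightarrow>
       real n * hfun lam \<ge> C0 * real k * (real r + ln (exp 1 * real p / real k)) \<longrightarrow>
       real n \<ge> C0 * max (real k * ln (exp 1 * real p / real k)) (ln lam) \<longrightarrow>
       aggregated_estimator n p r k Vsel Bst \<longrightarrow>
       (\<forall>V Ls. in_Theta \<kappa> q s p r lam V Ls \<longrightarrow>
          estimator_measurable n p r Vsel Bst V Ls \<longrightarrow>
          expected_loss n p r Vsel Bst V Ls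
            \<le> min (2 * real (min r (p - r))) (C * Psi k p r n lam)))
    \<and>
    (q = 0 \<longrightarrow>
     (\<forall>(s::real) (p::nat) (r::nat) (n::nat) (lam::real) Vsel Bst.
       let k = k_eff q s p r n lam in
       n \<ge> 1 \<longrightarrow>
       lam \<ge> C0 * sqrt (ln (real n) / real n) \<longrightarrow>
       real n \<ge> C0 * max (real k * ln (exp 1 * real p / real k)) (ln lam) \<longrightarrow>
       aggregated_estimator n p r k Vsel Bst \<longrightarrow>
       (\<forall>V Ls. in_Theta \<kappa> q s p r lam V Ls \<longrightarrow>
          estimator_measurable n p r Vsel Bst V Ls \<longrightarrow>
          expected_loss n p r Vsel Bst V Ls
            \<le> min (2 * real (min r (p - r))) (C * Psi0 k p r n lam))))"
proof -
  \<comment> \<open>The first summand serves the exponential tails, the others make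
    \<open>C0\<close> exceed the tail constant \<open>q / (2 - q)\<close> strictly.\<close>
  define C0 where "C0 = 10 ^ 6 + q / (2 - q) + 1"
  define C where "C = 162 * (\<kappa> + 1) * (q / (2 - q)) + 2 * 10 ^ 7"
  have C0: "10 ^ 6 \<le> C0" "q / (2 - q) < C0" using assms by (auto simp: C0_def)
  \<comment> \<open>The logarithm of \<open>lam\<close> may be negative, but its maximum with a
    nonnegative entropy is not, so \<open>C0\<close> may be lowered to
    \<open>10 ^ 6\<close>.\<close>
  have scale: "10 ^ 6 * max L x \<le> y" if "C0 * max L x \<le> y" "0 \<le> L" for L x y :: real
  proof -
    have "10 ^ 6 * max L x \<le> C0 * max L x" using C0(1) that(2) by (intro mult_right_mono) auto
    then show ?thesis using that(1) by linarith
  qed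
  have exact: "expected_loss n p r Vsel Bst V Ls \<le> min (2 * real (min r (p - r))) (C * Psi0 k p r n lam)" "r \<le> k"
    if "q = 0" "n \<ge> 1" "k = k_eff q s p r n lam"
      "C0 * max (real k * ln (exp 1 * real p / real k)) (ln lam) \<le> real n"
      "aggregated_estimator n p r k Vsel Bst" "in_Theta \<kappa> q s p r lam V Ls" "estimator_measurable n p r Vsel Bst V Ls"
    for s p r n lam Vsel Bst k V Ls
  proof -
    have e: "10 ^ 6 * max (real k * ln (exp 1 * real p / real k)) (ln lam) \<le> real n"
      by (rule scale[OF that(4) entropy_nonneg[OF aggregated_card_le[OF that(5)]]])
    show "expected_loss n p r Vsel Bst V Ls \<le> min (2 * real (min r (p - r))) (C * Psi0 k p r n lam)" "r \<le> k"
      using exact_sparse_rate[OF assms(1) that(2) that(3)[unfolded that(1)] e that(5) that(6)[unfolded that(1)] that(7)]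
      by (simp_all add: C_def that(1))
  qed
  have weak: "expected_loss n p r Vsel Bst V Ls \<le> min (2 * real (min r (p - r))) (C * Psi k p r n lam)"
    if h: "n \<ge> 1" "k = k_eff q s p r n lam"
      "C0 * real k * (real r + ln (exp 1 * real p / real k)) \<le> real n * hfun lam"
      "C0 * max (real k * ln (exp 1 * real p / real k)) (ln lam) \<le> real n"
      "aggregated_estimator n p r k Vsel Bst" "in_Theta \<kappa> q s p r lam V Ls" "estimator_measurable n p r Vsel Bst V Ls"
    for s p r n lam Vsel Bst k V Ls
  proof (cases "q = 0")
    case True
    have lam: "0 < lam" using h(6) by (simp add: in_Theta_def)
    \<comment> \<open>For \<open>q = 0\<close> the first claim is inherited from the sharper one,
      since \<open>r * (k - r) \<le> r * k\<close>.\<close>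
    have "Psi0 k p r n lam \<le> Psi k p r n lam"
      using exact(2)[OF True h(1,2,4-7)] h(1) lam unfolding Psi0_def Psi_def
      by (intro divide_right_mono add_right_mono mult_left_mono) (auto simp: hfun_def)
    moreover have "0 \<le> C" by (simp add: C_def True)
    ultimately have "C * Psi0 k p r n lam \<le> C * Psi k p r n lam" by (rule mult_left_mono)
    then show ?thesis using exact(1)[OF True h(1,2,4-7)] by simp
  next
    case False
    then have q: "0 < q" using assms by simp
    show ?thesis unfolding C_def
      by (rule sparse_rate[OF assms(1) q assms(3) h(1,2) C0 h(3-7)])
  qed
  show ?thesis
    by (rule exI[of _ C0], rule exI[of _ C]) (auto simp only: Let_def intro: weak exact)
qed

end
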